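(* Let $\mathcal U$ be an upper cluster algebra over a field $k$. Then the canonical module $\omega_{\mathcal U/k}$ is free of rank one over $\mathcal U$, and it is generated by a log volume form $\mu_{\mathbf x}$ in any cluster $\mathbf x$.
   Context: Cluster algebras. Let $k$ be a field and $\mathcal F$ a purely transcendental extension of $k$ of finite transcendence degree $n$. A seed $(Q,\mathbf x)$ for $\mathcal F$ over $k$ consists of: a finite quiver $Q$ with vertices $1,\dots,n$, without loops or directed 2-cycles (multiple arrows allowed); a cluster $\mathbf x=\{x_1,\dots,x_n\}$ of algebraically independent elements with $\mathcal F=k(x_1,\dots,x_n)$, where $x_i$ is the cluster variable at vertex $i$; and a subset of vertices designated frozen, the other vertices being mutable, with the convention that every vertex touching no arrow is frozen. Mutation of the seed at a mutable vertex $\ell$ gives a new seed: the quiver is changed by (1) adding an arrow $i\to j$ for each pair of arrows $i\to \ell\to j$, (2) reversing all arrows incident to $\ell$, (3) cancelling directed 2-cycles in pairs; all cluster variables stay the same except $x_\ell$, which is replaced by $x_\ell'=\big(\prod_{i\to \ell}x_i+\prod_{\ell\to i}x_i\big)x_\ell^{-1}$ (products over all arrows into, resp. out of, $\ell$); frozen vertices stay frozen. Seeds are mutation-equivalent if related by a sequence of mutations. The upper cluster algebra $\mathcal U$ of $(Q,\mathbf x)$ is the intersection in $\mathcal F$ of the Laurent rings $k[y_1^{\pm1},\dots,y_n^{\pm1}]$ over all clusters $\mathbf y=\{y_1,\dots,y_n\}$ of seeds mutation-equivalent to $(Q,\mathbf x)$. By a cluster of $\mathcal U$ is meant one of these clusters.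 ($\mathcal U$ need not be Noetherian.) Canonical modules. For a normal domain $S$ over $k$ whose fraction field $\mathcal F(S)$ has transcendence degree $n$ over $k$, the canonical module is $\omega_{S/k}:=(\Lambda^n_S\Omega_{S/k})^{**}$, where $(-)^*=\operatorname{Hom}_S(-,S)$. If $S$ is regular, $\omega_{S/k}=\Lambda_S^n\Omega_{S/k}$. By localization there is a natural embedding $\omega_{S/k}\subseteq \omega_{\mathcal F(S)/k}=\Lambda^n_{\mathcal F(S)}\Omega_{\mathcal F(S)/k}$. The log volume form of a cluster $\mathbf x=\{x_1,\dots,x_n\}$ (defined up to sign, depending on the ordering of the indices) is $\mu_{\mathbf x}=\dfrac{dx_1\wedge\cdots\wedge dx_n}{x_1\cdots x_n}$, regarded as an element of $\Lambda^n_{\mathcal F}\Omega_{\mathcal F/k}$; the claim says that $\omega_{\mathcal U/k}$, viewed inside this space, is $\mathcal U\mu_{\mathbf x}$. *)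

theory Defs
  imports
    "HOL-Algebra.Module"
    "HOL-Algebra.AbelCoset"
    "HOL-Algebra.Generated_Fields"
    "HOL-Algebra.Algebraic_Closure_Type"
    "HOL-Library.Poly_Mapping"
begin

section \<open>Modules over a commutative ring\<close>

definition free_module :: "('a, 'm) ring_scheme \<Rightarrow> 'x set \<Rightarrow> ('a, 'x \<Rightarrow> 'a) module" where
  "free_module R B =
     \<lparr>carrier = {f. (\<forall>x. f x \<in> carrier R) \<and> (\<forall>x. x \<notin> B \<longrightarrow> f x = \<zero>\<^bsub>R\<^esub>) \<and> finite {x. f x \<noteq> \<zero>\<^bsub>R\<^esub>}},
      monoid.mult = undefined, one = undefined,
      ring.zero = (\<lambda>_. \<zero>\<^bsub>R\<^esub>), add = (\<lambda>f g x. f x \<oplus>\<^bsub>R\<^esub> g x),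
      module.smult = (\<lambda>a f x. a \<otimes>\<^bsub>R\<^esub> f x)\<rparr>"

definition free_gen :: "('a, 'm) ring_scheme \<Rightarrow> 'x \<Rightarrow> 'x \<Rightarrow> 'a" where
  "free_gen R x = (\<lambda>y. if y = x then \<one>\<^bsub>R\<^esub> else \<zero>\<^bsub>R\<^esub>)"

definition submodule_span :: "('a, 'm) ring_scheme \<Rightarrow> ('a, 'b) module \<Rightarrow> 'b set \<Rightarrow> 'b set" where
  "submodule_span R M A = \<Inter> {N. submodule N R M \<and> A \<subseteq> N}"

definition quot_module :: "('a, 'b) module \<Rightarrow> 'b set \<Rightarrow> ('a, 'b set) module" where
  "quot_module M N =
     \<lparr>carrier = a_rcosets\<^bsub>M\<^esub> N,
      monoid.mult = undefined, one = undefined,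
      ring.zero = N, add = set_add M,
      module.smult = (\<lambda>a C. \<Union>x\<in>C. N +>\<^bsub>M\<^esub> (a \<odot>\<^bsub>M\<^esub> x))\<rparr>"

definition dual_module :: "('a, 'm) ring_scheme \<Rightarrow> ('a, 'b) module \<Rightarrow> ('a, 'b \<Rightarrow> 'a) module" where
  "dual_module R M =
     \<lparr>carrier = {f \<in> carrier M \<rightarrow>\<^sub>E carrier R.
         (\<forall>x\<in>carrier M. \<forall>y\<in>carrier M. f (x \<oplus>\<^bsub>M\<^esub> y) = f x \<oplus>\<^bsub>R\<^esub> f y) \<and>
         (\<forall>a\<in>carrier R. \<forall>x\<in>carrier M. f (a \<odot>\<^bsub>M\<^esub> x) = a \<otimes>\<^bsub>R\<^esub> f x)},
      monoid.mult = undefined, one = undefined,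
      ring.zero = (\<lambda>x\<in>carrier M. \<zero>\<^bsub>R\<^esub>),
      add = (\<lambda>f g. \<lambda>x\<in>carrier M. f x \<oplus>\<^bsub>R\<^esub> g x),
      module.smult = (\<lambda>a f. \<lambda>x\<in>carrier M. a \<otimes>\<^bsub>R\<^esub> f x)\<rparr>"

definition free_of_rank_one :: "('a, 'm) ring_scheme \<Rightarrow> ('a, 'b) module \<Rightarrow> bool" where
  "free_of_rank_one R M \<longleftrightarrow>
     (\<exists>w\<in>carrier M. bij_betw (\<lambda>a. a \<odot>\<^bsub>M\<^esub> w) (carrier R) (carrier M))"

text \<open>The exterior power is the free module on \<open>n\<close>-tuples of module elements (as lists) modulo
  multilinearity and the alternating relations; its generators are the wedges \<open>m\<^sub>1 \<and> \<dots> \<and> m\<^sub>n\<close>.\<close>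

definition tuples :: "'b set \<Rightarrow> nat \<Rightarrow> 'b list set" where
  "tuples A n = {xs. length xs = n \<and> set xs \<subseteq> A}"

definition ext_relations :: "('a, 'm) ring_scheme \<Rightarrow> ('a, 'b) module \<Rightarrow> nat \<Rightarrow> ('b list \<Rightarrow> 'a) set" where
  "ext_relations R M n =
     (let T = free_module R (tuples (carrier M) n); e = free_gen R in
       {e (xs[i := y \<oplus>\<^bsub>M\<^esub> z]) \<ominus>\<^bsub>T\<^esub> (e (xs[i := y]) \<oplus>\<^bsub>T\<^esub> e (xs[i := z])) | xs i y z.
          xs \<in> tuples (carrier M) n \<and> i < n \<and> y \<in> carrier M \<and> z \<in> carrier M} \<union>
       {e (xs[i := a \<odot>\<^bsub>M\<^esub> y]) \<ominus>\<^bsub>T\<^esub> a \<odot>\<^bsub>T\<^esub> e (xs[i := y]) | xs i a y.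
          xs \<in> tuples (carrier M) n \<and> i < n \<and> a \<in> carrier R \<and> y \<in> carrier M} \<union>
       {e xs | xs. xs \<in> tuples (carrier M) n \<and> (\<exists>i j. i < j \<and> j < n \<and> xs ! i = xs ! j)})"

definition ext_span :: "('a, 'm) ring_scheme \<Rightarrow> ('a, 'b) module \<Rightarrow> nat \<Rightarrow> ('b list \<Rightarrow> 'a) set" where
  "ext_span R M n =
     submodule_span R (free_module R (tuples (carrier M) n)) (ext_relations R M n)"

definition ext_power ::
    "('a, 'm) ring_scheme \<Rightarrow> ('a, 'b) module \<Rightarrow> nat \<Rightarrow> ('a, ('b list \<Rightarrow> 'a) set) module" where
  "ext_power R M n = quot_module (free_module R (tuples (carrier M) n)) (ext_span R M n)"

definition wedge ::
    "('a, 'm) ring_scheme \<Rightarrow> ('a, 'b) module \<Rightarrow> nat \<Rightarrow> 'b list \<Rightarrow> ('b list \<Rightarrow> 'a) set" where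
  "wedge R M n xs =
     ext_span R M n +>\<^bsub>free_module R (tuples (carrier M) n)\<^esub> free_gen R xs"


section \<open>Kaehler differentials\<close>

definition kaehler_relations :: "'a set \<Rightarrow> ('a, 'm) ring_scheme \<Rightarrow> ('a \<Rightarrow> 'a) set" where
  "kaehler_relations K S =
     (let T = free_module S (carrier S); \<delta> = free_gen S in
       {\<delta> (a \<oplus>\<^bsub>S\<^esub> b) \<ominus>\<^bsub>T\<^esub> (\<delta> a \<oplus>\<^bsub>T\<^esub> \<delta> b) | a b. a \<in> carrier S \<and> b \<in> carrier S} \<union>
       {\<delta> (a \<otimes>\<^bsub>S\<^esub> b) \<ominus>\<^bsub>T\<^esub> (a \<odot>\<^bsub>T\<^esub> \<delta> b \<oplus>\<^bsub>T\<^esub> b \<odot>\<^bsub>T\<^esub> \<delta> a) | a b. a \<in> carrier S \<and> b \<in> carrier S} \<union>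
       {\<delta> c | c. c \<in> K})"

definition kaehler_span :: "'a set \<Rightarrow> ('a, 'm) ring_scheme \<Rightarrow> ('a \<Rightarrow> 'a) set" where
  "kaehler_span K S = submodule_span S (free_module S (carrier S)) (kaehler_relations K S)"

definition kaehler :: "'a set \<Rightarrow> ('a, 'm) ring_scheme \<Rightarrow> ('a, ('a \<Rightarrow> 'a) set) module" where
  "kaehler K S = quot_module (free_module S (carrier S)) (kaehler_span K S)"

definition kdiff :: "'a set \<Rightarrow> ('a, 'm) ring_scheme \<Rightarrow> 'a \<Rightarrow> ('a \<Rightarrow> 'a) set" where
  "kdiff K S a = kaehler_span K S +>\<^bsub>free_module S (carrier S)\<^esub> free_gen S a"


section \<open>Canonical modules\<close>

text \<open>Throughout, \<open>n\<close> is the transcendence degree over \<open>K\<close> of the fraction field.\<close>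

definition top_forms ::
    "'a set \<Rightarrow> ('a, 'm) ring_scheme \<Rightarrow> nat \<Rightarrow> ('a, (('a \<Rightarrow> 'a) set list \<Rightarrow> 'a) set) module" where
  "top_forms K S n = ext_power S (kaehler K S) n"

definition dwedge ::
    "'a set \<Rightarrow> ('a, 'm) ring_scheme \<Rightarrow> 'a list \<Rightarrow> (('a \<Rightarrow> 'a) set list \<Rightarrow> 'a) set" where
  "dwedge K S as = wedge S (kaehler K S) (length as) (map (kdiff K S) as)"

definition canonical_module ::
    "'a set \<Rightarrow> ('a, 'm) ring_scheme \<Rightarrow> nat \<Rightarrow>
     ('a, ((('a \<Rightarrow> 'a) set list \<Rightarrow> 'a) set \<Rightarrow> 'a) \<Rightarrow> 'a) module" where
  "canonical_module K S n = dual_module S (dual_module S (top_forms K S n))"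

text \<open>From here on the ambient field is a type \<open>'f\<close>, and \<open>S\<close> is a subring of it with fraction
  field all of \<open>'f\<close>. A functional \<open>\<psi>\<close> in the \<open>S\<close>-dual of the top forms of \<open>S\<close> localizes to the
  functional on the top forms of \<open>'f\<close> that takes the same values on
  \<open>da\<^sub>1 \<and> \<dots> \<and> da\<^sub>n\<close> with all \<open>a\<^sub>i \<in> S\<close>. As the top forms of \<open>'f\<close> coincide with their
  bidual, an element \<open>\<phi>\<close> of the canonical module of \<open>S\<close> then localizes to the form \<open>v\<close> at which
  every such localized \<open>\<psi>\<close> takes the value \<open>\<phi> \<psi>\<close>.\<close>

abbreviation ambient :: "'f::field ring" where
  "ambient \<equiv> ring_of_type_algebra"

definition localized_functional ::
    "'f::field set \<Rightarrow> 'f ring \<Rightarrow> nat \<Rightarrow> ((('f \<Rightarrow> 'f) set list \<Rightarrow> 'f) set \<Rightarrow> 'f) \<Rightarrow>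
     ((('f \<Rightarrow> 'f) set list \<Rightarrow> 'f) set \<Rightarrow> 'f)" where
  "localized_functional K S n \<psi> =
     (THE \<psi>'. \<psi>' \<in> carrier (dual_module ambient (top_forms K ambient n)) \<and>
        (\<forall>as \<in> tuples (carrier S) n. \<psi>' (dwedge K ambient as) = \<psi> (dwedge K S as)))"

definition canonical_embedding ::
    "'f::field set \<Rightarrow> 'f ring \<Rightarrow> nat \<Rightarrow>
     (((('f \<Rightarrow> 'f) set list \<Rightarrow> 'f) set \<Rightarrow> 'f) \<Rightarrow> 'f) \<Rightarrow> (('f \<Rightarrow> 'f) set list \<Rightarrow> 'f) set" where
  "canonical_embedding K S n \<phi> =
     (THE v. v \<in> carrier (top_forms K ambient n) \<and>
        (\<forall>\<psi> \<in> carrier (dual_module S (top_forms K S n)). localized_functional K S n \<psi> v = \<phi> \<psi>))"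

definition log_volume_form :: "'f::field set \<Rightarrow> 'f list \<Rightarrow> (('f \<Rightarrow> 'f) set list \<Rightarrow> 'f) set" where
  "log_volume_form K ys =
     inverse (prod_list ys) \<odot>\<^bsub>top_forms K ambient (length ys)\<^esub> dwedge K ambient ys"


section \<open>Seeds and upper cluster algebras\<close>

text \<open>A quiver is given by its arrow multiplicities: \<open>q i j\<close> is the number of arrows from \<open>i\<close>
  to \<open>j\<close>.\<close>

definition is_quiver :: "nat \<Rightarrow> (nat \<Rightarrow> nat \<Rightarrow> nat) \<Rightarrow> bool" where
  "is_quiver n q \<longleftrightarrow>
     (\<forall>i j. q i j > 0 \<longrightarrow> i \<in> {1..n} \<and> j \<in> {1..n}) \<and>
     (\<forall>i. q i i = 0) \<and>
     (\<forall>i j. q i j = 0 \<or> q j i = 0)"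

text \<open>The three steps are: add an arrow for each path through \<open>l\<close>, reverse the arrows at \<open>l\<close>,
  cancel 2-cycles (by truncated subtraction).\<close>

definition mutate_quiver :: "nat \<Rightarrow> (nat \<Rightarrow> nat \<Rightarrow> nat) \<Rightarrow> nat \<Rightarrow> nat \<Rightarrow> nat" where
  "mutate_quiver l q =
     (let q1 = (\<lambda>i j. q i j + q i l * q l j);
          q2 = (\<lambda>i j. if i = l \<or> j = l then q1 j i else q1 i j)
      in (\<lambda>i j. q2 i j - q2 j i))"

record 'f seed =
  arrows :: "nat \<Rightarrow> nat \<Rightarrow> nat"
  frozen :: "nat set"
  cvar :: "nat \<Rightarrow> 'f"

text \<open>Polynomials in the variables indexed by \<open>I\<close> are finitely supported functions from
  finitely supported exponent vectors to coefficients.\<close>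

definition alg_independent :: "'f::field set \<Rightarrow> nat set \<Rightarrow> (nat \<Rightarrow> 'f) \<Rightarrow> bool" where
  "alg_independent K I x \<longleftrightarrow>
     (\<forall>p :: (nat \<Rightarrow>\<^sub>0 nat) \<Rightarrow>\<^sub>0 'f.
        (\<forall>m. Poly_Mapping.lookup p m \<in> K) \<and>
        (\<forall>m \<in> Poly_Mapping.keys p. Poly_Mapping.keys m \<subseteq> I) \<and>
        (\<Sum>m \<in> Poly_Mapping.keys p. Poly_Mapping.lookup p m *
           (\<Prod>i \<in> Poly_Mapping.keys m. x i ^ Poly_Mapping.lookup m i)) = 0
        \<longrightarrow> p = 0)"

definition is_seed :: "'f::field set \<Rightarrow> nat \<Rightarrow> 'f seed \<Rightarrow> bool" where
  "is_seed K n s \<longleftrightarrow>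
     is_quiver n (arrows s) \<and>
     frozen s \<subseteq> {1..n} \<and>
     (\<forall>i\<in>{1..n}. (\<forall>j. arrows s i j = 0 \<and> arrows s j i = 0) \<longrightarrow> i \<in> frozen s) \<and>
     alg_independent K {1..n} (cvar s) \<and>
     generate_field ambient (K \<union> cvar s ` {1..n}) = UNIV"

definition mutate_seed :: "nat \<Rightarrow> nat \<Rightarrow> 'f::field seed \<Rightarrow> 'f seed" where
  "mutate_seed n l s =
     \<lparr>arrows = mutate_quiver l (arrows s), frozen = frozen s,
      cvar = (cvar s)(l :=
        ((\<Prod>i\<in>{1..n}. cvar s i ^ arrows s i l) + (\<Prod>i\<in>{1..n}. cvar s i ^ arrows s l i))
          * inverse (cvar s l))\<rparr>"

inductive mutation_equivalent :: "nat \<Rightarrow> 'f::field seed \<Rightarrow> 'f seed \<Rightarrow> bool" for n s where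
  refl: "mutation_equivalent n s s"
| step: "mutation_equivalent n s t \<Longrightarrow> l \<in> {1..n} - frozen t \<Longrightarrow>
         mutation_equivalent n s (mutate_seed n l t)"

definition clusters :: "nat \<Rightarrow> 'f::field seed \<Rightarrow> 'f set set" where
  "clusters n s = {cvar t ` {1..n} | t. mutation_equivalent n s t}"

definition laurent_ring :: "'f::field set \<Rightarrow> 'f set \<Rightarrow> 'f set" where
  "laurent_ring K Y = generate_ring ambient (K \<union> Y \<union> inverse ` Y)"

definition upper_cluster_algebra :: "'f::field set \<Rightarrow> nat \<Rightarrow> 'f seed \<Rightarrow> 'f ring" where
  "upper_cluster_algebra K n s =
     ambient\<lparr>carrier := \<Inter>Y\<in>clusters n s. laurent_ring K Y\<rparr>"

end

theory Submission
  imports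
    Defs
    "HOL-Combinatorics.Permutations"
    "HOL-Computational_Algebra.Fraction_Field"
begin

section \<open>Subrings of the ambient field\<close>

lemma ambient_ops [simp]:
  "carrier (ambient :: 'f::field ring) = UNIV"
  "\<one>\<^bsub>(ambient :: 'f ring)\<^esub> = 1" "\<zero>\<^bsub>(ambient :: 'f ring)\<^esub> = 0"
  "a \<oplus>\<^bsub>(ambient :: 'f ring)\<^esub> b = a + b" "a \<otimes>\<^bsub>(ambient :: 'f ring)\<^esub> b = a * b"
  by (simp_all add: ring_of_type_algebra_def)

lemma ambient_a_inv [simp]: "\<ominus>\<^bsub>(ambient :: 'f::field ring)\<^esub> a = - a"
proof -
  interpret cring "ambient :: 'f ring" by (rule cring_from_type_algebra)
  show ?thesis by (rule minus_equality) auto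
qed

lemma ambient_m_inv [simp]: "a \<noteq> 0 \<Longrightarrow> m_inv (ambient :: 'f::field ring) a = inverse a"
proof -
  assume "a \<noteq> 0"
  interpret cring "ambient :: 'f ring" by (rule cring_from_type_algebra)
  show ?thesis by (rule comm_inv_char) (use \<open>a \<noteq> 0\<close> in auto)
qed

lemma subring_ambient_iff:
  "subring C (ambient :: 'f::field ring) \<longleftrightarrow>
     1 \<in> C \<and> (\<forall>a\<in>C. - a \<in> C) \<and> (\<forall>a\<in>C. \<forall>b\<in>C. a + b \<in> C) \<and> (\<forall>a\<in>C. \<forall>b\<in>C. a * b \<in> C)"
    (is "?l = ?r")
proof -
  interpret cring "ambient :: 'f ring" by (rule cring_from_type_algebra)
  show ?thesis
  proof
    assume ?l
    from subringE[OF this] show ?r by auto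
  next
    assume ?r
    then show ?l by (intro subringI) auto
  qed
qed

context
  fixes C :: "'f::field set"
  assumes C: "subring C ambient"
begin

lemma subring_one: "1 \<in> C"
  and subring_uminus: "a \<in> C \<Longrightarrow> - a \<in> C"
  and subring_add: "a \<in> C \<Longrightarrow> b \<in> C \<Longrightarrow> a + b \<in> C"
  and subring_mult: "a \<in> C \<Longrightarrow> b \<in> C \<Longrightarrow> a * b \<in> C"
  using C by (auto simp: subring_ambient_iff)

lemma subring_diff: "a \<in> C \<Longrightarrow> b \<in> C \<Longrightarrow> a - b \<in> C"
  using subring_add[of a "- b"] subring_uminus by simp

lemma subring_zero: "0 \<in> C"
  using subring_diff[OF subring_one subring_one] by simp

lemma subring_power: "a \<in> C \<Longrightarrow> a ^ n \<in> C"
  by (induction n) (auto intro: subring_one subring_mult)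

lemma subring_sum: "(\<And>i. i \<in> I \<Longrightarrow> h i \<in> C) \<Longrightarrow> sum h I \<in> C"
  by (induction I rule: infinite_finite_induct) (auto intro: subring_zero subring_add)

lemma subring_prod: "(\<And>i. i \<in> I \<Longrightarrow> h i \<in> C) \<Longrightarrow> prod h I \<in> C"
  by (induction I rule: infinite_finite_induct) (auto intro: subring_one subring_mult)

lemmas subring_closed = subring_one subring_uminus subring_add subring_mult subring_diff
  subring_zero subring_power subring_sum subring_prod

end

lemma subring_Inter_ambient:
  assumes "\<And>Y. Y \<in> \<Y> \<Longrightarrow> subring (f Y) (ambient :: 'f::field ring)"
  shows "subring (\<Inter>Y\<in>\<Y>. f Y) (ambient :: 'f ring)"
  using assms by (auto simp: subring_ambient_iff)

abbreviation gen :: "'f::field set \<Rightarrow> 'f set" where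
  "gen A \<equiv> generate_ring ambient A"

lemma gen_subring: "subring (gen A) ambient"
  using generate_ring.one[of ambient A] generate_ring.a_inv[of _ ambient A]
    generate_ring.eng_add[of _ ambient A] generate_ring.eng_mult[of _ ambient A]
  by (auto simp: subring_ambient_iff)

lemma gen_incl: "a \<in> A \<Longrightarrow> a \<in> gen A"
  by (rule generate_ring.incl)

lemma gen_least:
  assumes "subring C ambient" "A \<subseteq> C" shows "gen A \<subseteq> C"
proof
  fix a assume "a \<in> gen A"
  then show "a \<in> C"
    by induction (use assms in \<open>auto intro: subring_closed[OF assms(1)]\<close>)
qed

lemma gen_mono: "A \<subseteq> gen B \<Longrightarrow> gen A \<subseteq> gen B"
  by (rule gen_least[OF gen_subring])

lemma gen_mono': "A \<subseteq> B \<Longrightarrow> gen A \<subseteq> gen B"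
  by (rule gen_mono) (auto intro: gen_incl)

lemmas gen_closed = subring_closed[OF gen_subring]

lemma laurent_ring_subring: "subring (laurent_ring K Y) ambient"
  unfolding laurent_ring_def by (rule gen_subring)

section \<open>Free modules and quotient modules\<close>

lemma free_module_simps [simp]:
  "carrier (free_module R B) =
     {f. (\<forall>x. f x \<in> carrier R) \<and> (\<forall>x. x \<notin> B \<longrightarrow> f x = \<zero>\<^bsub>R\<^esub>) \<and> finite {x. f x \<noteq> \<zero>\<^bsub>R\<^esub>}}"
  "\<zero>\<^bsub>free_module R B\<^esub> = (\<lambda>_. \<zero>\<^bsub>R\<^esub>)"
  "f \<oplus>\<^bsub>free_module R B\<^esub> g = (\<lambda>x. f x \<oplus>\<^bsub>R\<^esub> g x)"
  "a \<odot>\<^bsub>free_module R B\<^esub> f = (\<lambda>x. a \<otimes>\<^bsub>R\<^esub> f x)"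
  by (simp_all add: free_module_def)

lemma free_module_module:
  fixes R :: "('a, 'm) ring_scheme" (structure)
  assumes "cring R"
  shows "module R (free_module R B)"
proof -
  interpret cring R by fact
  have fin: "finite {x. f x \<oplus> g x \<noteq> \<zero>}"
    if "finite {x. f x \<noteq> \<zero>}" "finite {x. g x \<noteq> \<zero>}" for f g :: "'b \<Rightarrow> 'a"
    by (rule finite_subset[OF _ finite_UnI[OF that]]) auto
  have fin2: "finite {x. a \<otimes> f x \<noteq> \<zero>}"
    if "finite {x. f x \<noteq> \<zero>}" "a \<in> carrier R" for f :: "'b \<Rightarrow> 'a" and a
    by (rule finite_subset[OF _ that(1)]) (use that in auto)
  have fin3: "finite {x. \<ominus> f x \<noteq> \<zero>}" 
    if "finite {x. f x \<noteq> \<zero>}" for f :: "'b \<Rightarrow> 'a"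
    by (rule finite_subset[OF _ that]) auto
  have "abelian_group (free_module R B)"
  proof (rule abelian_groupI)
    fix f assume f: "f \<in> carrier (free_module R B)"
    show "\<exists>g\<in>carrier (free_module R B). g \<oplus>\<^bsub>free_module R B\<^esub> f = \<zero>\<^bsub>free_module R B\<^esub>"
      by (rule bexI[of _ "\<lambda>x. \<ominus> f x"]) (use f fin3[of f] in \<open>auto simp: l_neg\<close>)
  qed (auto simp: fin a_ac)
  then show ?thesis
    by (intro moduleI assms) (auto simp: fin fin2 l_distr r_distr m_assoc)
qed

lemma free_gen_carrier:
  fixes R :: "('a, 'm) ring_scheme" (structure)
  assumes "cring R" "b \<in> B" shows "free_gen R b \<in> carrier (free_module R B)"
proof -
  interpret cring R by fact
  show ?thesis
    using \<open>b \<in> B\<close> finite_subset[of "{x. free_gen R b x \<noteq> \<zero>\<^bsub>R\<^esub>}" "{b}"]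
    by (auto simp: free_gen_def)
qed

lemma free_module_induct:
  fixes R :: "('a, 'm) ring_scheme" (structure)
  assumes "cring R" and f: "f \<in> carrier (free_module R B)"
    and P_zero: "P (\<zero>\<^bsub>free_module R B\<^esub>)"
    and gen: "\<And>b. b \<in> B \<Longrightarrow> P (free_gen R b)"
    and add: "\<And>f g. \<lbrakk>f \<in> carrier (free_module R B); g \<in> carrier (free_module R B); P f; P g\<rbrakk>
      \<Longrightarrow> P (f \<oplus>\<^bsub>free_module R B\<^esub> g)"
    and smult: "\<And>a f. \<lbrakk>a \<in> carrier R; f \<in> carrier (free_module R B); P f\<rbrakk>
      \<Longrightarrow> P (a \<odot>\<^bsub>free_module R B\<^esub> f)"
  shows "P f"
proof -
  interpret cring R by fact
  interpret T: module R "free_module R B" by (rule free_module_module) fact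
  have "finite F \<Longrightarrow> {x. f x \<noteq> \<zero>} \<subseteq> F \<Longrightarrow> f \<in> carrier (free_module R B) \<Longrightarrow> P f" for F f
  proof (induction F arbitrary: f rule: finite_induct)
    case empty
    then have "f = (\<lambda>_. \<zero>)" by auto
    with P_zero show ?case by (simp only: free_module_simps)
  next
    case (insert b F)
    define g where "g = f(b := \<zero>)"
    have "finite {x. g x \<noteq> \<zero>}"
      by (rule finite_subset[of _ "{x. f x \<noteq> \<zero>}"]) (use insert.prems in \<open>auto simp: g_def\<close>)
    then have g: "g \<in> carrier (free_module R B)"
      using insert.prems by (auto simp: g_def)
    have "P g"
      by (rule insert.IH) (use insert.prems g in \<open>auto simp: g_def\<close>)
    show ?case
    proof (cases "b \<in> B")
      case True
      have e: "free_gen R b \<in> carrier (free_module R B)"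
        by (rule free_gen_carrier) (fact, fact)
      have fb: "f b \<in> carrier R" using insert.prems by auto
      have "f = g \<oplus>\<^bsub>free_module R B\<^esub> (f b \<odot>\<^bsub>free_module R B\<^esub> free_gen R b)"
        using insert.prems by (auto simp: g_def free_gen_def fun_eq_iff)
      moreover have "P \<dots>"
        by (intro add smult gen True g \<open>P g\<close> e fb T.smult_closed)
      ultimately show ?thesis by simp
    next
      case False
      then have "f = g" using insert.prems by (auto simp: g_def fun_eq_iff)
      then show ?thesis using \<open>P g\<close> by simp
    qed
  qed
  then show ?thesis using f by auto
qed

lemma (in module) submodule_zero: "submodule N R M \<Longrightarrow> \<zero>\<^bsub>M\<^esub> \<in> N"
  using subgroup.one_closed[OF submodule.axioms(1)] by fastforce

lemma submodule_span_submodule: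
  assumes "module R M" "A \<subseteq> carrier M"
  shows "submodule (submodule_span R M A) R M"
proof -
  interpret module R M by fact
  have "carrier M \<in> {N. submodule N R M \<and> A \<subseteq> N}"
    using assms(2) carrier_is_submodule by auto
  then show ?thesis
    unfolding submodule_span_def
    by (intro submoduleI)
      (blast dest: submoduleE(1) intro: submodule_zero submoduleE(3,4,5))+
qed

lemma submodule_span_incl: "A \<subseteq> submodule_span R M A"
  by (auto simp: submodule_span_def)

lemma submodule_span_least: "submodule N R M \<Longrightarrow> A \<subseteq> N \<Longrightarrow> submodule_span R M A \<subseteq> N"
  by (auto simp: submodule_span_def)

context
  fixes R :: "('a, 'm) ring_scheme" and T :: "('a, 'b) module" and N :: "'b set"
  assumes T: "module R T" and N: "submodule N R T"
begin

interpretation T: module R T by (rule T)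

lemma quot_abelian_subgroup: "abelian_subgroup N T"
  by (rule abelian_subgroupI3)
    (use submodule.axioms(1)[OF N] T.abelian_group_axioms in \<open>auto intro: additive_subgroupI\<close>)

interpretation N: abelian_subgroup N T by (rule quot_abelian_subgroup)

lemma quot_carrier: "carrier (quot_module T N) = (\<lambda>x. N +>\<^bsub>T\<^esub> x) ` carrier T"
  by (auto simp: quot_module_def A_RCOSETS_def')

lemma quot_zero: "\<zero>\<^bsub>quot_module T N\<^esub> = N +>\<^bsub>T\<^esub> \<zero>\<^bsub>T\<^esub>"
  using T.a_coset_add_zero[OF N.a_subset] by (simp add: quot_module_def)

lemma quot_add:
  "x \<in> carrier T \<Longrightarrow> y \<in> carrier T \<Longrightarrow>
     (N +>\<^bsub>T\<^esub> x) \<oplus>\<^bsub>quot_module T N\<^esub> (N +>\<^bsub>T\<^esub> y) = N +>\<^bsub>T\<^esub> (x \<oplus>\<^bsub>T\<^esub> y)"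
  by (simp add: quot_module_def N.a_rcos_sum)

lemma quot_eq_iff:
  assumes "x \<in> carrier T" "y \<in> carrier T"
  shows "N +>\<^bsub>T\<^esub> x = N +>\<^bsub>T\<^esub> y \<longleftrightarrow> x \<ominus>\<^bsub>T\<^esub> y \<in> N"
proof -
  have "N +>\<^bsub>T\<^esub> x = N +>\<^bsub>T\<^esub> y \<longleftrightarrow> x \<in> N +>\<^bsub>T\<^esub> y"
  proof
    assume "N +>\<^bsub>T\<^esub> x = N +>\<^bsub>T\<^esub> y"
    then show "x \<in> N +>\<^bsub>T\<^esub> y" using N.a_rcos_self[OF assms(1)] by simp
  next
    assume "x \<in> N +>\<^bsub>T\<^esub> y"
    from N.a_repr_independence'[OF this assms(2)] show "N +>\<^bsub>T\<^esub> x = N +>\<^bsub>T\<^esub> y" ..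
  qed
  then show ?thesis
    unfolding N.a_rcos_module[OF assms(2,1)] a_minus_def .
qed

lemma quot_smult:
  assumes a: "a \<in> carrier R" and x: "x \<in> carrier T"
  shows "a \<odot>\<^bsub>quot_module T N\<^esub> (N +>\<^bsub>T\<^esub> x) = N +>\<^bsub>T\<^esub> (a \<odot>\<^bsub>T\<^esub> x)"
proof -
  have eq: "N +>\<^bsub>T\<^esub> (a \<odot>\<^bsub>T\<^esub> y) = N +>\<^bsub>T\<^esub> (a \<odot>\<^bsub>T\<^esub> x)" if y: "y \<in> N +>\<^bsub>T\<^esub> x" for y
  proof -
    have yT: "y \<in> carrier T" 
      using y N.a_elemrcos_carrier[OF x] by auto
    have "N +>\<^bsub>T\<^esub> y = N +>\<^bsub>T\<^esub> x"
      using T.a_repr_independence[OF y x submodule.axioms(1)[OF N]] by simp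
    then have "y \<ominus>\<^bsub>T\<^esub> x \<in> N" using quot_eq_iff yT x by simp
    then have "a \<odot>\<^bsub>T\<^esub> (y \<ominus>\<^bsub>T\<^esub> x) \<in> N" using T.submoduleE(4)[OF N a] by simp
    also have "a \<odot>\<^bsub>T\<^esub> (y \<ominus>\<^bsub>T\<^esub> x) = a \<odot>\<^bsub>T\<^esub> y \<ominus>\<^bsub>T\<^esub> a \<odot>\<^bsub>T\<^esub> x"
      using a x yT by (simp add: a_minus_def T.smult_r_distr T.smult_r_minus)
    finally show ?thesis using quot_eq_iff a x yT by simp
  qed
  have "N +>\<^bsub>T\<^esub> x \<noteq> {}" using N.a_rcos_self[OF x] by blast
  then have "(\<Union>y\<in>N +>\<^bsub>T\<^esub> x. N +>\<^bsub>T\<^esub> (a \<odot>\<^bsub>T\<^esub> y)) = N +>\<^bsub>T\<^esub> (a \<odot>\<^bsub>T\<^esub> x)"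
    by (rule SUP_eq_const) (rule eq)
  then show ?thesis by (simp add: quot_module_def)
qed

lemma quot_module_module: "module R (quot_module T N)"
proof -
  have ex: "\<exists>x\<in>carrier T. V = N +>\<^bsub>T\<^esub> x" if "V \<in> carrier (quot_module T N)" for V
    using that unfolding quot_carrier by blast
  have "abelian_group (quot_module T N)"
  proof (rule abelian_groupI, goal_cases)
    case (1 U V)
    with ex[of U] ex[of V] show ?case by (auto simp: quot_add quot_carrier)
  next
    case 2
    show ?case unfolding quot_zero quot_carrier by blast
  next
    case (3 U V W)
    with ex[of U] ex[of V] ex[of W] show ?case by (auto simp: quot_add T.a_assoc)
  next
    case (4 U V)
    with ex[of U] ex[of V] show ?case by (auto simp: quot_add T.a_comm)
  next
    case (5 U)
    with ex[of U] show ?case by (auto simp: quot_add quot_zero)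
  next
    case (6 U)
    with ex[of U] obtain x where x: "x \<in> carrier T" "U = N +>\<^bsub>T\<^esub> x" by blast
    show ?case
    proof (rule bexI)
      show "(N +>\<^bsub>T\<^esub> (\<ominus>\<^bsub>T\<^esub> x)) \<oplus>\<^bsub>quot_module T N\<^esub> U = \<zero>\<^bsub>quot_module T N\<^esub>"
        unfolding x(2) quot_zero quot_add[OF T.a_inv_closed[OF x(1)] x(1)] T.l_neg[OF x(1)] ..
      show "(N +>\<^bsub>T\<^esub> (\<ominus>\<^bsub>T\<^esub> x)) \<in> carrier (quot_module T N)"
        unfolding quot_carrier using T.a_inv_closed[OF x(1)] by (rule imageI)
    qed
  qed
  then show ?thesis
    by (rule moduleI[OF T.R.is_cring]) (auto simp: quot_carrier quot_add quot_smult
      T.smult_l_distr T.smult_r_distr T.smult_assoc1)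
qed

end

lemma quot_span_eqI:
  assumes "module R T" "A \<subseteq> carrier T" "x \<in> carrier T" "y \<in> carrier T" "x \<ominus>\<^bsub>T\<^esub> y \<in> A"
  shows "submodule_span R T A +>\<^bsub>T\<^esub> x = submodule_span R T A +>\<^bsub>T\<^esub> y"
  using quot_eq_iff[OF assms(1) submodule_span_submodule[OF assms(1,2)] assms(3,4)]
    submodule_span_incl[of A R T] assms(5) by blast

lemma quot_span_zeroI:
  assumes "module R T" "A \<subseteq> carrier T" "x \<in> A"
  shows "submodule_span R T A +>\<^bsub>T\<^esub> x = \<zero>\<^bsub>quot_module T (submodule_span R T A)\<^esub>"
proof -
  interpret T: module R T by fact
  have x: "x \<in> carrier T" using assms(2,3) by blast
  have "\<ominus>\<^bsub>T\<^esub> \<zero>\<^bsub>T\<^esub> = \<zero>\<^bsub>T\<^esub>"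
    using T.M.r_neg[OF T.M.zero_closed] by simp
  then have "x \<ominus>\<^bsub>T\<^esub> \<zero>\<^bsub>T\<^esub> = x"
    using x by (simp add: a_minus_def)
  then have "submodule_span R T A +>\<^bsub>T\<^esub> x = submodule_span R T A +>\<^bsub>T\<^esub> \<zero>\<^bsub>T\<^esub>"
    by (intro quot_span_eqI[OF assms(1,2) x T.M.zero_closed]) (simp add: assms(3))
  then show ?thesis
    by (simp add: quot_zero[OF assms(1) submodule_span_submodule[OF assms(1,2)]])
qed

section \<open>Kaehler differentials and exterior powers\<close>

context
  fixes K :: "'a set" and R :: "('a, 'm) ring_scheme" (structure)
  assumes R: "cring R" and K: "K \<subseteq> carrier R"
begin

interpretation R: cring R by (rule R)
interpretation T: module R "free_module R (carrier R)" by (rule free_module_module[OF R])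

lemmas free_gen_closed = free_gen_carrier[OF R, where B = "carrier R"]

lemma kaehler_relations_carrier: "kaehler_relations K R \<subseteq> carrier (free_module R (carrier R))"
  unfolding kaehler_relations_def Let_def
  using free_gen_closed K R.add.m_closed R.m_closed
  by (auto simp del: free_module_simps intro!: T.minus_closed T.add.m_closed T.smult_closed)

lemmas kaehler_span_submodule =
  submodule_span_submodule[OF T.module_axioms kaehler_relations_carrier, folded kaehler_span_def]

lemma kaehler_module: "module R (kaehler K R)"
  unfolding kaehler_def by (rule quot_module_module[OF T.module_axioms kaehler_span_submodule])

lemma kdiff_closed: "a \<in> carrier R \<Longrightarrow> kdiff K R a \<in> carrier (kaehler K R)"
  unfolding kaehler_def kdiff_def
  using quot_carrier[OF T.module_axioms kaehler_span_submodule] free_gen_closed by blast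

lemma kdiff_add:
  assumes "a \<in> carrier R" "b \<in> carrier R"
  shows "kdiff K R (a \<oplus> b) = kdiff K R a \<oplus>\<^bsub>kaehler K R\<^esub> kdiff K R b"
  unfolding kdiff_def kaehler_def quot_add[OF T.module_axioms kaehler_span_submodule
      free_gen_closed[OF assms(1)] free_gen_closed[OF assms(2)]]
  unfolding kaehler_span_def
  by (rule quot_span_eqI[OF T.module_axioms kaehler_relations_carrier])
    (use assms free_gen_closed in \<open>auto simp: kaehler_relations_def Let_def simp del: free_module_simps\<close>)

lemma kdiff_mult:
  assumes "a \<in> carrier R" "b \<in> carrier R"
  shows "kdiff K R (a \<otimes> b) =
    a \<odot>\<^bsub>kaehler K R\<^esub> kdiff K R b \<oplus>\<^bsub>kaehler K R\<^esub> b \<odot>\<^bsub>kaehler K R\<^esub> kdiff K R a"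
  unfolding kdiff_def kaehler_def
    quot_smult[OF T.module_axioms kaehler_span_submodule assms(1) free_gen_closed[OF assms(2)]]
    quot_smult[OF T.module_axioms kaehler_span_submodule assms(2) free_gen_closed[OF assms(1)]]
    quot_add[OF T.module_axioms kaehler_span_submodule
      T.smult_closed[OF assms(1) free_gen_closed[OF assms(2)]]
      T.smult_closed[OF assms(2) free_gen_closed[OF assms(1)]]]
  unfolding kaehler_span_def
  by (rule quot_span_eqI[OF T.module_axioms kaehler_relations_carrier])
    (use assms free_gen_closed in \<open>auto simp: kaehler_relations_def Let_def simp del: free_module_simps\<close>)

lemma kdiff_const: "c \<in> K \<Longrightarrow> kdiff K R c = \<zero>\<^bsub>kaehler K R\<^esub>"
  unfolding kdiff_def kaehler_def kaehler_span_def
  by (rule quot_span_zeroI[OF T.module_axioms kaehler_relations_carrier])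
    (auto simp: kaehler_relations_def Let_def)

lemma kaehler_induct:
  assumes w: "w \<in> carrier (kaehler K R)"
    and zero: "P (\<zero>\<^bsub>kaehler K R\<^esub>)" and kdiff: "\<And>a. a \<in> carrier R \<Longrightarrow> P (kdiff K R a)"
    and add: "\<And>x y. \<lbrakk>x \<in> carrier (kaehler K R); y \<in> carrier (kaehler K R); P x; P y\<rbrakk>
      \<Longrightarrow> P (x \<oplus>\<^bsub>kaehler K R\<^esub> y)"
    and smult: "\<And>a x. \<lbrakk>a \<in> carrier R; x \<in> carrier (kaehler K R); P x\<rbrakk>
      \<Longrightarrow> P (a \<odot>\<^bsub>kaehler K R\<^esub> x)"
  shows "P w"
proof -
  note Q = quot_carrier quot_zero quot_add quot_smult
  note Q' = Q[OF T.module_axioms kaehler_span_submodule, folded kaehler_def]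
  obtain f where f: "f \<in> carrier (free_module R (carrier R))"
    "w = kaehler_span K R +>\<^bsub>free_module R (carrier R)\<^esub> f"
    using w unfolding Q'(1) by blast
  have mem: "kaehler_span K R +>\<^bsub>free_module R (carrier R)\<^esub> g \<in> carrier (kaehler K R)"
    if "g \<in> carrier (free_module R (carrier R))" for g
    unfolding Q'(1) using that by (rule imageI)
  show ?thesis unfolding f(2)
    using f(1)
  proof (rule free_module_induct[OF R], goal_cases)
    case 1
    show ?case using zero unfolding Q'(2) .
  next
    case (2 b)
    show ?case using kdiff[OF 2] unfolding kdiff_def .
  next
    case (3 f g)
    then show ?case using add[OF mem mem] by (simp only: Q'(3))
  next
    case (4 a f)
    then show ?case using smult[OF _ mem] by (simp only: Q'(4))
  qed
qed

end

lemma tuples_update: "xs \<in> tuples A n \<Longrightarrow> y \<in> A \<Longrightarrow> xs[i := y] \<in> tuples A n"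
  using set_update_subset_insert[of xs i y] by (auto simp: tuples_def)

context
  fixes R :: "('a, 'm) ring_scheme" (structure) and M :: "('a, 'b) module" and n :: nat
  assumes M: "module R M"
begin

interpretation M: module R M by (rule M)
interpretation T: module R "free_module R (tuples (carrier M) n)"
  by (rule free_module_module[OF M.R.is_cring])

lemmas ext_free_gen_closed = free_gen_carrier[OF M.R.is_cring, where B = "tuples (carrier M) n"]

lemma ext_relations_carrier:
  "ext_relations R M n \<subseteq> carrier (free_module R (tuples (carrier M) n))"
  unfolding ext_relations_def Let_def
  by (auto simp del: free_module_simps intro!: T.minus_closed T.add.m_closed T.smult_closed
      ext_free_gen_closed tuples_update)

lemmas ext_span_submodule =
  submodule_span_submodule[OF T.module_axioms ext_relations_carrier, folded ext_span_def]

lemma ext_power_module: "module R (ext_power R M n)"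
  unfolding ext_power_def by (rule quot_module_module[OF T.module_axioms ext_span_submodule])

lemma wedge_closed: "xs \<in> tuples (carrier M) n \<Longrightarrow> wedge R M n xs \<in> carrier (ext_power R M n)"
  unfolding ext_power_def wedge_def
  using quot_carrier[OF T.module_axioms ext_span_submodule] ext_free_gen_closed by blast

lemma wedge_add:
  assumes "xs \<in> tuples (carrier M) n" "i < n" "y \<in> carrier M" "z \<in> carrier M"
  shows "wedge R M n (xs[i := y \<oplus>\<^bsub>M\<^esub> z]) =
    wedge R M n (xs[i := y]) \<oplus>\<^bsub>ext_power R M n\<^esub> wedge R M n (xs[i := z])"
proof -
  have y: "free_gen R (xs[i := y]) \<in> carrier (free_module R (tuples (carrier M) n))"
    and z: "free_gen R (xs[i := z]) \<in> carrier (free_module R (tuples (carrier M) n))"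
    and yz: "free_gen R (xs[i := y \<oplus>\<^bsub>M\<^esub> z]) \<in> carrier (free_module R (tuples (carrier M) n))"
    using assms by (auto intro!: ext_free_gen_closed tuples_update simp del: free_module_simps)
  show ?thesis
    unfolding wedge_def ext_power_def quot_add[OF T.module_axioms ext_span_submodule y z]
    unfolding ext_span_def
    by (rule quot_span_eqI[OF T.module_axioms ext_relations_carrier yz T.add.m_closed[OF y z]])
      (unfold ext_relations_def Let_def, use assms in blast)
qed

lemma wedge_smult:
  assumes "xs \<in> tuples (carrier M) n" "i < n" "a \<in> carrier R" "y \<in> carrier M"
  shows "wedge R M n (xs[i := a \<odot>\<^bsub>M\<^esub> y]) = a \<odot>\<^bsub>ext_power R M n\<^esub> wedge R M n (xs[i := y])"
proof -
  have y: "free_gen R (xs[i := y]) \<in> carrier (free_module R (tuples (carrier M) n))"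
    and ay: "free_gen R (xs[i := a \<odot>\<^bsub>M\<^esub> y]) \<in> carrier (free_module R (tuples (carrier M) n))"
    using assms by (auto intro!: ext_free_gen_closed tuples_update simp del: free_module_simps)
  show ?thesis
    unfolding wedge_def ext_power_def quot_smult[OF T.module_axioms ext_span_submodule assms(3) y]
    unfolding ext_span_def
    by (rule quot_span_eqI[OF T.module_axioms ext_relations_carrier ay T.smult_closed[OF assms(3) y]])
      (unfold ext_relations_def Let_def, use assms in blast)
qed

lemma wedge_alt:
  assumes "xs \<in> tuples (carrier M) n" "i < j" "j < n" "xs ! i = xs ! j"
  shows "wedge R M n xs = \<zero>\<^bsub>ext_power R M n\<^esub>"
  unfolding wedge_def ext_power_def ext_span_def
  by (rule quot_span_zeroI[OF T.module_axioms ext_relations_carrier])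
    (unfold ext_relations_def Let_def, use assms in blast)

lemma ext_power_induct:
  assumes w: "w \<in> carrier (ext_power R M n)"
    and zero: "P (\<zero>\<^bsub>ext_power R M n\<^esub>)"
    and wedge: "\<And>xs. xs \<in> tuples (carrier M) n \<Longrightarrow> P (wedge R M n xs)"
    and add: "\<And>x y. \<lbrakk>x \<in> carrier (ext_power R M n); y \<in> carrier (ext_power R M n); P x; P y\<rbrakk>
      \<Longrightarrow> P (x \<oplus>\<^bsub>ext_power R M n\<^esub> y)"
    and smult: "\<And>a x. \<lbrakk>a \<in> carrier R; x \<in> carrier (ext_power R M n); P x\<rbrakk>
      \<Longrightarrow> P (a \<odot>\<^bsub>ext_power R M n\<^esub> x)"
  shows "P w"
proof -
  let ?T = "free_module R (tuples (carrier M) n)"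
  note Q = quot_carrier quot_zero quot_add quot_smult
  note Q' = Q[OF T.module_axioms ext_span_submodule, folded ext_power_def]
  obtain f where f: "f \<in> carrier ?T" "w = ext_span R M n +>\<^bsub>?T\<^esub> f"
    using w unfolding Q'(1) by blast
  have mem: "ext_span R M n +>\<^bsub>?T\<^esub> g \<in> carrier (ext_power R M n)" if "g \<in> carrier ?T" for g
    unfolding Q'(1) using that by (rule imageI)
  show ?thesis unfolding f(2)
    using f(1)
  proof (rule free_module_induct[OF M.R.is_cring], goal_cases)
    case 1
    show ?case using zero unfolding Q'(2) .
  next
    case (2 b)
    show ?case using wedge[OF 2] unfolding wedge_def .
  next
    case (3 f g)
    then show ?case using add[OF mem mem] by (simp only: Q'(3))
  next
    case (4 a f)
    then show ?case using smult[OF _ mem] by (simp only: Q'(4))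
  qed
qed

end

section \<open>Functionals with values in the ambient field\<close>

abbreviation sub :: "'f::field set \<Rightarrow> 'f ring" where
  "sub C \<equiv> ambient\<lparr>carrier := C\<rparr>"

lemma sub_UNIV: "sub UNIV = (ambient :: 'f::field ring)"
  by (simp add: ring_of_type_algebra_def)

lemma sub_cring: "subring C ambient \<Longrightarrow> cring (sub C)"
proof -
  assume C: "subring C ambient"
  interpret cring "ambient :: 'a ring" by (rule cring_from_type_algebra)
  have "subcring C ambient" by (rule subcringI'[OF C])
  then show ?thesis using subcring_iff by simp
qed

lemma UNIV_subring: "subring UNIV (ambient :: 'f::field ring)"
  by (simp add: subring_ambient_iff)

definition linear_to :: "'f::field set \<Rightarrow> ('f, 'b) module \<Rightarrow> ('b \<Rightarrow> 'f) \<Rightarrow> bool" where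
  "linear_to C M g \<longleftrightarrow>
     (\<forall>x\<in>carrier M. \<forall>y\<in>carrier M. g (x \<oplus>\<^bsub>M\<^esub> y) = g x + g y) \<and>
     (\<forall>a\<in>C. \<forall>x\<in>carrier M. g (a \<odot>\<^bsub>M\<^esub> x) = a * g x)"

lemma linear_to_add: "linear_to C M g \<Longrightarrow> x \<in> carrier M \<Longrightarrow> y \<in> carrier M \<Longrightarrow>
    g (x \<oplus>\<^bsub>M\<^esub> y) = g x + g y"
  and linear_to_smult: "linear_to C M g \<Longrightarrow> a \<in> C \<Longrightarrow> x \<in> carrier M \<Longrightarrow> g (a \<odot>\<^bsub>M\<^esub> x) = a * g x"
  by (auto simp: linear_to_def)

lemma linear_to_zero:
  assumes "module (sub C) M" "linear_to C M g" shows "g \<zero>\<^bsub>M\<^esub> = 0"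
proof -
  interpret M: module "sub C" M by fact
  have "g (\<zero>\<^bsub>M\<^esub> \<oplus>\<^bsub>M\<^esub> \<zero>\<^bsub>M\<^esub>) = g \<zero>\<^bsub>M\<^esub> + g \<zero>\<^bsub>M\<^esub>"
    by (rule linear_to_add[OF assms(2)]) auto
  then have "g \<zero>\<^bsub>M\<^esub> = g \<zero>\<^bsub>M\<^esub> + g \<zero>\<^bsub>M\<^esub>"
    by (simp only: M.M.l_zero[OF M.M.zero_closed])
  then show ?thesis by (metis add_cancel_right_right)
qed

lemma linear_to_uminus:
  assumes "module (sub C) M" "linear_to C M g" "x \<in> carrier M" shows "g (\<ominus>\<^bsub>M\<^esub> x) = - g x"
proof -
  interpret M: module "sub C" M by fact
  have "g (\<ominus>\<^bsub>M\<^esub> x \<oplus>\<^bsub>M\<^esub> x) = g (\<ominus>\<^bsub>M\<^esub> x) + g x"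
    by (rule linear_to_add[OF assms(2)]) (auto simp: assms)
  then show ?thesis
    using linear_to_zero[OF assms(1,2)] M.M.l_neg[OF assms(3)] by (simp add: eq_neg_iff_add_eq_0)
qed

lemma linear_to_minus:
  assumes "module (sub C) M" "linear_to C M g" "x \<in> carrier M" "y \<in> carrier M"
  shows "g (x \<ominus>\<^bsub>M\<^esub> y) = g x - g y"
proof -
  interpret M: module "sub C" M by fact
  show ?thesis
    using assms by (simp add: a_minus_def linear_to_add[OF assms(2)] linear_to_uminus[OF assms(1,2)])
qed

lemma linear_to_kills_span:
  assumes "module (sub C) T" "linear_to C T g" "A \<subseteq> carrier T" "\<And>x. x \<in> A \<Longrightarrow> g x = 0"
    and "x \<in> submodule_span (sub C) T A"
  shows "g x = 0"
proof -
  interpret T: module "sub C" T by fact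
  have "submodule {x \<in> carrier T. g x = 0} (sub C) T"
    by (rule T.submoduleI)
      (auto simp: linear_to_zero[OF assms(1,2)] linear_to_uminus[OF assms(1,2)]
        linear_to_add[OF assms(2)] linear_to_smult[OF assms(2)])
  from submodule_span_least[OF this, of A] show ?thesis using assms by auto
qed

lemma linear_to_quot:
  assumes T: "module (sub C) T" and N: "submodule N (sub C) T"
    and g: "linear_to C T g" and kills: "\<And>x. x \<in> N \<Longrightarrow> g x = 0"
  shows "\<exists>h. linear_to C (quot_module T N) h \<and> (\<forall>x\<in>carrier T. h (N +>\<^bsub>T\<^esub> x) = g x)"
proof -
  interpret T: module "sub C" T by fact
  define h where "h V = g (SOME x. x \<in> carrier T \<and> V = N +>\<^bsub>T\<^esub> x)" for V
  have h: "h (N +>\<^bsub>T\<^esub> x) = g x" if x: "x \<in> carrier T" for x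
  proof -
    let ?y = "SOME y. y \<in> carrier T \<and> N +>\<^bsub>T\<^esub> x = N +>\<^bsub>T\<^esub> y"
    have y: "?y \<in> carrier T \<and> N +>\<^bsub>T\<^esub> x = N +>\<^bsub>T\<^esub> ?y"
      by (rule someI[where x = x]) (use x in simp)
    then have "x \<ominus>\<^bsub>T\<^esub> ?y \<in> N" using quot_eq_iff[OF T N x, of ?y] by blast
    then have "g (x \<ominus>\<^bsub>T\<^esub> ?y) = 0" by (rule kills)
    then show ?thesis using y x linear_to_minus[OF T g x, of ?y] by (simp add: h_def)
  qed
  note Q = quot_carrier[OF T N] quot_add[OF T N] quot_smult[OF T N]
  have ex: "\<exists>x\<in>carrier T. V = N +>\<^bsub>T\<^esub> x" if "V \<in> carrier (quot_module T N)" for V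
    using that unfolding Q(1) by blast
  have "linear_to C (quot_module T N) h"
    unfolding linear_to_def
  proof (intro conjI ballI)
    fix V W assume "V \<in> carrier (quot_module T N)" "W \<in> carrier (quot_module T N)"
    then obtain x y where "x \<in> carrier T" "y \<in> carrier T" "V = N +>\<^bsub>T\<^esub> x" "W = N +>\<^bsub>T\<^esub> y"
      using ex by meson
    then show "h (V \<oplus>\<^bsub>quot_module T N\<^esub> W) = h V + h W"
      by (simp add: Q(2) h linear_to_add[OF g])
  next
    fix a V assume "a \<in> C" "V \<in> carrier (quot_module T N)"
    then obtain x where "x \<in> carrier T" "V = N +>\<^bsub>T\<^esub> x" using ex by meson
    then show "h (a \<odot>\<^bsub>quot_module T N\<^esub> V) = a * h V"
      using \<open>a \<in> C\<close> by (simp add: Q(3) h linear_to_smult[OF g])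
  qed
  with h show ?thesis by blast
qed

definition free_extend :: "('x \<Rightarrow> 'f::field) \<Rightarrow> ('x \<Rightarrow> 'f) \<Rightarrow> 'f" where
  "free_extend h f = (\<Sum>x | f x \<noteq> 0. f x * h x)"

lemma free_extend_superset:
  "finite F \<Longrightarrow> {x. f x \<noteq> 0} \<subseteq> F \<Longrightarrow> free_extend h f = (\<Sum>x\<in>F. f x * h x)"
  unfolding free_extend_def by (rule sum.mono_neutral_left) auto

lemma linear_to_free_extend: "linear_to C (free_module (sub C) B) (free_extend h)"
  unfolding linear_to_def
proof (intro conjI ballI)
  fix f g assume "f \<in> carrier (free_module (sub C) B)" "g \<in> carrier (free_module (sub C) B)"
  then have fin: "finite ({x. f x \<noteq> 0} \<union> {x. g x \<noteq> 0})" by simp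
  show "free_extend h (f \<oplus>\<^bsub>free_module (sub C) B\<^esub> g) = free_extend h f + free_extend h g"
    by (subst (1 2 3) free_extend_superset[OF fin]) (auto simp: sum.distrib distrib_right)
next
  fix a f assume "f \<in> carrier (free_module (sub C) B)"
  then have fin: "finite {x. f x \<noteq> 0}" by simp
  show "free_extend h (a \<odot>\<^bsub>free_module (sub C) B\<^esub> f) = a * free_extend h f"
    by (subst (1 2) free_extend_superset[OF fin]) (auto simp: sum_distrib_left mult.assoc)
qed

lemma free_extend_gen [simp]: "free_extend h (free_gen (sub C) b) = h b"
  by (subst free_extend_superset[of "{b}"]) (auto simp: free_gen_def split: if_splits)

context
  fixes K C :: "'f::field set"
  assumes C: "subring C ambient" and K: "K \<subseteq> C"
begin

interpretation R: cring "sub C" by (rule sub_cring[OF C])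

lemma kaehler_functional:
  assumes add: "\<And>a b. a \<in> C \<Longrightarrow> b \<in> C \<Longrightarrow> \<delta> (a + b) = \<delta> a + \<delta> b"
    and mult: "\<And>a b. a \<in> C \<Longrightarrow> b \<in> C \<Longrightarrow> \<delta> (a * b) = a * \<delta> b + b * \<delta> a"
    and const: "\<And>c. c \<in> K \<Longrightarrow> \<delta> c = 0"
  shows "\<exists>g. linear_to C (kaehler K (sub C)) g \<and> (\<forall>a\<in>C. g (kdiff K (sub C) a) = \<delta> a)"
proof -
  let ?T = "free_module (sub C) C"
  have K': "K \<subseteq> carrier (sub C)" using K by simp
  have T: "module (sub C) ?T" by (rule free_module_module[OF R.is_cring])
  interpret T: module "sub C" ?T by (rule T)
  have lin: "linear_to C ?T (free_extend \<delta>)" by (rule linear_to_free_extend)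
  have gen: "free_gen (sub C) a \<in> carrier ?T" if "a \<in> C" for a
    using free_gen_carrier[OF R.is_cring that] .
  have rel: "kaehler_relations K (sub C) \<subseteq> carrier ?T"
    using kaehler_relations_carrier[OF R.is_cring K'] by (simp del: free_module_simps)
  have kills: "free_extend \<delta> x = 0" if "x \<in> kaehler_relations K (sub C)" for x
    using that unfolding kaehler_relations_def Let_def
    by (auto simp: linear_to_minus[OF T lin] linear_to_add[OF lin] linear_to_smult[OF lin] gen 
        add mult const subring_closed[OF C] T.M.add.m_closed[OF gen gen] T.smult_closed[OF _ gen, simplified]
        T.M.add.m_closed[OF T.smult_closed[OF _ gen] T.smult_closed[OF _ gen], simplified]
        simp del: free_module_simps)
  have span: "kaehler_span K (sub C) = submodule_span (sub C) ?T (kaehler_relations K (sub C))"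
    by (simp add: kaehler_span_def)
  from linear_to_quot[OF T submodule_span_submodule[OF T rel] lin linear_to_kills_span[OF T lin rel kills]]
  obtain g where "linear_to C (kaehler K (sub C)) g"
    "\<And>x. x \<in> carrier ?T \<Longrightarrow> g (kaehler_span K (sub C) +>\<^bsub>?T\<^esub> x) = free_extend \<delta> x"
    unfolding kaehler_def span by auto
  then show ?thesis using gen by (auto simp: kdiff_def intro!: exI[of _ g])
qed

lemma ext_power_functional:
  assumes M: "module (sub C) M"
    and add: "\<And>xs i y z. \<lbrakk>xs \<in> tuples (carrier M) n; i < n; y \<in> carrier M; z \<in> carrier M\<rbrakk>
      \<Longrightarrow> E (xs[i := y \<oplus>\<^bsub>M\<^esub> z]) = E (xs[i := y]) + E (xs[i := z])"
    and smult: "\<And>xs i a y. \<lbrakk>xs \<in> tuples (carrier M) n; i < n; a \<in> C; y \<in> carrier M\<rbrakk>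
      \<Longrightarrow> E (xs[i := a \<odot>\<^bsub>M\<^esub> y]) = a * E (xs[i := y])"
    and alt: "\<And>xs i j. \<lbrakk>xs \<in> tuples (carrier M) n; i < j; j < n; xs ! i = xs ! j\<rbrakk> \<Longrightarrow> E xs = 0"
  shows "\<exists>g. linear_to C (ext_power (sub C) M n) g \<and>
    (\<forall>xs\<in>tuples (carrier M) n. g (wedge (sub C) M n xs) = E xs)"
proof -
  let ?T = "free_module (sub C) (tuples (carrier M) n)"
  interpret M: module "sub C" M by (rule M)
  have T: "module (sub C) ?T" by (rule free_module_module[OF R.is_cring])
  interpret T: module "sub C" ?T by (rule T)
  have lin: "linear_to C ?T (free_extend E)" by (rule linear_to_free_extend)
  have gen: "free_gen (sub C) xs \<in> carrier ?T" if "xs \<in> tuples (carrier M) n" for xs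
    using free_gen_carrier[OF R.is_cring that] .
  note upd = tuples_update[of _ "carrier M" n]
  have rel: "ext_relations (sub C) M n \<subseteq> carrier ?T"
    by (rule ext_relations_carrier[OF M])
  have kills: "free_extend E x = 0" if "x \<in> ext_relations (sub C) M n" for x
    using that unfolding ext_relations_def Let_def
    by (auto simp: linear_to_minus[OF T lin] linear_to_add[OF lin] linear_to_smult[OF lin] gen upd
        add smult alt T.M.add.m_closed[OF gen gen] T.smult_closed[OF _ gen, simplified]
        M.smult_closed[simplified] simp del: free_module_simps)
  have span: "ext_span (sub C) M n = submodule_span (sub C) ?T (ext_relations (sub C) M n)"
    by (simp add: ext_span_def)
  from linear_to_quot[OF T submodule_span_submodule[OF T rel] lin linear_to_kills_span[OF T lin rel kills]]
  obtain g where "linear_to C (ext_power (sub C) M n) g"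
    "\<And>x. x \<in> carrier ?T \<Longrightarrow> g (ext_span (sub C) M n +>\<^bsub>?T\<^esub> x) = free_extend E x"
    unfolding ext_power_def span by auto
  then show ?thesis using gen by (auto simp: wedge_def intro!: exI[of _ g])
qed

end

section \<open>Alternating multiderivations\<close>

definition derivation_to ::
    "'f::field set \<Rightarrow> 'f set \<Rightarrow> ('f, 'b) module \<Rightarrow> ('f \<Rightarrow> 'b) \<Rightarrow> bool" where
  "derivation_to K C V d \<longleftrightarrow>
     (\<forall>a\<in>C. d a \<in> carrier V) \<and>
     (\<forall>a\<in>C. \<forall>b\<in>C. d (a + b) = d a \<oplus>\<^bsub>V\<^esub> d b) \<and>
     (\<forall>a\<in>C. \<forall>b\<in>C. d (a * b) = a \<odot>\<^bsub>V\<^esub> d b \<oplus>\<^bsub>V\<^esub> b \<odot>\<^bsub>V\<^esub> d a) \<and>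
     (\<forall>c\<in>K. d c = \<zero>\<^bsub>V\<^esub>)"

definition multiderivation_to ::
    "'f::field set \<Rightarrow> 'f set \<Rightarrow> nat \<Rightarrow> ('f, 'b) module \<Rightarrow> ('f list \<Rightarrow> 'b) \<Rightarrow> bool" where
  "multiderivation_to K C n V E \<longleftrightarrow>
     (\<forall>as\<in>tuples C n. E as \<in> carrier V) \<and>
     (\<forall>as\<in>tuples C n. \<forall>i<n. derivation_to K C V (\<lambda>a. E (as[i := a]))) \<and>
     (\<forall>as\<in>tuples C n. \<forall>i j. i < j \<and> j < n \<and> as ! i = as ! j \<longrightarrow> E as = \<zero>\<^bsub>V\<^esub>)"

lemma derivation_unique:
  assumes V: "module ambient V" and C: "subring C ambient" and K: "K \<subseteq> C" "1 \<in> K"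
    and d: "derivation_to K C V d" and e: "derivation_to K C V e"
    and G: "G \<subseteq> C" "\<And>g. g \<in> G \<Longrightarrow> d g = e g"
    and frac: "\<exists>p\<in>gen (K \<union> G). \<exists>q\<in>gen (K \<union> G). q \<noteq> 0 \<and> a * q = p"
    and a: "a \<in> C"
  shows "d a = e a"
proof -
  interpret V: module ambient V by fact
  have sm: "a \<odot>\<^bsub>V\<^esub> v \<in> carrier V" if "v \<in> carrier V" for a v
    using V.smult_closed[OF _ that] by simp
  have d1: "\<And>a. a \<in> C \<Longrightarrow> d a \<in> carrier V" "\<And>a b. a \<in> C \<Longrightarrow> b \<in> C \<Longrightarrow> d (a + b) = d a \<oplus>\<^bsub>V\<^esub> d b"
    "\<And>a b. a \<in> C \<Longrightarrow> b \<in> C \<Longrightarrow> d (a * b) = a \<odot>\<^bsub>V\<^esub> d b \<oplus>\<^bsub>V\<^esub> b \<odot>\<^bsub>V\<^esub> d a"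
    "\<And>c. c \<in> K \<Longrightarrow> d c = \<zero>\<^bsub>V\<^esub>"
    using d by (auto simp: derivation_to_def)
  have e1: "\<And>a. a \<in> C \<Longrightarrow> e a \<in> carrier V" "\<And>a b. a \<in> C \<Longrightarrow> b \<in> C \<Longrightarrow> e (a + b) = e a \<oplus>\<^bsub>V\<^esub> e b"
    "\<And>a b. a \<in> C \<Longrightarrow> b \<in> C \<Longrightarrow> e (a * b) = a \<odot>\<^bsub>V\<^esub> e b \<oplus>\<^bsub>V\<^esub> b \<odot>\<^bsub>V\<^esub> e a"
    "\<And>c. c \<in> K \<Longrightarrow> e c = \<zero>\<^bsub>V\<^esub>"
    using e by (auto simp: derivation_to_def)
  have sumzero: "f (- a) = \<ominus>\<^bsub>V\<^esub> f a" 
    if f: "\<And>a. a \<in> C \<Longrightarrow> f a \<in> carrier V" "\<And>a b. a \<in> C \<Longrightarrow> b \<in> C \<Longrightarrow> f (a + b) = f a \<oplus>\<^bsub>V\<^esub> f b"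
      and a: "a \<in> C" for f a
  proof -
    have c0: "0 \<in> C" and ca: "- a \<in> C" using a by (auto intro: subring_closed[OF C])
    have "f 0 \<oplus>\<^bsub>V\<^esub> f 0 = f 0" using f(2)[OF c0 c0] by simp
    then have "f 0 = \<zero>\<^bsub>V\<^esub>" using V.M.add.l_cancel_one' f(1)[OF c0] by auto
    moreover have "f (- a) \<oplus>\<^bsub>V\<^esub> f a = f 0" using f(2)[OF ca a] by simp
    ultimately show ?thesis
      using V.M.minus_equality f(1)[OF a] f(1)[OF ca] by metis
  qed
  let ?Z = "{a \<in> C. d a = e a}"
  have "subring ?Z ambient"
    unfolding subring_ambient_iff
    using K subring_closed[OF C] by (auto simp: d1 e1 sumzero)
  moreover have "K \<union> G \<subseteq> ?Z" using K G d1(4) e1(4) by auto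
  ultimately have Z: "gen (K \<union> G) \<subseteq> ?Z" by (rule gen_least)
  obtain p q where pq: "p \<in> ?Z" "q \<in> ?Z" "q \<noteq> 0" "a * q = p" using frac Z by blast
  have "a \<odot>\<^bsub>V\<^esub> e q \<oplus>\<^bsub>V\<^esub> q \<odot>\<^bsub>V\<^esub> d a = a \<odot>\<^bsub>V\<^esub> e q \<oplus>\<^bsub>V\<^esub> q \<odot>\<^bsub>V\<^esub> e a"
    using d1(3)[OF a, of q] e1(3)[OF a, of q] pq by auto
  then have "q \<odot>\<^bsub>V\<^esub> d a = q \<odot>\<^bsub>V\<^esub> e a"
    using V.M.add.l_cancel[of "a \<odot>\<^bsub>V\<^esub> e q" "q \<odot>\<^bsub>V\<^esub> d a" "q \<odot>\<^bsub>V\<^esub> e a"] sm d1(1) e1(1) pq a by auto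
  then have "inverse q \<odot>\<^bsub>V\<^esub> (q \<odot>\<^bsub>V\<^esub> d a) = inverse q \<odot>\<^bsub>V\<^esub> (q \<odot>\<^bsub>V\<^esub> e a)" by simp
  moreover have "inverse q \<odot>\<^bsub>V\<^esub> (q \<odot>\<^bsub>V\<^esub> v) = v" if "v \<in> carrier V" for v
    using V.smult_assoc1[of "inverse q" q v] V.smult_one[OF that] that pq(3) by simp
  ultimately show ?thesis using d1(1) e1(1) a by metis
qed

text \<open>Induction over the slots of a tuple.\<close>

lemma slot_induct:
  assumes "G \<subseteq> C" and base: "\<And>as. as \<in> tuples G n \<Longrightarrow> P as"
    and step: "\<And>as i a. \<lbrakk>as \<in> tuples C n; i < n; \<And>g. g \<in> G \<Longrightarrow> P (as[i := g]); a \<in> C\<rbrakk>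
      \<Longrightarrow> P (as[i := a])"
    and as: "as \<in> tuples C n"
  shows "P as"
proof -
  have *: "P as" if "as \<in> tuples C n" "\<forall>j. k \<le> j \<and> j < n \<longrightarrow> as ! j \<in> G" "k \<le> n" for k as
    using that
  proof (induction k arbitrary: as)
    case 0
    then show ?case by (intro base) (auto simp: tuples_def in_set_conv_nth)
  next
    case (Suc k)
    have "P (as[k := as ! k])"
    proof (rule step)
      show "as ! k \<in> C" using Suc.prems by (auto simp: tuples_def)
      fix g assume g: "g \<in> G"
      show "P (as[k := g])"
      proof (rule Suc.IH)
        show "as[k := g] \<in> tuples C n"
          using g assms(1) Suc.prems by (auto intro!: tuples_update)
        show "\<forall>j. k \<le> j \<and> j < n \<longrightarrow> as[k := g] ! j \<in> G"
          using g Suc.prems by (auto simp: tuples_def nth_list_update)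
      qed (use Suc.prems in simp)
    qed (use Suc.prems in auto)
    then show ?case by simp
  qed
  show ?thesis by (rule *[OF as, of n]) auto
qed

lemma multiderivation_swap:
  assumes V: "module ambient V" and C: "subring C ambient"
    and E: "multiderivation_to K C n V E" and as: "as \<in> tuples C n"
    and ij: "i < n" "j < n" "i \<noteq> j"
  shows "E (as[i := as ! j, j := as ! i]) = \<ominus>\<^bsub>V\<^esub> E as"
proof -
  interpret V: module ambient V by fact
  define B where "B a b = E (as[i := a, j := b])" for a b
  have mem: "as[i := a, j := b] \<in> tuples C n" if "a \<in> C" "b \<in> C" for a b
    using that as by (intro tuples_update) 
  have len: "length as = n" using as by (simp add: tuples_def)
  have closed: "B a b \<in> carrier V" if "a \<in> C" "b \<in> C" for a b
    using E mem[OF that] by (auto simp: multiderivation_to_def B_def)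
  have alt: "B a a = \<zero>\<^bsub>V\<^esub>" if "a \<in> C" for a
  proof -
    have "as[i := a, j := a] ! i = as[i := a, j := a] ! j" using ij len by (auto simp: nth_list_update)
    then show ?thesis using E mem[OF that that] ij
      unfolding multiderivation_to_def B_def by (metis linorder_neqE_nat)
  qed
  have add2: "B a (b + c) = B a b \<oplus>\<^bsub>V\<^esub> B a c" if "a \<in> C" "b \<in> C" "c \<in> C" for a b c
    using E ij that tuples_update[OF as that(1), of i]
    unfolding multiderivation_to_def B_def derivation_to_def by blast
  have add1: "B (a + b) c = B a c \<oplus>\<^bsub>V\<^esub> B b c" if "a \<in> C" "b \<in> C" "c \<in> C" for a b c
    using E ij that tuples_update[OF as that(3), of j]
    unfolding multiderivation_to_def B_def derivation_to_def list_update_swap[OF ij(3)] by blast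
  have ai: "as ! i \<in> C" and aj: "as ! j \<in> C" using as ij by (auto simp: tuples_def)
  let ?a = "as ! i" and ?b = "as ! j"
  have "\<zero>\<^bsub>V\<^esub> = B (?a + ?b) (?a + ?b)" using alt subring_add[OF C ai aj] by simp
  also have "\<dots> = (B ?a ?a \<oplus>\<^bsub>V\<^esub> B ?b ?a) \<oplus>\<^bsub>V\<^esub> (B ?a ?b \<oplus>\<^bsub>V\<^esub> B ?b ?b)"
    using add1 add2 subring_add[OF C ai aj] ai aj by simp
  also have "\<dots> = B ?b ?a \<oplus>\<^bsub>V\<^esub> B ?a ?b"
    using alt closed ai aj by simp
  finally have "B ?b ?a = \<ominus>\<^bsub>V\<^esub> B ?a ?b"
    using V.M.minus_equality closed ai aj by metis
  then show ?thesis by (simp add: B_def)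
qed

lemma multiderivations_permuted:
  assumes V: "module ambient V" and C: "subring C ambient"
    and E: "multiderivation_to K C n V E" and D: "multiderivation_to K C n V D"
    and xs: "xs \<in> tuples C n" and perm: "mset as = mset xs"
  shows "(E as = E xs \<and> D as = D xs) \<or> (E as = \<ominus>\<^bsub>V\<^esub> E xs \<and> D as = \<ominus>\<^bsub>V\<^esub> D xs)"
proof -
  interpret V: module ambient V by fact
  have len: "length xs = n" using xs by (simp add: tuples_def)
  obtain p where p: "p permutes {..<length xs}" "permute_list p xs = as"
    using mset_eq_permutation[OF perm] by blast
  have closed: "E as \<in> carrier V" "D as \<in> carrier V" if "as \<in> tuples C n" for as
    using E D that by (auto simp: multiderivation_to_def)
  have "permute_list p xs \<in> tuples C n \<and> ((E (permute_list p xs) = E xs \<and> D (permute_list p xs) = D xs) \<or>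
      (E (permute_list p xs) = \<ominus>\<^bsub>V\<^esub> E xs \<and> D (permute_list p xs) = \<ominus>\<^bsub>V\<^esub> D xs))"
    using finite_lessThan p(1)
  proof (induction rule: permutes_rev_induct)
    case id
    then show ?case using xs by simp
  next
    case (swap a b p)
    let ?ys = "permute_list p xs" and ?t = "Transposition.transpose a b"
    have t: "?t permutes {..<length xs}" using swap by (intro permutes_swap_id) auto
    have "permute_list (p \<circ> ?t) xs = permute_list ?t ?ys"
      by (rule permute_list_compose) (rule t)
    also have "\<dots> = ?ys[a := ?ys ! b, b := ?ys ! a]"
      by (rule nth_equalityI)
        (use t swap in \<open>auto simp: permute_list_nth nth_list_update Transposition.transpose_def\<close>)
    finally have eq: "permute_list (p \<circ> ?t) xs = ?ys[a := ?ys ! b, b := ?ys ! a]" .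
    have ab: "a < n" "b < n" using swap len by auto
    have ys: "?ys \<in> tuples C n" using swap by blast
    then have "?ys ! a \<in> C" "?ys ! b \<in> C" using ab by (auto simp: tuples_def)
    then have "permute_list (p \<circ> ?t) xs \<in> tuples C n"
      unfolding eq by (intro tuples_update ys)
    moreover have "\<ominus>\<^bsub>V\<^esub> (\<ominus>\<^bsub>V\<^esub> E xs) = E xs" "\<ominus>\<^bsub>V\<^esub> (\<ominus>\<^bsub>V\<^esub> D xs) = D xs"
      using closed[OF xs] by auto
    ultimately show ?case
      using swap.IH multiderivation_swap[OF V C E ys ab \<open>a \<noteq> b\<close>]
        multiderivation_swap[OF V C D ys ab \<open>a \<noteq> b\<close>] unfolding eq by auto
  qed
  then show ?thesis using p(2) by simp
qed

lemma multiderivation_unique: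
  assumes V: "module ambient V" and C: "subring C ambient" and K: "K \<subseteq> C" "1 \<in> K"
    and E: "multiderivation_to K C n V E" and D: "multiderivation_to K C n V D"
    and xs: "xs \<in> tuples C n" and eq: "E xs = D xs"
    and frac: "\<And>a. a \<in> C \<Longrightarrow> \<exists>p\<in>gen (K \<union> set xs). \<exists>q\<in>gen (K \<union> set xs). q \<noteq> 0 \<and> a * q = p"
    and as: "as \<in> tuples C n"
  shows "E as = D as"
proof (rule slot_induct[where P = "\<lambda>as. E as = D as", OF _ _ _ as])
  show sub: "set xs \<subseteq> C" using xs by (simp add: tuples_def)
  fix as assume as: "as \<in> tuples (set xs) n"
  then have asC: "as \<in> tuples C n" using sub by (auto simp: tuples_def)
  show "E as = D as"
  proof (cases "distinct as")
    case True
    have "card (set xs) \<le> n" using xs card_length[of xs] by (simp add: tuples_def)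
    moreover have c: "card (set as) = n" using True as distinct_card by (fastforce simp: tuples_def)
    moreover have s: "set as \<subseteq> set xs" using as by (simp add: tuples_def)
    ultimately have "set as = set xs" "card (set xs) = length xs"
      using card_seteq[of "set xs" "set as"] card_mono[OF _ s] xs by (auto simp: tuples_def)
    then have "mset as = mset xs"
      using True card_distinct[of xs] set_eq_iff_mset_eq_distinct[of as xs] by blast
    from multiderivations_permuted[OF V C E D xs this] show ?thesis using eq by auto
  next
    case False
    then obtain i j where ij: "i < n" "j < n" "i \<noteq> j" "as ! i = as ! j"
      using as by (auto simp: distinct_conv_nth tuples_def)
    have "E as = \<zero>\<^bsub>V\<^esub>" "D as = \<zero>\<^bsub>V\<^esub>" if "k < l" "l < n" "as ! k = as ! l" for k l
      using asC E D that by (auto simp: multiderivation_to_def)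
    from this[of i j] this[of j i] ij have "E as = \<zero>\<^bsub>V\<^esub>" "D as = \<zero>\<^bsub>V\<^esub>"
      by (cases i j rule: linorder_cases; simp)+
    then show ?thesis by simp
  qed
next
  fix as i a
  assume as: "as \<in> tuples C n" and i: "i < n" and a: "a \<in> C"
    and IH: "\<And>g. g \<in> set xs \<Longrightarrow> E (as[i := g]) = D (as[i := g])"
  have d: "derivation_to K C V (\<lambda>a. E (as[i := a]))" "derivation_to K C V (\<lambda>a. D (as[i := a]))"
    using E D as i by (auto simp: multiderivation_to_def)
  show "E (as[i := a]) = D (as[i := a])"
    by (rule derivation_unique[OF V C K d _ IH frac[OF a] a]) (use xs in \<open>simp add: tuples_def\<close>)
qed

section \<open>Determinants and top forms\<close>

definition leibniz_det :: "nat \<Rightarrow> (nat \<Rightarrow> nat \<Rightarrow> 'f::field) \<Rightarrow> 'f" where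
  "leibniz_det n f = (\<Sum>p | p permutes {..<n}. of_int (sign p) * (\<Prod>i<n. f i (p i)))"

lemma leibniz_det_row:
  assumes "i < n"
  shows "leibniz_det n (f(i := u)) =
    (\<Sum>p | p permutes {..<n}. u (p i) * (of_int (sign p) * (\<Prod>k\<in>{..<n} - {i}. f k (p k))))"
  unfolding leibniz_det_def
proof (rule sum.cong[OF HOL.refl])
  fix p
  have "(\<Prod>k<n. (f(i := u)) k (p k)) = u (p i) * (\<Prod>k\<in>{..<n} - {i}. (f(i := u)) k (p k))"
    using assms by (subst prod.remove[of _ i]) auto
  also have "(\<Prod>k\<in>{..<n} - {i}. (f(i := u)) k (p k)) = (\<Prod>k\<in>{..<n} - {i}. f k (p k))"
    by (rule prod.cong) auto
  finally show "of_int (sign p) * (\<Prod>k<n. (f(i := u)) k (p k)) =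
      u (p i) * (of_int (sign p) * (\<Prod>k\<in>{..<n} - {i}. f k (p k)))"
    by (simp add: ac_simps)
qed

lemma leibniz_det_linear:
  assumes "i < n"
  shows "leibniz_det n (f(i := \<lambda>j. a * u j + b * v j)) =
    a * leibniz_det n (f(i := u)) + b * leibniz_det n (f(i := v))"
  by (simp add: leibniz_det_row[OF assms] sum_distrib_left sum.distrib[symmetric] algebra_simps)

text \<open>Even and odd permutations are matched by composing with the transposition of the two equal
  rows; comparing the sum with its own negative would not suffice in characteristic two.\<close>

lemma leibniz_det_alternating:
  assumes ij: "i < n" "j < n" "i \<noteq> j" and eq: "f i = f j"
  shows "leibniz_det n f = 0"
proof -
  let ?t = "Transposition.transpose i j" and ?A = "{p. p permutes {..<n}}"
  define g where "g p = of_int (sign p) * (\<Prod>k<n. f k (p k))" for p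
  have t: "?t permutes {..<n}" using ij by (intro permutes_swap_id) auto
  have fin: "finite ?A" by (simp add: finite_permutations)
  have sgn: "sign (p \<circ> ?t) = - sign p" if "p \<in> ?A" for p
    using that ij t by (simp add: sign_compose permutation_swap_id sign_swap_id
        permutes_imp_permutation[of "{..<n}"])
  have g: "g (p \<circ> ?t) = - g p" if p: "p \<in> ?A" for p
  proof -
    have ft: "f (?t k) = f k" for k
      using eq by (cases "k = i"; cases "k = j") (simp_all add: Transposition.transpose_def)
    have "(\<Prod>k<n. f k ((p \<circ> ?t) k)) = (\<Prod>k<n. f (?t k) ((p \<circ> ?t) (?t k)))"
      using prod.permute[OF t, of "\<lambda>k. f k ((p \<circ> ?t) k)"] by (simp add: comp_def)
    also have "\<dots> = (\<Prod>k<n. f k (p k))"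
      by (simp add: ft)
    finally show ?thesis by (simp add: g_def sgn[OF p])
  qed
  have even: "evenperm (p \<circ> ?t) \<longleftrightarrow> \<not> evenperm p" if "p \<in> ?A" for p
    using sgn[OF that] by (auto simp: sign_def split: if_splits)
  have closed: "p \<circ> ?t \<in> ?A" if "p \<in> ?A" for p
    using permutes_compose[OF t] that by auto
  have inv: "p \<circ> ?t \<circ> ?t = p" for p :: "nat \<Rightarrow> nat" by (simp add: fun_eq_iff)
  have "(\<Sum>p\<in>{p\<in>?A. \<not> evenperm p}. g p) = (\<Sum>p\<in>{p\<in>?A. evenperm p}. g (p \<circ> ?t))"
    by (rule sum.reindex_bij_witness[where i = "\<lambda>p. p \<circ> ?t" and j = "\<lambda>p. p \<circ> ?t"])
      (use even closed inv in auto)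
  also have "\<dots> = - (\<Sum>p\<in>{p\<in>?A. evenperm p}. g p)"
    unfolding sum_negf[symmetric] by (rule sum.cong) (auto simp: g)
  finally have "(\<Sum>p\<in>{p\<in>?A. evenperm p}. g p) + (\<Sum>p\<in>{p\<in>?A. \<not> evenperm p}. g p) = 0" by simp
  moreover have "sum g ({p\<in>?A. evenperm p} \<union> {p\<in>?A. \<not> evenperm p}) =
      (\<Sum>p\<in>{p\<in>?A. evenperm p}. g p) + (\<Sum>p\<in>{p\<in>?A. \<not> evenperm p}. g p)"
    by (rule sum.union_disjoint) (use fin in auto)
  moreover have "{p\<in>?A. evenperm p} \<union> {p\<in>?A. \<not> evenperm p} = ?A" by blast
  ultimately show ?thesis by (simp add: leibniz_det_def g_def)
qed

lemma leibniz_det_diagonal: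
  assumes "\<And>i j. i < n \<Longrightarrow> j < n \<Longrightarrow> i \<noteq> j \<Longrightarrow> f i j = 0"
  shows "leibniz_det n f = (\<Prod>i<n. f i i)"
proof -
  have zero: "(\<Prod>i<n. f i (p i)) = 0" if p: "p permutes {..<n}" and "p \<noteq> id" for p
  proof -
    obtain i where i: "p i \<noteq> i" using \<open>p \<noteq> id\<close> by (auto simp: fun_eq_iff)
    then have "i \<in> {..<n}" using p by (auto simp: permutes_def)
    then have "f i (p i) = 0" using assms[of i "p i"] i permutes_in_image[OF p, of i] by auto
    then show ?thesis using \<open>i \<in> {..<n}\<close> by (intro prod_zero) auto
  qed
  have "leibniz_det n f = (\<Sum>p\<in>{id}. of_int (sign p) * (\<Prod>i<n. f i (p i)))"
    unfolding leibniz_det_def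
    by (rule sum.mono_neutral_right) (auto simp: finite_permutations permutes_id zero)
  then show ?thesis by (simp add: sign_id)
qed

definition field_module :: "('f::field, 'f) module" where
  "field_module = \<lparr>carrier = UNIV, monoid.mult = undefined, one = undefined,
     ring.zero = 0, add = (+), module.smult = (*)\<rparr>"

lemma field_module_simps [simp]:
  "carrier field_module = UNIV" "\<zero>\<^bsub>field_module\<^esub> = 0"
  "a \<oplus>\<^bsub>field_module\<^esub> b = a + b" "a \<odot>\<^bsub>field_module\<^esub> b = a * b"
  by (simp_all add: field_module_def)

lemma field_module_module: "module ambient (field_module :: ('f::field, 'f) module)"
proof (rule moduleI[OF cring_from_type_algebra])
  show "abelian_group (field_module :: ('f, 'f) module)"
  proof (rule abelian_groupI)
    fix x :: 'f
    show "\<exists>y\<in>carrier field_module. y \<oplus>\<^bsub>field_module\<^esub> x = \<zero>\<^bsub>field_module\<^esub>"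
      by (rule bexI[of _ "- x"]) auto
  qed auto
qed (auto simp: algebra_simps)

lemma field_module_a_inv [simp]: "\<ominus>\<^bsub>field_module\<^esub> a = - (a :: 'f::field)"
proof -
  interpret module ambient "field_module :: ('f, 'f) module" by (rule field_module_module)
  show ?thesis by (rule M.minus_equality) auto
qed

abbreviation derivation :: "'f::field set \<Rightarrow> 'f set \<Rightarrow> ('f \<Rightarrow> 'f) \<Rightarrow> bool" where
  "derivation K C \<equiv> derivation_to K C field_module"

abbreviation multiderivation :: "'f::field set \<Rightarrow> 'f set \<Rightarrow> nat \<Rightarrow> ('f list \<Rightarrow> 'f) \<Rightarrow> bool" where
  "multiderivation K C n \<equiv> multiderivation_to K C n field_module"

definition jacobian :: "(nat \<Rightarrow> 'f::field \<Rightarrow> 'f) \<Rightarrow> 'f list \<Rightarrow> 'f" where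
  "jacobian \<theta> as = leibniz_det (length as) (\<lambda>i j. \<theta> j (as ! i))"

lemma jacobian_update:
  "i < length as \<Longrightarrow> jacobian \<theta> (as[i := a]) =
     leibniz_det (length as) ((\<lambda>i j. \<theta> j (as ! i))(i := \<lambda>j. \<theta> j a))"
  by (auto simp: jacobian_def fun_eq_iff nth_list_update intro!: arg_cong[where f = "leibniz_det _"])

lemma jacobian_multiderivation:
  assumes "\<And>j. derivation K C (\<theta> j)"
  shows "multiderivation K C n (jacobian \<theta>)"
proof -
  have \<theta>: "\<theta> j (a + b) = 1 * \<theta> j a + 1 * \<theta> j b" "\<theta> j (a * b) = a * \<theta> j b + b * \<theta> j a"
    if "a \<in> C" "b \<in> C" for j a b
    using assms[of j] that by (auto simp: derivation_to_def)
  have const: "\<theta> j c = 0" if "c \<in> K" for j c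
    using assms[of j] that by (auto simp: derivation_to_def)
  have alt: "jacobian \<theta> as = 0" if "length as = n" "i < j" "j < n" "as ! i = as ! j" for as i j
    unfolding jacobian_def that(1) by (rule leibniz_det_alternating[of i n j]) (use that in auto)
  show ?thesis
    unfolding multiderivation_to_def derivation_to_def
    using alt by (auto simp: tuples_def jacobian_update \<theta> const leibniz_det_row
        distrib_right sum.distrib sum_distrib_left mult.assoc)
qed

context
  fixes K C :: "'f::field set" and n :: nat
  assumes C: "subring C ambient" and K: "K \<subseteq> C"
begin

interpretation R: cring "sub C" by (rule sub_cring[OF C])

lemma K_carrier: "K \<subseteq> carrier (sub C)" using K by simp

lemmas kaehler_module' = kaehler_module[OF R.is_cring K_carrier]

lemma top_forms_module: "module (sub C) (top_forms K (sub C) n)"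
  unfolding top_forms_def by (rule ext_power_module[OF kaehler_module'])

lemma kdiffs_tuple:
  "as \<in> tuples C n \<Longrightarrow> map (kdiff K (sub C)) as \<in> tuples (carrier (kaehler K (sub C))) n"
  using kdiff_closed[OF R.is_cring K_carrier] by (auto simp: tuples_def)

lemma dwedge_wedge:
  "as \<in> tuples C n \<Longrightarrow> dwedge K (sub C) as = wedge (sub C) (kaehler K (sub C)) n (map (kdiff K (sub C)) as)"
  by (simp add: dwedge_def tuples_def)

lemma dwedge_closed: "as \<in> tuples C n \<Longrightarrow> dwedge K (sub C) as \<in> carrier (top_forms K (sub C) n)"
  unfolding top_forms_def
  by (simp add: dwedge_wedge wedge_closed[OF kaehler_module'] kdiffs_tuple)

lemma dwedge_add:
  assumes "as \<in> tuples C n" "i < n" "a \<in> C" "b \<in> C"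
  shows "dwedge K (sub C) (as[i := a + b]) =
    dwedge K (sub C) (as[i := a]) \<oplus>\<^bsub>top_forms K (sub C) n\<^esub> dwedge K (sub C) (as[i := b])"
  using assms kdiff_add[OF R.is_cring K_carrier, of a b] kdiff_closed[OF R.is_cring K_carrier]
  by (simp add: dwedge_wedge tuples_update subring_add[OF C] map_update top_forms_def
      wedge_add[OF kaehler_module' kdiffs_tuple])

lemma dwedge_mult:
  assumes "as \<in> tuples C n" "i < n" "a \<in> C" "b \<in> C"
  shows "dwedge K (sub C) (as[i := a * b]) =
    a \<odot>\<^bsub>top_forms K (sub C) n\<^esub> dwedge K (sub C) (as[i := b]) \<oplus>\<^bsub>top_forms K (sub C) n\<^esub>
    b \<odot>\<^bsub>top_forms K (sub C) n\<^esub> dwedge K (sub C) (as[i := a])"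
proof -
  interpret \<Omega>: module "sub C" "kaehler K (sub C)" by (rule kaehler_module')
  note cl = kdiff_closed[OF R.is_cring K_carrier]
  show ?thesis
  using assms kdiff_mult[OF R.is_cring K_carrier, of a b] cl[of a] cl[of b]
    \<Omega>.smult_closed[of a "kdiff K (sub C) b"] \<Omega>.smult_closed[of b "kdiff K (sub C) a"]
  by (simp add: dwedge_wedge tuples_update subring_mult[OF C] map_update top_forms_def
      wedge_add[OF kaehler_module' kdiffs_tuple] wedge_smult[OF kaehler_module' kdiffs_tuple])
qed

lemma dwedge_const:
  assumes "as \<in> tuples C n" "i < n" "c \<in> K"
  shows "dwedge K (sub C) (as[i := c]) = \<zero>\<^bsub>top_forms K (sub C) n\<^esub>"
proof -
  interpret \<Omega>: module "sub C" "kaehler K (sub C)" by (rule kaehler_module')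
  interpret M: module "sub C" "top_forms K (sub C) n" by (rule top_forms_module)
  let ?z = "\<zero>\<^bsub>kaehler K (sub C)\<^esub>" and ?w = "wedge (sub C) (kaehler K (sub C)) n"
  let ?ds = "map (kdiff K (sub C)) as"
  have "?w (?ds[i := \<zero>\<^bsub>sub C\<^esub> \<odot>\<^bsub>kaehler K (sub C)\<^esub> ?z]) =
      \<zero>\<^bsub>sub C\<^esub> \<odot>\<^bsub>top_forms K (sub C) n\<^esub> ?w (?ds[i := ?z])"
    unfolding top_forms_def
    by (rule wedge_smult[OF kaehler_module' kdiffs_tuple[OF assms(1)] assms(2)])
      (auto simp: subring_zero[OF C])
  also have "\<dots> = \<zero>\<^bsub>top_forms K (sub C) n\<^esub>"
    by (rule M.smult_l_null)
      (unfold top_forms_def, intro wedge_closed[OF kaehler_module'] tuples_update kdiffs_tuple assms \<Omega>.M.zero_closed)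
  finally have "?w (?ds[i := ?z]) = \<zero>\<^bsub>top_forms K (sub C) n\<^esub>"
    by (simp only: \<Omega>.smult_l_null[OF \<Omega>.M.zero_closed])
  moreover have "c \<in> C" by (rule subsetD[OF K assms(3)])
  ultimately show ?thesis
    using assms kdiff_const[OF R.is_cring K_carrier assms(3)]
    by (simp add: dwedge_wedge tuples_update map_update)
qed

lemma dwedge_alt:
  assumes "as \<in> tuples C n" "i < j" "j < n" "as ! i = as ! j"
  shows "dwedge K (sub C) as = \<zero>\<^bsub>top_forms K (sub C) n\<^esub>"
  unfolding dwedge_wedge[OF assms(1)] top_forms_def
  by (rule wedge_alt[OF kaehler_module' kdiffs_tuple[OF assms(1)] assms(2,3)])
    (use assms in \<open>auto simp: tuples_def\<close>)

lemma top_forms_induct: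
  assumes w: "w \<in> carrier (top_forms K (sub C) n)"
    and zero: "P (\<zero>\<^bsub>top_forms K (sub C) n\<^esub>)"
    and dwedge: "\<And>as. as \<in> tuples C n \<Longrightarrow> P (dwedge K (sub C) as)"
    and add: "\<And>x y. \<lbrakk>x \<in> carrier (top_forms K (sub C) n); y \<in> carrier (top_forms K (sub C) n); P x; P y\<rbrakk>
      \<Longrightarrow> P (x \<oplus>\<^bsub>top_forms K (sub C) n\<^esub> y)"
    and smult: "\<And>a x. \<lbrakk>a \<in> C; x \<in> carrier (top_forms K (sub C) n); P x\<rbrakk>
      \<Longrightarrow> P (a \<odot>\<^bsub>top_forms K (sub C) n\<^esub> x)"
  shows "P w"
proof -
  let ?\<Omega> = "kaehler K (sub C)" and ?M = "top_forms K (sub C) n"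
  let ?w = "wedge (sub C) ?\<Omega> n"
  interpret \<Omega>: module "sub C" ?\<Omega> by (rule kaehler_module')
  interpret M: module "sub C" ?M by (rule top_forms_module)
  have cl: "?w xs \<in> carrier ?M" if "xs \<in> tuples (carrier ?\<Omega>) n" for xs
    unfolding top_forms_def by (rule wedge_closed[OF kaehler_module' that])
  have base: "P (?w xs)" if xs: "xs \<in> tuples (kdiff K (sub C) ` C) n" for xs
  proof -
    have "xs \<in> lists (kdiff K (sub C) ` C)" using xs by (auto simp: tuples_def)
    then obtain as where as: "as \<in> lists C" "xs = map (kdiff K (sub C)) as"
      unfolding lists_image by blast
    then have "as \<in> tuples C n" using xs by (auto simp: tuples_def)
    then show ?thesis using dwedge[of as] as by (simp add: dwedge_wedge)
  qed
  have wedge: "P (?w xs)" if xs: "xs \<in> tuples (carrier ?\<Omega>) n" for xs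
  proof (rule slot_induct[where P = "\<lambda>xs. P (?w xs)", OF _ base _ xs])
    show "kdiff K (sub C) ` C \<subseteq> carrier ?\<Omega>" using kdiff_closed[OF R.is_cring K_carrier] by auto
    fix xs i x
    assume xs: "xs \<in> tuples (carrier ?\<Omega>) n" and i: "i < n"
      and IH: "\<And>g. g \<in> kdiff K (sub C) ` C \<Longrightarrow> P (?w (xs[i := g]))" and x: "x \<in> carrier ?\<Omega>"
    have cl': "?w (xs[i := y]) \<in> carrier ?M" if "y \<in> carrier ?\<Omega>" for y
      by (intro cl tuples_update xs that)
    show "P (?w (xs[i := x]))"
      using x
    proof (rule kaehler_induct[OF R.is_cring K_carrier])
      have "?w (xs[i := \<zero>\<^bsub>sub C\<^esub> \<odot>\<^bsub>?\<Omega>\<^esub> \<zero>\<^bsub>?\<Omega>\<^esub>]) = \<zero>\<^bsub>sub C\<^esub> \<odot>\<^bsub>?M\<^esub> ?w (xs[i := \<zero>\<^bsub>?\<Omega>\<^esub>])"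
        unfolding top_forms_def by (rule wedge_smult[OF kaehler_module' xs i]) (auto simp: subring_zero[OF C])
      also have "\<dots> = \<zero>\<^bsub>?M\<^esub>" by (rule M.smult_l_null) (intro cl' \<Omega>.M.zero_closed)
      finally have "?w (xs[i := \<zero>\<^bsub>?\<Omega>\<^esub>]) = \<zero>\<^bsub>?M\<^esub>"
        by (simp only: \<Omega>.smult_l_null[OF \<Omega>.M.zero_closed])
      then show "P (?w (xs[i := \<zero>\<^bsub>?\<Omega>\<^esub>]))" using zero by simp
    next
      fix a assume "a \<in> carrier (sub C)"
      then show "P (?w (xs[i := kdiff K (sub C) a]))" using IH by simp
    next
      fix y z assume yz: "y \<in> carrier ?\<Omega>" "z \<in> carrier ?\<Omega>" "P (?w (xs[i := y]))" "P (?w (xs[i := z]))"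
      show "P (?w (xs[i := y \<oplus>\<^bsub>?\<Omega>\<^esub> z]))"
        unfolding wedge_add[OF kaehler_module' xs i yz(1,2)] top_forms_def[symmetric]
        by (intro add cl' yz)
    next
      fix a y assume y: "a \<in> carrier (sub C)" "y \<in> carrier ?\<Omega>" "P (?w (xs[i := y]))"
      show "P (?w (xs[i := a \<odot>\<^bsub>?\<Omega>\<^esub> y]))"
        unfolding wedge_smult[OF kaehler_module' xs i y(1,2)] top_forms_def[symmetric]
        using y by (intro smult cl') simp_all
    qed
  qed
  show ?thesis
    by (rule ext_power_induct[OF kaehler_module' w[unfolded top_forms_def]])
      (auto simp: top_forms_def[symmetric] zero wedge intro: add smult)
qed

lemma linear_to_dwedge_multiderivation:
  assumes "linear_to C (top_forms K (sub C) n) \<psi>"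
  shows "multiderivation K C n (\<lambda>as. \<psi> (dwedge K (sub C) as))"
proof -
  interpret M: module "sub C" "top_forms K (sub C) n" by (rule top_forms_module)
  show ?thesis
    unfolding multiderivation_to_def derivation_to_def
    using linear_to_zero[OF top_forms_module assms]
    by (auto simp: dwedge_add dwedge_mult dwedge_const dwedge_closed tuples_update
        linear_to_add[OF assms] linear_to_smult[OF assms] M.smult_closed dest: dwedge_alt)
qed

lemma linear_to_eqI:
  assumes g: "linear_to C (top_forms K (sub C) n) g" and h: "linear_to C (top_forms K (sub C) n) h"
    and eq: "\<And>as. as \<in> tuples C n \<Longrightarrow> g (dwedge K (sub C) as) = h (dwedge K (sub C) as)"
    and w: "w \<in> carrier (top_forms K (sub C) n)"
  shows "g w = h w"
  using w by (rule top_forms_induct)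
    (auto simp: linear_to_zero[OF top_forms_module g] linear_to_zero[OF top_forms_module h] eq
      linear_to_add[OF g] linear_to_add[OF h] linear_to_smult[OF g] linear_to_smult[OF h])

lemma jacobian_functional:
  assumes \<theta>: "\<And>j. derivation K C (\<theta> j)"
  shows "\<exists>\<Phi>. linear_to C (top_forms K (sub C) n) \<Phi> \<and>
    (\<forall>as\<in>tuples C n. \<Phi> (dwedge K (sub C) as) = jacobian \<theta> as)"
proof -
  let ?\<Omega> = "kaehler K (sub C)"
  have "\<exists>g. linear_to C ?\<Omega> g \<and> (\<forall>a\<in>C. g (kdiff K (sub C) a) = \<theta> j a)" for j
    by (rule kaehler_functional[OF C K]) (use \<theta>[of j] in \<open>auto simp: derivation_to_def\<close>)
  then obtain g where lin: "\<And>j. linear_to C ?\<Omega> (g j)"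
    and g: "\<And>j a. a \<in> C \<Longrightarrow> g j (kdiff K (sub C) a) = \<theta> j a"
    by metis
  define E where "E ws = leibniz_det n (\<lambda>i j. g j (ws ! i))" for ws
  have upd: "E (ws[i := w]) = leibniz_det n ((\<lambda>i j. g j (ws ! i))(i := \<lambda>j. g j w))"
    if "ws \<in> tuples (carrier ?\<Omega>) n" "i < n" for ws i w
    using that by (auto simp: E_def fun_eq_iff nth_list_update tuples_def
        intro!: arg_cong[where f = "leibniz_det _"])
  have "\<exists>\<Phi>. linear_to C (ext_power (sub C) ?\<Omega> n) \<Phi> \<and>
    (\<forall>ws\<in>tuples (carrier ?\<Omega>) n. \<Phi> (wedge (sub C) ?\<Omega> n ws) = E ws)"
  proof (rule ext_power_functional[OF C K kaehler_module'], goal_cases)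
    case (1 ws i y z)
    then show ?case
      using leibniz_det_linear[of i n "\<lambda>i j. g j (ws ! i)" 1 "\<lambda>j. g j y" 1 "\<lambda>j. g j z"]
      by (simp add: upd linear_to_add[OF lin])
  next
    case (2 ws i a y)
    then show ?case
      using leibniz_det_linear[of i n "\<lambda>i j. g j (ws ! i)" a "\<lambda>j. g j y" 0 "\<lambda>j. g j y"]
      by (simp add: upd linear_to_smult[OF lin])
  next
    case (3 ws i j)
    then show ?case unfolding E_def by (intro leibniz_det_alternating[of i n j]) auto
  qed
  then obtain \<Phi> where \<Phi>: "linear_to C (top_forms K (sub C) n) \<Phi>"
    "\<And>ws. ws \<in> tuples (carrier ?\<Omega>) n \<Longrightarrow> \<Phi> (wedge (sub C) ?\<Omega> n ws) = E ws"
    unfolding top_forms_def by blast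
  have "E (map (kdiff K (sub C)) as) = jacobian \<theta> as" if as: "as \<in> tuples C n" for as
  proof -
    have len: "length as = n" "\<And>i. i < n \<Longrightarrow> as ! i \<in> C" using as by (auto simp: tuples_def)
    show ?thesis unfolding E_def jacobian_def len leibniz_det_def
      by (intro sum.cong HOL.refl arg_cong2[where f = "(*)"] prod.cong) (auto simp: len g)
  qed
  then show ?thesis
    using \<Phi> by (intro exI[of _ \<Phi>]) (auto simp: dwedge_wedge kdiffs_tuple)
qed

end

section \<open>The canonical module of a subring\<close>

lemma dual_module_simps:
  "f \<in> carrier (dual_module (sub C) M) \<longleftrightarrow>
     f \<in> extensional (carrier M) \<and> (\<forall>x\<in>carrier M. f x \<in> C) \<and> linear_to C M f"
  "f \<oplus>\<^bsub>dual_module (sub C) M\<^esub> g = (\<lambda>x\<in>carrier M. f x + g x)"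
  "a \<odot>\<^bsub>dual_module (sub C) M\<^esub> f = (\<lambda>x\<in>carrier M. a * f x)"
  by (auto simp: dual_module_def linear_to_def PiE_iff)

lemma multiderivation_smult:
  assumes V: "module ambient V" and D: "multiderivation K C n D" and v: "v \<in> carrier V"
  shows "multiderivation_to K C n V (\<lambda>as. D as \<odot>\<^bsub>V\<^esub> v)"
proof -
  interpret V: module ambient V by fact
  have sm: "a \<odot>\<^bsub>V\<^esub> v \<in> carrier V" for a using V.smult_closed[OF _ v] by simp
  have l: "(a + b) \<odot>\<^bsub>V\<^esub> v = a \<odot>\<^bsub>V\<^esub> v \<oplus>\<^bsub>V\<^esub> b \<odot>\<^bsub>V\<^esub> v" for a b
    using V.smult_l_distr[of a b v] v by simp
  have m: "(a * b) \<odot>\<^bsub>V\<^esub> v = a \<odot>\<^bsub>V\<^esub> (b \<odot>\<^bsub>V\<^esub> v)" for a b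
    using V.smult_assoc1[of a b v] v by simp
  have z: "0 \<odot>\<^bsub>V\<^esub> v = \<zero>\<^bsub>V\<^esub>" using V.smult_l_null[OF v] by simp
  show ?thesis
    using D unfolding multiderivation_to_def derivation_to_def
    by (auto simp: sm l m z)
qed

locale jacobian_ring =
  fixes K C :: "'f::field set" and n :: nat and xs :: "'f list" and \<theta> :: "nat \<Rightarrow> 'f \<Rightarrow> 'f"
  assumes C: "subring C ambient" and K: "K \<subseteq> C" "1 \<in> K"
    and xs: "xs \<in> tuples C n"
    and frac: "\<And>a. \<exists>p\<in>gen (K \<union> set xs). \<exists>q\<in>gen (K \<union> set xs). q \<noteq> 0 \<and> a * q = p"
    and \<theta>: "\<And>j. derivation K UNIV (\<theta> j)"
    and nonzero: "jacobian \<theta> xs \<noteq> 0"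
    and jacobian_mem: "\<And>as. as \<in> tuples C n \<Longrightarrow> jacobian \<theta> as \<in> C"
    and jacobian_conductor: "\<And>c. (\<And>as. as \<in> tuples C n \<Longrightarrow> c * jacobian \<theta> as \<in> C) \<Longrightarrow> c \<in> C"
begin

abbreviation "M \<equiv> top_forms K (sub C) n"
abbreviation "MF \<equiv> top_forms K (ambient :: 'f ring) n"
abbreviation "M1 \<equiv> dual_module (sub C) M"
abbreviation "N \<equiv> canonical_module K (sub C) n"

lemma K_UNIV: "K \<subseteq> UNIV" by simp

lemmas ambient_facts = UNIV_subring K_UNIV
lemmas MF_module = top_forms_module[OF ambient_facts, unfolded sub_UNIV]

sublocale MF: module ambient MF by (rule MF_module)
sublocale M: module "sub C" M by (rule top_forms_module[OF C K(1)])

lemma derivation_C: "derivation K C (\<theta> j)"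
  using \<theta>[of j] by (auto simp: derivation_to_def)

definition \<Phi> :: "(('f \<Rightarrow> 'f) set list \<Rightarrow> 'f) set \<Rightarrow> 'f" where
  "\<Phi> = (SOME \<Phi>. linear_to C M \<Phi> \<and> (\<forall>as\<in>tuples C n. \<Phi> (dwedge K (sub C) as) = jacobian \<theta> as))"

definition \<Phi>F :: "(('f \<Rightarrow> 'f) set list \<Rightarrow> 'f) set \<Rightarrow> 'f" where
  "\<Phi>F = (SOME \<Phi>. linear_to UNIV MF \<Phi> \<and> (\<forall>as\<in>tuples UNIV n. \<Phi> (dwedge K ambient as) = jacobian \<theta> as))"

lemma \<Phi>_linear: "linear_to C M \<Phi>"
  and \<Phi>_dwedge: "as \<in> tuples C n \<Longrightarrow> \<Phi> (dwedge K (sub C) as) = jacobian \<theta> as"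
  using someI_ex[OF jacobian_functional[OF C K(1), of \<theta> n, OF derivation_C]] unfolding \<Phi>_def by auto

lemma \<Phi>F_linear: "linear_to UNIV MF \<Phi>F"
  and \<Phi>F_dwedge: "as \<in> tuples UNIV n \<Longrightarrow> \<Phi>F (dwedge K ambient as) = jacobian \<theta> as"
  using someI_ex[OF jacobian_functional[OF ambient_facts, of \<theta> n, OF \<theta>, unfolded sub_UNIV]]
  unfolding \<Phi>F_def by auto

lemma \<Phi>_mem: "w \<in> carrier M \<Longrightarrow> \<Phi> w \<in> C"
  by (rule top_forms_induct[OF C K(1)])
    (auto simp: linear_to_zero[OF M.module_axioms \<Phi>_linear] \<Phi>_dwedge jacobian_mem
      linear_to_add[OF \<Phi>_linear] linear_to_smult[OF \<Phi>_linear] intro: subring_closed[OF C])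

lemma tuples_UNIV: "as \<in> tuples C n \<Longrightarrow> as \<in> tuples UNIV n"
  by (auto simp: tuples_def)

definition \<mu> where "\<mu> = inverse (jacobian \<theta> xs) \<odot>\<^bsub>MF\<^esub> dwedge K ambient xs"

lemmas dwedge_closed_F = dwedge_closed[OF ambient_facts, unfolded sub_UNIV]

lemma smult_closed_F: "v \<in> carrier MF \<Longrightarrow> a \<odot>\<^bsub>MF\<^esub> v \<in> carrier MF"
  using MF.smult_closed[of a v] by simp

lemma smult_assoc_F: "v \<in> carrier MF \<Longrightarrow> a \<odot>\<^bsub>MF\<^esub> (b \<odot>\<^bsub>MF\<^esub> v) = (a * b) \<odot>\<^bsub>MF\<^esub> v"
  using MF.smult_assoc1[of a b v] by simp

lemma \<mu>_closed: "\<mu> \<in> carrier MF"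
  unfolding \<mu>_def by (intro smult_closed_F dwedge_closed_F tuples_UNIV xs)

lemma \<Phi>F_smult: "v \<in> carrier MF \<Longrightarrow> \<Phi>F (a \<odot>\<^bsub>MF\<^esub> v) = a * \<Phi>F v"
  using linear_to_smult[OF \<Phi>F_linear] by simp

lemma \<Phi>F_\<mu>: "\<Phi>F \<mu> = 1"
  unfolding \<mu>_def using nonzero
  by (simp add: \<Phi>F_smult[OF dwedge_closed_F[OF tuples_UNIV[OF xs]]] \<Phi>F_dwedge[OF tuples_UNIV[OF xs]])

lemma dwedge_multiderivation: "multiderivation_to K UNIV n MF (dwedge K ambient)"
  unfolding multiderivation_to_def derivation_to_def
  using dwedge_add[OF ambient_facts] dwedge_mult[OF ambient_facts] dwedge_const[OF ambient_facts]
    dwedge_alt[OF ambient_facts] dwedge_closed[OF ambient_facts]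
  by (auto simp: sub_UNIV tuples_update)

text \<open>The top forms of the field are one-dimensional.\<close>

lemma dwedge_jacobian: "as \<in> tuples UNIV n \<Longrightarrow> dwedge K ambient as = jacobian \<theta> as \<odot>\<^bsub>MF\<^esub> \<mu>"
proof (rule multiderivation_unique[OF MF_module UNIV_subring K_UNIV K(2) dwedge_multiderivation
      multiderivation_smult[OF MF_module jacobian_multiderivation[OF \<theta>] \<mu>_closed]
      tuples_UNIV[OF xs] _ frac])
  have "dwedge K ambient xs \<in> carrier MF" by (intro dwedge_closed_F tuples_UNIV xs)
  then show "dwedge K ambient xs = jacobian \<theta> xs \<odot>\<^bsub>MF\<^esub> \<mu>"
    unfolding \<mu>_def using nonzero MF.smult_one by (simp add: smult_assoc_F)
qed

lemma top_form_eq: "v \<in> carrier MF \<Longrightarrow> v = \<Phi>F v \<odot>\<^bsub>MF\<^esub> \<mu>"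
proof (rule top_forms_induct[where P = "\<lambda>v. v = \<Phi>F v \<odot>\<^bsub>MF\<^esub> \<mu>", OF ambient_facts, unfolded sub_UNIV])
  show "\<zero>\<^bsub>MF\<^esub> = \<Phi>F \<zero>\<^bsub>MF\<^esub> \<odot>\<^bsub>MF\<^esub> \<mu>"
    using linear_to_zero[OF top_forms_module[OF ambient_facts], unfolded sub_UNIV, OF \<Phi>F_linear]
      MF.smult_l_null[OF \<mu>_closed] by simp
next
  fix as :: "'f list" assume "as \<in> tuples UNIV n"
  then show "dwedge K ambient as = \<Phi>F (dwedge K ambient as) \<odot>\<^bsub>MF\<^esub> \<mu>"
    by (simp only: \<Phi>F_dwedge) (rule dwedge_jacobian)
next
  fix v w assume vw: "v \<in> carrier MF" "w \<in> carrier MF"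
    and eq: "v = \<Phi>F v \<odot>\<^bsub>MF\<^esub> \<mu>" "w = \<Phi>F w \<odot>\<^bsub>MF\<^esub> \<mu>"
  have "\<Phi>F (v \<oplus>\<^bsub>MF\<^esub> w) \<odot>\<^bsub>MF\<^esub> \<mu> = \<Phi>F v \<odot>\<^bsub>MF\<^esub> \<mu> \<oplus>\<^bsub>MF\<^esub> \<Phi>F w \<odot>\<^bsub>MF\<^esub> \<mu>"
    using linear_to_add[OF \<Phi>F_linear vw] MF.smult_l_distr[OF _ _ \<mu>_closed] by simp
  then show "v \<oplus>\<^bsub>MF\<^esub> w = \<Phi>F (v \<oplus>\<^bsub>MF\<^esub> w) \<odot>\<^bsub>MF\<^esub> \<mu>" using eq by simp
next
  fix a v assume v: "v \<in> carrier MF" and eq: "v = \<Phi>F v \<odot>\<^bsub>MF\<^esub> \<mu>"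
  have "\<Phi>F (a \<odot>\<^bsub>MF\<^esub> v) \<odot>\<^bsub>MF\<^esub> \<mu> = a \<odot>\<^bsub>MF\<^esub> (\<Phi>F v \<odot>\<^bsub>MF\<^esub> \<mu>)"
    using v \<mu>_closed by (simp add: \<Phi>F_smult smult_assoc_F)
  then show "a \<odot>\<^bsub>MF\<^esub> v = \<Phi>F (a \<odot>\<^bsub>MF\<^esub> v) \<odot>\<^bsub>MF\<^esub> \<mu>" using eq by simp
qed

text \<open>The dual of the top forms.\<close>

definition \<psi> :: "'f \<Rightarrow> (('f \<Rightarrow> 'f) set list \<Rightarrow> 'f) set \<Rightarrow> 'f" where
  "\<psi> c = (\<lambda>w\<in>carrier M. c * \<Phi> w)"

lemma dwedge_xs_closed: "dwedge K (sub C) xs \<in> carrier M"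
  by (rule dwedge_closed[OF C K(1) xs])

lemma \<psi>_linear: "linear_to C M (\<psi> c)"
  using linear_to_add[OF \<Phi>_linear] linear_to_smult[OF \<Phi>_linear] M.smult_closed M.M.add.m_closed
  by (auto simp: linear_to_def \<psi>_def algebra_simps)

lemma \<psi>_closed: "c \<in> C \<Longrightarrow> \<psi> c \<in> carrier M1"
  using \<psi>_linear[of c] \<Phi>_mem by (auto simp: dual_module_simps \<psi>_def intro: subring_mult[OF C])

lemma \<psi>_dwedge: "as \<in> tuples C n \<Longrightarrow> \<psi> c (dwedge K (sub C) as) = c * jacobian \<theta> as"
  using dwedge_closed[OF C K(1)] by (simp add: \<psi>_def \<Phi>_dwedge)

lemma \<psi>_inject:
  assumes "\<psi> c = \<psi> d" shows "c = d"
proof -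
  have "c * jacobian \<theta> xs = d * jacobian \<theta> xs"
    using \<psi>_dwedge[OF xs, of c] \<psi>_dwedge[OF xs, of d] unfolding assms by (rule HOL.trans[OF sym])
  then show ?thesis using nonzero by simp
qed

lemma dual_top_forms:
  assumes f: "f \<in> carrier M1"
  obtains c where "c \<in> C" "f = \<psi> c"
proof -
  define c where "c = f (dwedge K (sub C) xs) / jacobian \<theta> xs"
  have lin: "linear_to C M f" and ext: "f \<in> extensional (carrier M)"
    and mem: "\<And>w. w \<in> carrier M \<Longrightarrow> f w \<in> C"
    using f by (auto simp: dual_module_simps)
  have jac: "multiderivation K C n (\<lambda>as. c * jacobian \<theta> as)"
    using multiderivation_smult[OF field_module_module jacobian_multiderivation[OF derivation_C], of c]
    by (simp add: mult.commute)
  have val: "f (dwedge K (sub C) as) = c * jacobian \<theta> as" if "as \<in> tuples C n" for as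
    by (rule multiderivation_unique[OF field_module_module C K
          linear_to_dwedge_multiderivation[OF C K(1) lin] jac xs _ frac that])
      (use nonzero in \<open>simp add: c_def\<close>)
  have "c \<in> C"
  proof (rule jacobian_conductor)
    fix as assume as: "as \<in> tuples C n"
    then show "c * jacobian \<theta> as \<in> C"
      using mem[OF dwedge_closed[OF C K(1) as]] val[OF as] by simp
  qed
  moreover have "f = \<psi> c"
  proof (rule extensionalityI[OF ext])
    show "\<psi> c \<in> extensional (carrier M)" by (simp add: \<psi>_def)
    fix w assume w: "w \<in> carrier M"
    show "f w = \<psi> c w"
      by (rule linear_to_eqI[OF C K(1) lin \<psi>_linear _ w]) (simp add: val \<psi>_dwedge)
  qed
  ultimately show ?thesis by (rule that)
qed

lemma localized_\<psi>:
  "localized_functional K (sub C) n (\<psi> c) = (\<lambda>v\<in>carrier MF. c * \<Phi>F v)" (is "_ = ?\<psi>'")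
  unfolding localized_functional_def
proof (rule the_equality, intro conjI ballI)
  have lin: "linear_to UNIV MF ?\<psi>'"
    using linear_to_add[OF \<Phi>F_linear] linear_to_smult[OF \<Phi>F_linear] smult_closed_F MF.M.add.m_closed
    by (auto simp: linear_to_def algebra_simps)
  then show "?\<psi>' \<in> carrier (dual_module ambient MF)"
    by (simp add: dual_module_simps(1)[of _ UNIV, unfolded sub_UNIV])
  fix as assume "as \<in> tuples (carrier (sub C)) n"
  then have as: "as \<in> tuples C n" by simp
  then show "?\<psi>' (dwedge K ambient as) = \<psi> c (dwedge K (sub C) as)"
    using dwedge_closed[OF C K(1) as] dwedge_closed_F[OF tuples_UNIV[OF as]]
    by (simp add: \<psi>_def \<Phi>_dwedge \<Phi>F_dwedge tuples_UNIV)
next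
  fix g assume g: "g \<in> carrier (dual_module ambient MF) \<and>
    (\<forall>as\<in>tuples (carrier (sub C)) n. g (dwedge K ambient as) = \<psi> c (dwedge K (sub C) as))"
  then have lin: "linear_to UNIV MF g" and ext: "g \<in> extensional (carrier MF)"
    by (auto simp: dual_module_simps(1)[of _ UNIV, unfolded sub_UNIV])
  have "g (dwedge K ambient xs) = c * jacobian \<theta> xs"
    using g xs dwedge_xs_closed by (simp add: \<psi>_def \<Phi>_dwedge)
  moreover have "g (dwedge K ambient xs) = jacobian \<theta> xs * g \<mu>"
    using dwedge_jacobian[OF tuples_UNIV[OF xs]] linear_to_smult[OF lin _ \<mu>_closed] by simp
  ultimately have "g \<mu> = c" using nonzero by simp
  have "g v = c * \<Phi>F v" if v: "v \<in> carrier MF" for v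
  proof -
    have "g v = g (\<Phi>F v \<odot>\<^bsub>MF\<^esub> \<mu>)" using top_form_eq[OF v] by simp
    also have "\<dots> = \<Phi>F v * g \<mu>" by (rule linear_to_smult[OF lin _ \<mu>_closed]) simp
    finally show ?thesis by (simp add: \<open>g \<mu> = c\<close>)
  qed
  then show "g = ?\<psi>'" using ext by (intro extensionalityI[of _ "carrier MF"]) auto
qed

text \<open>The bidual.\<close>

definition \<phi> :: "'f \<Rightarrow> ((('f \<Rightarrow> 'f) set list \<Rightarrow> 'f) set \<Rightarrow> 'f) \<Rightarrow> 'f" where
  "\<phi> d = (\<lambda>f\<in>carrier M1. d * (THE c. f = \<psi> c))"

lemma \<phi>_\<psi>: "c \<in> C \<Longrightarrow> \<phi> d (\<psi> c) = d * c"
  using the_equality[of "\<lambda>c'. \<psi> c = \<psi> c'" c] by (auto simp: \<phi>_def \<psi>_closed dest: \<psi>_inject)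

lemma \<psi>_add: "\<psi> c \<oplus>\<^bsub>M1\<^esub> \<psi> d = \<psi> (c + d)"
  by (auto simp: dual_module_simps \<psi>_def fun_eq_iff algebra_simps)

lemma \<psi>_smult: "a \<odot>\<^bsub>M1\<^esub> \<psi> c = \<psi> (a * c)"
  by (auto simp: dual_module_simps \<psi>_def fun_eq_iff algebra_simps)

lemma \<phi>_closed: "d \<in> C \<Longrightarrow> \<phi> d \<in> carrier N"
  unfolding canonical_module_def dual_module_simps(1)
proof (intro conjI ballI)
  assume d: "d \<in> C"
  show "\<phi> d \<in> extensional (carrier M1)" by (simp add: \<phi>_def)
  show "\<phi> d f \<in> C" if "f \<in> carrier M1" for f
    using that d by (elim dual_top_forms) (simp add: \<phi>_\<psi> subring_mult[OF C])
  show "linear_to C M1 (\<phi> d)"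
    unfolding linear_to_def
  proof (intro conjI ballI)
    fix f g assume "f \<in> carrier M1" "g \<in> carrier M1"
    then show "\<phi> d (f \<oplus>\<^bsub>M1\<^esub> g) = \<phi> d f + \<phi> d g"
      by (elim dual_top_forms) (simp add: \<psi>_add \<phi>_\<psi> subring_add[OF C] algebra_simps)
  next
    fix a f assume "a \<in> C" "f \<in> carrier M1"
    then show "\<phi> d (a \<odot>\<^bsub>M1\<^esub> f) = a * \<phi> d f"
      by (elim dual_top_forms) (simp add: \<psi>_smult \<phi>_\<psi> subring_mult[OF C])
  qed
qed

lemma canonical_module_cases:
  assumes h: "h \<in> carrier N"
  obtains d where "d \<in> C" "h = \<phi> d"
proof
  have one: "1 \<in> C" by (rule subsetD[OF K])
  have lin: "linear_to C M1 h" and ext: "h \<in> extensional (carrier M1)"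
    and mem: "\<And>f. f \<in> carrier M1 \<Longrightarrow> h f \<in> C"
    using h unfolding canonical_module_def by (auto simp: dual_module_simps(1))
  show "h (\<psi> 1) \<in> C" by (rule mem[OF \<psi>_closed[OF one]])
  show "h = \<phi> (h (\<psi> 1))"
  proof (rule extensionalityI[OF ext])
    show "\<phi> (h (\<psi> 1)) \<in> extensional (carrier M1)" by (simp add: \<phi>_def)
    fix f assume "f \<in> carrier M1"
    then obtain c where c: "c \<in> C" "f = \<psi> c" by (rule dual_top_forms)
    have "h f = h (c \<odot>\<^bsub>M1\<^esub> \<psi> 1)" by (simp add: c \<psi>_smult)
    also have "\<dots> = c * h (\<psi> 1)" by (rule linear_to_smult[OF lin c(1) \<psi>_closed[OF one]])
    finally show "h f = \<phi> (h (\<psi> 1)) f" using c by (simp add: \<phi>_\<psi>)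
  qed
qed

lemma \<phi>_inject:
  assumes "\<phi> c = \<phi> d" shows "c = d"
proof -
  have one: "1 \<in> C" by (rule subsetD[OF K])
  have "c * 1 = d * 1"
    using \<phi>_\<psi>[OF one, of c] \<phi>_\<psi>[OF one, of d] unfolding assms by (rule HOL.trans[OF sym])
  then show ?thesis by simp
qed

lemma \<phi>_smult: "a \<odot>\<^bsub>N\<^esub> \<phi> d = \<phi> (a * d)"
  unfolding canonical_module_def dual_module_simps(3) by (auto simp: \<phi>_def fun_eq_iff)

lemma embedding_\<phi>: "canonical_embedding K (sub C) n (\<phi> d) = d \<odot>\<^bsub>MF\<^esub> \<mu>"
  unfolding canonical_embedding_def
proof (rule the_equality, intro conjI ballI)
  show d\<mu>: "d \<odot>\<^bsub>MF\<^esub> \<mu> \<in> carrier MF" by (rule smult_closed_F[OF \<mu>_closed])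
  fix f assume "f \<in> carrier M1"
  then obtain c where "c \<in> C" "f = \<psi> c" by (rule dual_top_forms)
  then show "localized_functional K (sub C) n f (d \<odot>\<^bsub>MF\<^esub> \<mu>) = \<phi> d f"
    using d\<mu> by (simp add: localized_\<psi> \<phi>_\<psi> \<Phi>F_smult[OF \<mu>_closed] \<Phi>F_\<mu>)
next
  fix v assume v: "v \<in> carrier MF \<and>
    (\<forall>f\<in>carrier M1. localized_functional K (sub C) n f v = \<phi> d f)"
  have one: "1 \<in> C" by (rule subsetD[OF K])
  have "localized_functional K (sub C) n (\<psi> 1) v = \<phi> d (\<psi> 1)" 
    by (rule bspec[OF conjunct2[OF v] \<psi>_closed[OF one]])
  then have "\<Phi>F v = d" using v by (simp add: localized_\<psi> \<phi>_\<psi>[OF one])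
  then show "v = d \<odot>\<^bsub>MF\<^esub> \<mu>" using top_form_eq[of v] v by simp
qed

theorem canonical_module_free:
  assumes \<epsilon>: "\<epsilon> \<in> C" "\<epsilon> * \<epsilon> = 1"
  shows "free_of_rank_one (sub C) N"
    and "inj_on (canonical_embedding K (sub C) n) (carrier N)"
    and "canonical_embedding K (sub C) n ` carrier N = {a \<odot>\<^bsub>MF\<^esub> (\<epsilon> \<odot>\<^bsub>MF\<^esub> \<mu>) | a. a \<in> C}"
    and "\<exists>w\<in>carrier N. canonical_embedding K (sub C) n w = \<epsilon> \<odot>\<^bsub>MF\<^esub> \<mu> \<and>
      carrier N = {a \<odot>\<^bsub>N\<^esub> w | a. a \<in> C}"
proof -
  have carrier_N: "carrier N = \<phi> ` C"
    using canonical_module_cases \<phi>_closed by blast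
  have div: "\<exists>a. d = a * \<epsilon> \<and> a \<in> C" if "d \<in> C" for d
    by (rule exI[of _ "d * \<epsilon>"]) (use \<epsilon> that in \<open>simp add: mult.assoc subring_mult[OF C]\<close>)
  have img: "carrier N = (\<lambda>a. \<phi> (a * \<epsilon>)) ` C"
    unfolding carrier_N using div \<epsilon>(1) subring_mult[OF C] by blast
  then have gen: "carrier N = {a \<odot>\<^bsub>N\<^esub> \<phi> \<epsilon> | a. a \<in> C}"
    unfolding \<phi>_smult by blast
  have "inj_on (\<lambda>a. a \<odot>\<^bsub>N\<^esub> \<phi> \<epsilon>) C"
    unfolding \<phi>_smult using \<epsilon>(2) by (intro inj_onI) (auto dest!: \<phi>_inject)
  then have "bij_betw (\<lambda>a. a \<odot>\<^bsub>N\<^esub> \<phi> \<epsilon>) C (carrier N)"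
    using gen unfolding bij_betw_def by blast
  then show "free_of_rank_one (sub C) N"
    unfolding free_of_rank_one_def using \<phi>_closed[OF \<epsilon>(1)] by auto
  show "inj_on (canonical_embedding K (sub C) n) (carrier N)"
  proof (rule inj_onI)
    fix h h' assume "h \<in> carrier N" "h' \<in> carrier N"
      "canonical_embedding K (sub C) n h = canonical_embedding K (sub C) n h'"
    then obtain d d' where d: "h = \<phi> d" "h' = \<phi> d'" "d \<odot>\<^bsub>MF\<^esub> \<mu> = d' \<odot>\<^bsub>MF\<^esub> \<mu>"
      unfolding carrier_N by (auto simp: embedding_\<phi>)
    from arg_cong[OF d(3), of \<Phi>F] have "d = d'"
      by (simp add: \<Phi>F_smult[OF \<mu>_closed] \<Phi>F_\<mu>)
    then show "h = h'" using d(1,2) by simp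
  qed
  have "canonical_embedding K (sub C) n ` carrier N = (\<lambda>a. (a * \<epsilon>) \<odot>\<^bsub>MF\<^esub> \<mu>) ` C"
    unfolding img image_image embedding_\<phi> ..
  then show "canonical_embedding K (sub C) n ` carrier N = {a \<odot>\<^bsub>MF\<^esub> (\<epsilon> \<odot>\<^bsub>MF\<^esub> \<mu>) | a. a \<in> C}"
    unfolding smult_assoc_F[OF \<mu>_closed] by blast
  show "\<exists>w\<in>carrier N. canonical_embedding K (sub C) n w = \<epsilon> \<odot>\<^bsub>MF\<^esub> \<mu> \<and>
      carrier N = {a \<odot>\<^bsub>N\<^esub> w | a. a \<in> C}"
    by (rule bexI[of _ "\<phi> \<epsilon>"]) (use gen in \<open>simp add: embedding_\<phi>\<close>, rule \<phi>_closed[OF \<epsilon>(1)])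
qed

end

section \<open>Transcendental elements\<close>

definition transc :: "'f::field set \<Rightarrow> 'f \<Rightarrow> bool" where
  "transc C x \<longleftrightarrow> (\<forall>p :: 'f poly. (\<forall>i. coeff p i \<in> C) \<and> poly p x = 0 \<longrightarrow> p = 0)"

lemma transcD: "transc C x \<Longrightarrow> (\<And>i. coeff p i \<in> C) \<Longrightarrow> poly p x = 0 \<Longrightarrow> p = 0"
  by (auto simp: transc_def)

lemma transc_mono: "transc D x \<Longrightarrow> C \<subseteq> D \<Longrightarrow> transc C x"
  by (auto simp: transc_def)

definition fracs :: "'f::field set \<Rightarrow> 'f set" where
  "fracs C = {a / b | a b. a \<in> C \<and> b \<in> C \<and> b \<noteq> 0}"

lemma fracsI: "a \<in> C \<Longrightarrow> b \<in> C \<Longrightarrow> b \<noteq> 0 \<Longrightarrow> a / b \<in> fracs C"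
  by (auto simp: fracs_def)

lemma frac_incl: "subring C ambient \<Longrightarrow> C \<subseteq> fracs C"
  using fracsI[of _ C 1] subring_one[of C] by auto

lemma frac_inverse:
  assumes C: "subring C ambient" and a: "a \<in> fracs C" shows "inverse a \<in> fracs C"
proof -
  obtain u v where uv: "a = u / v" "u \<in> C" "v \<in> C" "v \<noteq> 0" using a by (auto simp: fracs_def)
  show ?thesis
  proof (cases "u = 0")
    case True
    then have "inverse a = 0" using uv(1) by simp
    then show ?thesis using frac_incl[OF C] subring_zero[OF C] by auto
  next
    case False
    then show ?thesis using fracsI[OF uv(3,2)] uv(1) by simp
  qed
qed

lemma frac_subring:
  assumes C: "subring C ambient" shows "subring (fracs C) ambient"
  unfolding subring_ambient_iff
proof (intro conjI ballI)
  show "1 \<in> fracs C" using frac_incl[OF C] subring_one[OF C] by (rule subsetD)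
next
  fix a assume "a \<in> fracs C"
  then obtain u v where "a = u / v" "u \<in> C" "v \<in> C" "v \<noteq> 0" by (auto simp: fracs_def)
  then show "- a \<in> fracs C"
    using fracsI[OF subring_uminus[OF C, of u], of v] by simp
next
  fix a b assume "a \<in> fracs C" "b \<in> fracs C"
  then obtain u v s t where uv: "a = u / v" "u \<in> C" "v \<in> C" "v \<noteq> 0"
    and st: "b = s / t" "s \<in> C" "t \<in> C" "t \<noteq> 0" by (auto simp: fracs_def)
  have eq: "a + b = (u * t + s * v) / (v * t)" "a * b = (u * s) / (v * t)"
    by (simp_all add: uv(1,4) st(1,4) add_frac_eq)
  show "a + b \<in> fracs C" "a * b \<in> fracs C"
    unfolding eq using uv st
    by (auto intro!: fracsI subring_add[OF C] subring_mult[OF C])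
qed

lemma transc_frac:
  assumes C: "subring C ambient" and x: "transc C x" shows "transc (fracs C) x"
  unfolding transc_def
proof (intro allI impI, elim conjE)
  fix p :: "'a poly" assume co: "\<forall>i. coeff p i \<in> fracs C" and root: "poly p x = 0"
  have "\<forall>i. \<exists>b. b \<in> C \<and> b \<noteq> 0 \<and> coeff p i * b \<in> C"
  proof
    fix i
    obtain u v where "coeff p i = u / v" "u \<in> C" "v \<in> C" "v \<noteq> 0"
      using spec[OF co, of i] by (auto simp: fracs_def)
    then show "\<exists>b. b \<in> C \<and> b \<noteq> 0 \<and> coeff p i * b \<in> C" by (intro exI[of _ v]) simp
  qed
  then obtain b where b: "\<And>i. b i \<in> C" "\<And>i. b i \<noteq> 0" "\<And>i. coeff p i * b i \<in> C" by metis
  define D where "D = (\<Prod>i\<le>degree p. b i)"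
  have "coeff (smult D p) i \<in> C" for i
  proof (cases "i \<le> degree p")
    case True
    have "D = b i * (\<Prod>i\<in>{..degree p} - {i}. b i)"
      unfolding D_def using True by (subst prod.remove[of _ i]) auto
    then have eq: "coeff (smult D p) i = coeff p i * b i * (\<Prod>i\<in>{..degree p} - {i}. b i)" by simp
    show ?thesis unfolding eq by (intro subring_mult[OF C] subring_prod[OF C] b)
  qed (auto simp: coeff_eq_0 subring_zero[OF C])
  then have "smult D p = 0" by (rule transcD[OF x]) (simp add: root)
  then show "p = 0" using b(2) by (simp add: D_def)
qed

lemma transc_exchange:
  assumes C: "subring C ambient" and x: "transc C x" "x \<noteq> 0" and p: "p \<in> C" "p \<noteq> 0"
  shows "transc C (p / x)"
  unfolding transc_def
proof (intro allI impI, elim conjE)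
  fix q :: "'a poly" assume co: "\<forall>i. coeff q i \<in> C" and root: "poly q (p / x) = 0"
  define d where "d = degree q"
  define r where "r = (\<Sum>i\<le>d. Polynomial.monom (coeff q i * p ^ i) (d - i))"
  have cr: "coeff r j = (\<Sum>i\<le>d. if d - i = j then coeff q i * p ^ i else 0)" for j
    by (simp add: r_def coeff_sum)
  have "poly r x = (\<Sum>i\<le>d. coeff q i * p ^ i * x ^ (d - i))"
    by (simp add: r_def poly_sum poly_monom)
  also have "\<dots> = (\<Sum>i\<le>d. x ^ d * (coeff q i * (p / x) ^ i))"
    by (rule sum.cong) (use x(2) in \<open>auto simp: power_diff field_simps\<close>)
  also have "\<dots> = x ^ d * poly q (p / x)"
    by (simp add: poly_altdef d_def sum_distrib_left)
  finally have "poly r x = 0" using root by simp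
  moreover have "coeff r j \<in> C" for j
    unfolding cr using co p by (auto intro!: subring_sum[OF C] subring_mult[OF C] subring_power[OF C] subring_zero[OF C])
  ultimately have "r = 0" by (intro transcD[OF x(1)])
  have "coeff q i = 0" if "i \<le> d" for i
  proof -
    have "0 = coeff r (d - i)" using \<open>r = 0\<close> by simp
    also have "\<dots> = (\<Sum>k\<le>d. if k = i then coeff q k * p ^ k else 0)"
      unfolding cr by (rule sum.cong) (use that in auto)
    also have "\<dots> = coeff q i * p ^ i" using that by simp
    finally show ?thesis using p by simp
  qed
  then show "q = 0" by (metis d_def leading_coeff_0_iff order_refl)
qed

section \<open>Laurent monomials\<close>

definition lmonom :: "nat set \<Rightarrow> (nat \<Rightarrow> 'f::field) \<Rightarrow> (nat \<Rightarrow> int) \<Rightarrow> 'f" where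
  "lmonom I x m = (\<Prod>i\<in>I. x i powi m i)"

definition exponents :: "nat set \<Rightarrow> (nat \<Rightarrow> int) set" where
  "exponents I = {m. \<forall>i. i \<notin> I \<longrightarrow> m i = 0}"

inductive_set lspan :: "'f::field set \<Rightarrow> nat set \<Rightarrow> (nat \<Rightarrow> 'f) \<Rightarrow> (nat \<Rightarrow> int) set \<Rightarrow> 'f set"
  for K I x P where
  lspan_zero: "0 \<in> lspan K I x P"
| lspan_step: "v \<in> lspan K I x P \<Longrightarrow> c \<in> K \<Longrightarrow> m \<in> P \<Longrightarrow> v + c * lmonom I x m \<in> lspan K I x P"

definition lindep :: "'f::field set \<Rightarrow> nat set \<Rightarrow> (nat \<Rightarrow> 'f) \<Rightarrow> bool" where
  "lindep K I x \<longleftrightarrow> (\<forall>i\<in>I. x i \<noteq> 0) \<and>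
     (\<forall>A c. finite A \<and> A \<subseteq> exponents I \<and> (\<forall>m\<in>A. c m \<in> K) \<and> (\<Sum>m\<in>A. c m * lmonom I x m) = 0
        \<longrightarrow> (\<forall>m\<in>A. c m = 0))"

lemma lindepD:
  assumes "lindep K I x" "finite A" "A \<subseteq> exponents I" "\<And>m. m \<in> A \<Longrightarrow> c m \<in> K"
    "(\<Sum>m\<in>A. c m * lmonom I x m) = 0" "m \<in> A"
  shows "c m = 0"
  using conjunct2[OF assms(1)[unfolded lindep_def]] assms(2-) by meson

lemma lmonom_cong: "(\<And>i. i \<in> I \<Longrightarrow> x i = y i) \<Longrightarrow> (\<And>i. i \<in> I \<Longrightarrow> m i = k i) \<Longrightarrow> lmonom I x m = lmonom I y k"
  by (auto simp: lmonom_def intro!: prod.cong)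

lemma lmonom_add: "(\<And>i. i \<in> I \<Longrightarrow> x i \<noteq> 0) \<Longrightarrow> lmonom I x (\<lambda>i. m i + k i) = lmonom I x m * lmonom I x k"
  by (simp add: lmonom_def prod.distrib[symmetric] power_int_add)

lemma lmonom_zero [simp]: "lmonom I x (\<lambda>i. 0) = 1"
  by (simp add: lmonom_def)

lemma lmonom_split: "finite I \<Longrightarrow> k \<in> I \<Longrightarrow> lmonom I x m = x k powi m k * lmonom (I - {k}) x m"
  by (simp add: lmonom_def prod.remove)

lemma lmonom_single:
  assumes "finite I" "i \<in> I" shows "lmonom I x ((\<lambda>_. 0)(i := e)) = x i powi e"
proof -
  have "lmonom I x ((\<lambda>_. 0)(i := e)) = (\<Prod>j\<in>I. if j = i then x i powi e else 1)"
    unfolding lmonom_def by (rule prod.cong) auto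
  then show ?thesis using assms by simp
qed

lemma lmonom_nonzero: "finite I \<Longrightarrow> (\<And>i. i \<in> I \<Longrightarrow> x i \<noteq> 0) \<Longrightarrow> lmonom I x m \<noteq> 0"
  by (simp add: lmonom_def)

lemma lspan_single: "c \<in> K \<Longrightarrow> m \<in> P \<Longrightarrow> c * lmonom I x m \<in> lspan K I x P"
  using lspan_step[OF lspan_zero] by simp

lemma lspan_mono: "v \<in> lspan K I x P \<Longrightarrow> P \<subseteq> Q \<Longrightarrow> v \<in> lspan K I x Q"
  by (induction rule: lspan.induct) (auto intro: lspan.intros)

lemma lspan_add: 
  assumes "v \<in> lspan K I x P" "w \<in> lspan K I x P" shows "v + w \<in> lspan K I x P"
  using assms(2)
proof (induction rule: lspan.induct)
  case (lspan_step w c m)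
  then show ?case using lspan.lspan_step[OF lspan_step(4,2,3)] by (simp add: add.assoc)
qed (simp add: assms)

lemma lspan_mult_monom:
  assumes "subring K ambient" "\<And>i. i \<in> I \<Longrightarrow> x i \<noteq> 0" "v \<in> lspan K I x P" "c \<in> K" 
    "\<And>m. m \<in> P \<Longrightarrow> (\<lambda>i. m i + k i) \<in> Q"
  shows "v * (c * lmonom I x k) \<in> lspan K I x Q"
  using assms(3)
proof (induction rule: lspan.induct)
  case (lspan_step v d m)
  have "v * (c * lmonom I x k) + (d * c) * lmonom I x (\<lambda>i. m i + k i) \<in> lspan K I x Q"
    by (rule lspan.lspan_step) (use lspan_step assms subring_mult in auto)
  then show ?case using lmonom_add[OF assms(2)] by (simp add: algebra_simps)
qed (simp add: lspan_zero)

lemma lspan_uminus: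
  assumes K: "subring K ambient" and v: "v \<in> lspan K I x P" shows "- v \<in> lspan K I x P"
  using v
proof (induction rule: lspan.induct)
  case (lspan_step v c m)
  then show ?case
    using lspan.lspan_step[of "- v" K I x P "- c" m] by (simp add: subring_uminus[OF K])
qed (simp add: lspan_zero)

lemma lspan_diff: "subring K ambient \<Longrightarrow> v \<in> lspan K I x P \<Longrightarrow> w \<in> lspan K I x P \<Longrightarrow> v - w \<in> lspan K I x P"
  using lspan_add[of v K I x P "- w"] lspan_uminus[of K w I x P] by simp

lemma lspan_mult:
  assumes K: "subring K ambient" and x: "\<And>i. i \<in> I \<Longrightarrow> x i \<noteq> 0"
    and v: "v \<in> lspan K I x (exponents I)" and w: "w \<in> lspan K I x (exponents I)"
  shows "v * w \<in> lspan K I x (exponents I)"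
  using w
proof (induction rule: lspan.induct)
  case (lspan_step w c m)
  have "v * (c * lmonom I x m) \<in> lspan K I x (exponents I)"
    using K x v lspan_step(2) by (rule lspan_mult_monom) (use lspan_step in \<open>auto simp: exponents_def\<close>)
  then show ?case using lspan_add lspan_step by (simp add: distrib_left)
qed (simp add: lspan_zero)

lemma lspan_repr:
  assumes "subring K ambient" and "v \<in> lspan K I x P"
  shows "\<exists>A c. finite A \<and> A \<subseteq> P \<and> (\<forall>m. c m \<in> K) \<and> (\<forall>m. m \<notin> A \<longrightarrow> c m = 0) \<and> v = (\<Sum>m\<in>A. c m * lmonom I x m)"
  using assms(2)
proof (induction rule: lspan.induct)
  case lspan_zero
  show ?case by (intro exI[of _ "{}"] exI[of _ "\<lambda>_. 0"]) (auto simp: subring_zero[OF assms(1)])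
next
  case (lspan_step v d k)
  then obtain A c where A: "finite A" "A \<subseteq> P" "\<And>m. c m \<in> K" "\<And>m. m \<notin> A \<Longrightarrow> c m = 0"
    "v = (\<Sum>m\<in>A. c m * lmonom I x m)" by blast
  have "v = (\<Sum>m\<in>insert k A. c m * lmonom I x m)"
    unfolding A(5) by (rule sum.mono_neutral_left) (use A in auto)
  also have "\<dots> = c k * lmonom I x k + (\<Sum>m\<in>A - {k}. c m * lmonom I x m)"
    using A(1) by (simp add: sum.insert_remove)
  finally have v: "v + d * lmonom I x k = (c k + d) * lmonom I x k + (\<Sum>m\<in>A - {k}. c m * lmonom I x m)"
    by (simp add: algebra_simps)
  have "(\<Sum>m\<in>insert k A. (c(k := c k + d)) m * lmonom I x m) =
      (c k + d) * lmonom I x k + (\<Sum>m\<in>A - {k}. (c(k := c k + d)) m * lmonom I x m)"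
    using A(1) by (subst sum.insert_remove) auto
  also have "(\<Sum>m\<in>A - {k}. (c(k := c k + d)) m * lmonom I x m) = (\<Sum>m\<in>A - {k}. c m * lmonom I x m)"
    by (rule sum.cong) auto
  finally show ?case
    using v A lspan_step subring_add[OF assms(1)]
    by (intro exI[of _ "insert k A"] exI[of _ "c(k := c k + d)"]) auto
qed

lemma lindep_disjoint:
  assumes K: "subring K ambient" and x: "lindep K I x"
    and v: "v \<in> lspan K I x P" "v \<in> lspan K I x Q"
    and PQ: "P \<inter> Q = {}" "P \<subseteq> exponents I" "Q \<subseteq> exponents I"
  shows "v = 0"
proof -
  obtain A c where A: "finite A" "A \<subseteq> P" "\<And>m. c m \<in> K" "v = (\<Sum>m\<in>A. c m * lmonom I x m)"
    using lspan_repr[OF K v(1)] by blast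
  obtain A' c' where A': "finite A'" "A' \<subseteq> Q" "\<And>m. c' m \<in> K" "v = (\<Sum>m\<in>A'. c' m * lmonom I x m)"
    using lspan_repr[OF K v(2)] by blast
  have disj: "A \<inter> A' = {}" using A A' PQ by blast
  define d where "d m = (if m \<in> A then c m else - c' m)" for m
  have "(\<Sum>m\<in>A \<union> A'. d m * lmonom I x m) = (\<Sum>m\<in>A. d m * lmonom I x m) + (\<Sum>m\<in>A'. d m * lmonom I x m)"
    by (rule sum.union_disjoint) (use A A' disj in auto)
  also have "(\<Sum>m\<in>A. d m * lmonom I x m) = v" unfolding A(4) by (rule sum.cong) (auto simp: d_def)
  also have "(\<Sum>m\<in>A'. d m * lmonom I x m) = (\<Sum>m\<in>A'. - (c' m * lmonom I x m))"
    by (rule sum.cong) (use disj in \<open>auto simp: d_def\<close>)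
  also have "v + \<dots> = 0" by (simp add: A'(4) sum_negf)
  finally have sum: "(\<Sum>m\<in>A \<union> A'. d m * lmonom I x m) = 0" .
  have "d m = 0" if "m \<in> A \<union> A'" for m
  proof (rule lindepD[OF x _ _ _ sum that])
    show "d m \<in> K" for m using A(3) A'(3) subring_uminus[OF K] by (simp add: d_def)
  qed (use A A' PQ in auto)
  then have "c m = 0" if "m \<in> A" for m using that by (fastforce simp: d_def)
  then show ?thesis using A(4) by simp
qed

lemma laurent_const: "c \<in> K \<Longrightarrow> c \<in> laurent_ring K Y"
  and laurent_var: "y \<in> Y \<Longrightarrow> y \<in> laurent_ring K Y"
  and laurent_inverse: "y \<in> Y \<Longrightarrow> inverse y \<in> laurent_ring K Y"
  by (auto simp: laurent_ring_def intro: gen_incl)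

lemma laurent_powi: "y \<in> Y \<Longrightarrow> y powi e \<in> laurent_ring K Y"
  unfolding power_int_def
  by (cases "0 \<le> e")
    (simp_all add: subring_power[OF laurent_ring_subring laurent_var] subring_power[OF laurent_ring_subring laurent_inverse])

lemma laurent_ring_lspan:
  assumes K: "subring K ambient" and I: "finite I" and x: "\<And>i. i \<in> I \<Longrightarrow> x i \<noteq> 0"
  shows "laurent_ring K (x ` I) = lspan K I x (exponents I)"
proof
  let ?S = "lspan K I x (exponents I)"
  have const: "c \<in> ?S" if "c \<in> K" for c
    using lspan_single[OF that, of "\<lambda>_. 0" "exponents I" I x] by (simp add: exponents_def)
  have var: "x i powi e \<in> ?S" if "i \<in> I" for i e
  proof -
    have "lmonom I x ((\<lambda>_. 0)(i := e)) = x i powi e" by (rule lmonom_single[OF I that])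
    then show ?thesis
      using lspan_single[OF subring_one[OF K], of "(\<lambda>_. 0)(i := e)" "exponents I" I x] that
      by (simp add: exponents_def)
  qed
  have "subring ?S ambient"
    unfolding subring_ambient_iff
    by (intro conjI ballI const[OF subring_one[OF K]] lspan_uminus[OF K] lspan_add lspan_mult[OF K]) (auto simp: x)
  moreover have "K \<union> x ` I \<union> inverse ` x ` I \<subseteq> ?S"
    using const var[of _ 1] var[of _ "-1"] by (auto simp: power_int_minus)
  ultimately show "laurent_ring K (x ` I) \<subseteq> ?S"
    unfolding laurent_ring_def by (rule gen_least)
  show "?S \<subseteq> laurent_ring K (x ` I)"
  proof
    fix v assume "v \<in> ?S"
    then show "v \<in> laurent_ring K (x ` I)"
    proof (induction rule: lspan.induct)
      case (lspan_step v c m)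
      have "x i powi e \<in> laurent_ring K (x ` I)" if "i \<in> I" for i e
        by (rule laurent_powi) (use that in auto)
      then have "lmonom I x m \<in> laurent_ring K (x ` I)"
        unfolding lmonom_def by (intro subring_prod[OF laurent_ring_subring])
      moreover have "c \<in> laurent_ring K (x ` I)"
        using lspan_step by (auto simp: laurent_ring_def intro: gen_incl)
      ultimately show ?case
        using lspan_step by (intro subring_add[OF laurent_ring_subring] subring_mult[OF laurent_ring_subring])
    qed (rule subring_zero[OF laurent_ring_subring])
  qed
qed

lemma lindep_nonzero: "lindep K I x \<Longrightarrow> i \<in> I \<Longrightarrow> x i \<noteq> 0"
  by (simp add: lindep_def)

lemma lindep_transc:
  assumes K: "subring K ambient" and I: "finite I" "k \<in> I" and x: "lindep K I x"
  shows "transc (laurent_ring K (x ` (I - {k}))) (x k)"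
  unfolding transc_def
proof (intro allI impI, elim conjE)
  fix p :: "'a poly" let ?J = "I - {k}"
  assume co: "\<forall>i. coeff p i \<in> laurent_ring K (x ` ?J)" and root: "poly p (x k) = 0"
  have nz: "\<And>i. i \<in> I \<Longrightarrow> x i \<noteq> 0" using x by (simp add: lindep_def)
  have "\<exists>A c. finite A \<and> A \<subseteq> exponents ?J \<and> (\<forall>m. c m \<in> K) \<and> coeff p i = (\<Sum>m\<in>A. c m * lmonom ?J x m)" for i
  proof -
    have "coeff p i \<in> lspan K ?J x (exponents ?J)"
      using co laurent_ring_lspan[OF K, of ?J x] I nz by simp
    from lspan_repr[OF K this] show ?thesis by blast
  qed
  then obtain A c where A: "\<And>i. finite (A i)" "\<And>i. A i \<subseteq> exponents ?J" "\<And>i m. c i m \<in> K"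
    "\<And>i. coeff p i = (\<Sum>m\<in>A i. c i m * lmonom ?J x m)" by metis
  define S where "S = Sigma {..degree p} A"
  define h where "h = (\<lambda>(i, m :: nat \<Rightarrow> int). m(k := int i))"
  have mk: "m k = 0" if "m \<in> A i" for i m using A(2)[of i] that by (auto simp: exponents_def)
  have inj: "inj_on h S"
  proof (rule inj_onI, clarify)
    fix i m j m' assume "(i, m) \<in> S" "(j, m') \<in> S" "h (i, m) = h (j, m')"
    then have m: "m \<in> A i" "m' \<in> A j" and eq: "m(k := int i) = m'(k := int j)"
      by (auto simp: S_def h_def)
    have "i = j" using fun_cong[OF eq, of k] by simp
    moreover have "m = m'"
    proof
      fix l show "m l = m' l" using fun_cong[OF eq, of l] mk[OF m(1)] mk[OF m(2)] by (cases "l = k") auto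
    qed
    ultimately show "i = j \<and> m = m'" by simp
  qed
  have mon: "lmonom I x (h (i, m)) = x k ^ i * lmonom ?J x m" for i m
    using lmonom_split[OF I, of x "h (i, m)"] lmonom_cong[of ?J x x "h (i, m)" m] by (simp add: h_def)
  define d where "d m = c (nat (m k)) (m(k := 0))" for m
  have d: "d (h (i, m)) = c i m" if "m \<in> A i" for i m
  proof -
    have "m(k := 0) = m" using mk[OF that] by (auto simp: fun_eq_iff)
    then show ?thesis by (simp add: d_def h_def)
  qed
  have "0 = (\<Sum>i\<le>degree p. \<Sum>m\<in>A i. c i m * lmonom ?J x m * x k ^ i)"
    using root by (simp add: poly_altdef A(4) sum_distrib_right)
  also have "\<dots> = (\<Sum>(i, m)\<in>S. c i m * lmonom ?J x m * x k ^ i)"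
    unfolding S_def by (rule sum.Sigma) (auto simp: A)
  also have "\<dots> = (\<Sum>s\<in>S. d (h s) * lmonom I x (h s))"
    by (rule sum.cong) (auto simp: S_def d mon)
  also have "\<dots> = (\<Sum>m\<in>h ` S. d m * lmonom I x m)"
    using sum.reindex[OF inj, of "\<lambda>m. d m * lmonom I x m"] by simp
  finally have zero: "(\<Sum>m\<in>h ` S. d m * lmonom I x m) = 0" by simp
  have "c i m = 0" if i: "i \<le> degree p" and m: "m \<in> A i" for i m
  proof -
    have "d (h (i, m)) = 0"
    proof (rule lindepD[OF x _ _ _ zero])
      show "finite (h ` S)" using A by (auto simp: S_def)
      show "h ` S \<subseteq> exponents I" using A(2) I(2) by (fastforce simp: S_def h_def exponents_def)
      show "d m \<in> K" for m using A(3) by (simp add: d_def)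
      show "h (i, m) \<in> h ` S" using i m by (auto simp: S_def)
    qed
    then show ?thesis using d[OF m] by simp
  qed
  then have "coeff p i = 0" if "i \<le> degree p" for i using that A(4) by simp
  then show "p = 0" by (metis leading_coeff_0_iff order_refl)
qed

lemma lindep_mono:
  assumes x: "lindep K I x" and J: "J \<subseteq> I" and I: "finite I"
  shows "lindep K J x"
  unfolding lindep_def
proof (intro conjI ballI allI impI)
  show "x i \<noteq> 0" if "i \<in> J" for i using that J lindep_nonzero[OF x] by blast
  fix A c m
  assume A: "finite A \<and> A \<subseteq> exponents J \<and> (\<forall>m\<in>A. c m \<in> K) \<and> (\<Sum>m\<in>A. c m * lmonom J x m) = 0" and m: "m \<in> A"
  have "lmonom I x m = lmonom J x m" if "m \<in> A" for m
    unfolding lmonom_def by (rule prod.mono_neutral_right) (use I J A that in \<open>auto simp: exponents_def\<close>)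
  then have "(\<Sum>m\<in>A. c m * lmonom I x m) = 0" using A by simp
  then show "c m = 0"
    by (intro lindepD[OF x]) (use A J m in \<open>auto simp: exponents_def\<close>)
qed

lemma lindep_extend:
  assumes K: "subring K ambient" and I: "finite I" "k \<in> I" and x: "lindep K (I - {k}) x"
    and xk: "x k \<noteq> 0" "transc (laurent_ring K (x ` (I - {k}))) (x k)"
  shows "lindep K I x"
  unfolding lindep_def
proof (intro conjI ballI allI impI)
  let ?J = "I - {k}"
  have nz: "x i \<noteq> 0" if "i \<in> I" for i using that xk(1) lindep_nonzero[OF x, of i] by (cases "i = k") auto
  then show "x i \<noteq> 0" if "i \<in> I" for i using that .
  fix A c m
  assume A: "finite A \<and> A \<subseteq> exponents I \<and> (\<forall>m\<in>A. c m \<in> K) \<and> (\<Sum>m\<in>A. c m * lmonom I x m) = 0" and m: "m \<in> A"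
  define M where "M = (\<Sum>m\<in>A. nat \<bar>m k\<bar>)"
  have M: "\<bar>m k\<bar> \<le> int M" if "m \<in> A" for m
  proof -
    have "nat \<bar>m k\<bar> \<le> M" unfolding M_def by (rule member_le_sum) (use A that in auto)
    then show ?thesis by linarith
  qed
  define e where "e m = nat (m k + int M)" for m :: "nat \<Rightarrow> int"
  have e: "int (e m) = m k + int M" if "m \<in> A" for m using M[OF that] by (auto simp: e_def)
  define p where "p = (\<Sum>m\<in>A. Polynomial.monom (c m * lmonom ?J x m) (e m))"
  have cp: "coeff p i = (\<Sum>m\<in>{m\<in>A. e m = i}. c m * lmonom ?J x m)" for i
    using A by (simp add: p_def coeff_sum sum.inter_filter[symmetric] if_distrib)
  have "poly p (x k) = (\<Sum>m\<in>A. c m * lmonom ?J x m * x k ^ e m)"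
    by (simp add: p_def poly_sum poly_monom)
  also have "\<dots> = (\<Sum>m\<in>A. x k ^ M * (c m * lmonom I x m))"
  proof (rule sum.cong)
    fix m assume m: "m \<in> A"
    have "x k ^ e m = x k powi (m k + int M)" unfolding e[OF m, symmetric] by simp
    also have "\<dots> = x k powi m k * x k ^ M" using xk(1) by (simp add: power_int_add)
    finally show "c m * lmonom ?J x m * x k ^ e m = x k ^ M * (c m * lmonom I x m)"
      by (simp add: lmonom_split[OF I] ac_simps)
  qed simp
  also have "\<dots> = x k ^ M * (\<Sum>m\<in>A. c m * lmonom I x m)" by (simp only: sum_distrib_left)
  also have "(\<Sum>m\<in>A. c m * lmonom I x m) = 0" using A by blast
  finally have root: "poly p (x k) = 0" by simp
  have "coeff p i \<in> laurent_ring K (x ` ?J)" for i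
    unfolding cp
  proof (rule subring_sum[OF laurent_ring_subring])
    fix m assume "m \<in> {m\<in>A. e m = i}"
    then have "c m \<in> K" using A by blast
    then show "c m * lmonom ?J x m \<in> laurent_ring K (x ` ?J)"
      unfolding lmonom_def
      by (intro subring_mult[OF laurent_ring_subring] subring_prod[OF laurent_ring_subring]
          laurent_powi laurent_const) auto
  qed
  then have "p = 0" by (intro transcD[OF xk(2) _ root])
  let ?A = "{m'\<in>A. e m' = e m}"
  define g where "g m = m(k := 0)" for m :: "nat \<Rightarrow> int"
  have g: "(g m')(k := m k) = m'" if "m' \<in> ?A" for m'
  proof -
    have "m' k = m k" using that e[OF m] e[of m'] by auto
    then show ?thesis by (auto simp: g_def fun_eq_iff)
  qed
  have inj: "inj_on g ?A" by (rule inj_on_inverseI[of _ "\<lambda>m'. m'(k := m k)"]) (rule g)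
  have "0 = (\<Sum>m'\<in>?A. c m' * lmonom ?J x m')" using cp[of "e m"] \<open>p = 0\<close> by simp
  also have "\<dots> = (\<Sum>m'\<in>?A. c ((g m')(k := m k)) * lmonom ?J x (g m'))"
  proof (rule sum.cong)
    fix m' assume m': "m' \<in> ?A"
    have "lmonom ?J x (g m') = lmonom ?J x m'" by (rule lmonom_cong) (auto simp: g_def)
    then show "c m' * lmonom ?J x m' = c ((g m')(k := m k)) * lmonom ?J x (g m')" by (simp only: g[OF m'])
  qed simp
  also have "\<dots> = (\<Sum>m'\<in>g ` ?A. c (m'(k := m k)) * lmonom ?J x m')"
    using sum.reindex[OF inj, of "\<lambda>m'. c (m'(k := m k)) * lmonom ?J x m'"] by simp
  finally have zero: "(\<Sum>m'\<in>g ` ?A. c (m'(k := m k)) * lmonom ?J x m') = 0" by simp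
  have "c ((g m)(k := m k)) = 0"
  proof (rule lindepD[OF x _ _ _ zero])
    show "g ` ?A \<subseteq> exponents ?J" using A by (auto simp: exponents_def g_def)
    show "c (m'(k := m k)) \<in> K" if "m' \<in> g ` ?A" for m' using that A g by auto
    show "g m \<in> g ` ?A" using m by blast
  qed (use A in simp)
  then show "c m = 0" using g[of m] m by simp
qed

section \<open>Laurent expansions in one variable\<close>

definition expansion :: "'f::field set \<Rightarrow> 'f \<Rightarrow> 'f \<Rightarrow> nat \<Rightarrow> 'f poly \<Rightarrow> bool" where
  "expansion C x f N P \<longleftrightarrow> (\<forall>i. coeff P i \<in> C) \<and> f * x ^ N = poly P x"

lemma expansion_pad:
  assumes C: "subring C ambient" and e: "expansion C x f N P"
  shows "expansion C x f (N + k) (Polynomial.monom 1 k * P)"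
proof -
  have "coeff (Polynomial.monom 1 k * P) i \<in> C" for i
    using e subring_zero[OF C] by (simp add: expansion_def coeff_monom_mult)
  moreover have "f * x ^ (N + k) = poly (Polynomial.monom 1 k * P) x"
  proof -
    have "f * x ^ (N + k) = x ^ k * (f * x ^ N)" by (simp only: power_add ac_simps)
    also have "f * x ^ N = poly P x" using e by (simp add: expansion_def)
    finally show ?thesis by (simp add: poly_monom)
  qed
  ultimately show ?thesis by (simp add: expansion_def)
qed

lemma expansion_exists:
  assumes C: "subring C ambient" and x: "x \<noteq> 0" and f: "f \<in> gen (C \<union> {x, inverse x})"
  shows "\<exists>N P. expansion C x f N P"
proof -
  let ?S = "{f. \<exists>N P. expansion C x f N P}"
  have add: "a + b \<in> ?S" if "a \<in> ?S" "b \<in> ?S" for a b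
  proof -
    obtain N P M R where e: "expansion C x a N P" "expansion C x b M R" using \<open>a \<in> ?S\<close> \<open>b \<in> ?S\<close> by blast
    have "expansion C x a (N + M) (Polynomial.monom 1 M * P)" "expansion C x b (N + M) (Polynomial.monom 1 N * R)"
      using expansion_pad[OF C e(1), of M] expansion_pad[OF C e(2), of N] by (simp_all add: add.commute)
    then have "expansion C x (a + b) (N + M) (Polynomial.monom 1 M * P + Polynomial.monom 1 N * R)"
      using subring_add[OF C] by (auto simp: expansion_def distrib_right)
    then show ?thesis by blast
  qed
  have mult: "a * b \<in> ?S" if "a \<in> ?S" "b \<in> ?S" for a b
  proof -
    obtain N P M R where e: "expansion C x a N P" "expansion C x b M R" using \<open>a \<in> ?S\<close> \<open>b \<in> ?S\<close> by blast
    have "coeff (P * R) i \<in> C" for i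
      unfolding coeff_mult using e by (intro subring_sum[OF C] subring_mult[OF C]) (auto simp: expansion_def)
    moreover have "a * b * x ^ (N + M) = poly (P * R) x"
    proof -
      have "a * b * x ^ (N + M) = (a * x ^ N) * (b * x ^ M)" by (simp only: power_add ac_simps)
      also have "a * x ^ N = poly P x" using e by (simp add: expansion_def)
      also have "b * x ^ M = poly R x" using e by (simp add: expansion_def)
      finally show ?thesis by simp
    qed
    ultimately have "expansion C x (a * b) (N + M) (P * R)"
      by (simp add: expansion_def)
    then show ?thesis by blast
  qed
  have const: "c \<in> ?S" if "c \<in> C" for c
    by (rule CollectI, rule exI[of _ 0], rule exI[of _ "[:c:]"])
      (use that subring_zero[OF C] in \<open>auto simp: expansion_def coeff_pCons split: nat.splits\<close>)
  have var: "x \<in> ?S"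
    by (rule CollectI, rule exI[of _ 0], rule exI[of _ "[:0, 1:]"])
      (use subring_one[OF C] subring_zero[OF C] in \<open>auto simp: expansion_def coeff_pCons split: nat.splits\<close>)
  have inv: "inverse x \<in> ?S"
    by (rule CollectI, rule exI[of _ 1], rule exI[of _ "[:1:]"])
      (use x subring_one[OF C] subring_zero[OF C] in \<open>auto simp: expansion_def coeff_pCons split: nat.splits\<close>)
  have neg: "- a \<in> ?S" if "a \<in> ?S" for a
    using mult[OF const[OF subring_uminus[OF C subring_one[OF C]]] that] by simp
  have "subring ?S ambient"
    unfolding subring_ambient_iff
    by (intro conjI ballI const[OF subring_one[OF C]] neg add mult)
  moreover have "C \<union> {x, inverse x} \<subseteq> ?S"
  proof
    fix y assume "y \<in> C \<union> {x, inverse x}"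
    then consider "y \<in> C" | "y = x" | "y = inverse x" by blast
    then show "y \<in> ?S" using const[of y] var inv by cases simp_all
  qed
  ultimately have "gen (C \<union> {x, inverse x}) \<subseteq> ?S" by (rule gen_least)
  then show ?thesis using f by blast
qed

lemma expansion_unique:
  assumes E: "subring E ambient" "transc E x" and "C \<subseteq> E" "D \<subseteq> E"
    and "expansion C x f N P" "expansion D x f N R"
  shows "P = R"
proof -
  have "P - R = 0"
    by (rule transcD[OF E(2)]) (use assms in \<open>auto simp: expansion_def intro!: subring_diff[OF E(1)]\<close>)
  then show ?thesis by simp
qed

lemma expansion_sum:
  assumes x: "x \<noteq> 0" and e: "expansion C x f N P"
  shows "f = (\<Sum>l=1..N. coeff P (N - l) * inverse x ^ l) + (\<Sum>i\<in>{N..N + degree P}. coeff P i * x ^ (i - N))"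
proof -
  have "poly P x = (\<Sum>i\<le>N + degree P. coeff P i * x ^ i)"
    unfolding poly_altdef by (rule sum.mono_neutral_left) (auto simp: coeff_eq_0)
  also have "{..N + degree P} = {..<N} \<union> {N..N + degree P}" by auto
  also have "(\<Sum>i\<in>\<dots>. coeff P i * x ^ i) = (\<Sum>i<N. coeff P i * x ^ i) + (\<Sum>i\<in>{N..N + degree P}. coeff P i * x ^ i)"
    by (rule sum.union_disjoint) auto
  also have "(\<Sum>i<N. coeff P i * x ^ i) = (\<Sum>l=1..N. coeff P (N - l) * x ^ (N - l))"
    by (rule sum.reindex_bij_witness[where i = "\<lambda>l. N - l" and j = "\<lambda>i. N - i"]) auto
  finally have "f * x ^ N = (\<Sum>l=1..N. coeff P (N - l) * x ^ (N - l)) + (\<Sum>i\<in>{N..N + degree P}. coeff P i * x ^ i)"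
    using e by (simp add: expansion_def)
  also have "(\<Sum>l=1..N. coeff P (N - l) * x ^ (N - l)) = (\<Sum>l=1..N. coeff P (N - l) * inverse x ^ l) * x ^ N"
    unfolding sum_distrib_right
    by (rule sum.cong) (use x in \<open>auto simp: power_diff field_simps\<close>)
  also have "(\<Sum>i\<in>{N..N + degree P}. coeff P i * x ^ i) = (\<Sum>i\<in>{N..N + degree P}. coeff P i * x ^ (i - N)) * x ^ N"
    unfolding sum_distrib_right
    by (rule sum.cong) (auto simp: power_add[symmetric])
  finally show ?thesis using x by (simp add: distrib_right[symmetric])
qed

text \<open>An element that is a Laurent polynomial both in \<open>x\<close> and in \<open>p / x\<close> has coefficients of negative
  degree \<open>- l\<close> divisible by \<open>p ^ l\<close>.\<close>

lemma expansion_divisible: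
  assumes C: "subring C ambient" and x: "transc C x" "x \<noteq> 0" and p: "p \<in> C" "p \<noteq> 0"
    and f: "f \<in> gen (C \<union> {x, inverse x})" and f': "f \<in> gen (C \<union> {p / x, inverse (p / x)})"
  shows "\<exists>N P b. expansion C x f N P \<and> (\<forall>l. b l \<in> C) \<and> (\<forall>l. 1 \<le> l \<and> l \<le> N \<longrightarrow> coeff P (N - l) = b l * p ^ l)"
proof -
  obtain N0 P0 where e0: "expansion C x f N0 P0" using expansion_exists[OF C x(2) f] by blast
  obtain M R where e': "expansion C (p / x) f M R"
    using expansion_exists[OF C _ f'] x(2) p(2) by auto
  define N where "N = N0 + degree R"
  define P where "P = Polynomial.monom 1 (degree R) * P0"
  have e: "expansion C x f N P" unfolding N_def P_def by (rule expansion_pad[OF C e0])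
  define T where "T = (\<Sum>j\<le>degree R. Polynomial.monom (coeff R j * p ^ j) (N + M - j))"
  have "poly T x = (\<Sum>j\<le>degree R. coeff R j * p ^ j * x ^ (N + M - j))"
    by (simp add: T_def poly_sum poly_monom)
  also have "\<dots> = (\<Sum>j\<le>degree R. x ^ (N + M) * (coeff R j * (p / x) ^ j))"
    by (rule sum.cong) (use x(2) in \<open>auto simp: power_diff field_simps N_def\<close>)
  also have "\<dots> = x ^ (N + M) * (f * (p / x) ^ M)"
    using e' by (simp add: poly_altdef expansion_def sum_distrib_left)
  also have "\<dots> = p ^ M * (f * x ^ N)" using x(2) by (simp add: power_add power_divide)
  also have "f * x ^ N = poly P x" using e by (simp add: expansion_def)
  finally have "poly (smult (p ^ M) P - T) x = 0" by simp
  moreover have cT: "coeff T i = (\<Sum>j\<le>degree R. if N + M - j = i then coeff R j * p ^ j else 0)" for i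
    by (simp add: T_def coeff_sum)
  moreover have "coeff (smult (p ^ M) P - T) i \<in> C" for i
    using e e' p unfolding coeff_diff cT coeff_smult
    by (auto simp: expansion_def intro!: subring_diff[OF C] subring_sum[OF C] subring_mult[OF C]
        subring_power[OF C] subring_zero[OF C])
  ultimately have "smult (p ^ M) P - T = 0" by (intro transcD[OF x(1)])
  then have T: "smult (p ^ M) P = T" by simp
  have eq: "p ^ M * coeff P i = coeff T i" for i
    unfolding T[symmetric] by simp
  have "coeff P (N - l) = coeff R (M + l) * p ^ l" if l: "1 \<le> l" "l \<le> N" for l
  proof -
    have "coeff T (N - l) = (\<Sum>j\<le>degree R. if j = M + l then coeff R j * p ^ j else 0)"
      unfolding cT by (rule sum.cong) (use l in \<open>auto simp: N_def\<close>)
    also have "\<dots> = coeff R (M + l) * p ^ (M + l)" by (auto simp: coeff_eq_0)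
    finally have "p ^ M * coeff P (N - l) = p ^ M * (coeff R (M + l) * p ^ l)"
      using eq[of "N - l"] by (simp add: power_add)
    then show ?thesis using p(2) by simp
  qed
  then show ?thesis using e e' by (intro exI[of _ N] exI[of _ P] exI[of _ "\<lambda>l. coeff R (M + l)"]) (auto simp: expansion_def)
qed

lemma comaximal_descent:
  assumes S: "subring S ambient" and uv: "u \<in> S" "v \<in> S" "p \<in> S" "q \<in> S" "u * p + v * q = 1"
    and "p ^ N * f \<in> S" "q ^ M * f \<in> S"
  shows "f \<in> S"
  using assms(7,8)
proof (induction "N + M" arbitrary: N M f rule: less_induct)
  case less
  show ?case
  proof (cases "N = 0 \<or> M = 0")
    case True
    then show ?thesis using less.prems by auto
  next
    case False
    then obtain N' M' where N: "N = Suc N'" "M = Suc M'" by (metis not0_implies_Suc)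
    have pf: "p ^ N' * (p * f) = p ^ N * f" "q ^ M * (p * f) = p * (q ^ M * f)"
      and qf: "p ^ N * (q * f) = q * (p ^ N * f)" "q ^ M' * (q * f) = q ^ M * f"
      by (simp_all add: N ac_simps)
    have "p * f \<in> S"
    proof (rule less.hyps[of N' M])
      show "N' + M < N + M" by (simp add: N)
      show "p ^ N' * (p * f) \<in> S" unfolding pf(1) by (rule less.prems(1))
      show "q ^ M * (p * f) \<in> S" unfolding pf(2) by (rule subring_mult[OF S uv(3) less.prems(2)])
    qed
    moreover have "q * f \<in> S"
    proof (rule less.hyps[of N M'])
      show "N + M' < N + M" by (simp add: N)
      show "p ^ N * (q * f) \<in> S" unfolding qf(1) by (rule subring_mult[OF S uv(4) less.prems(1)])
      show "q ^ M' * (q * f) \<in> S" unfolding qf(2) by (rule less.prems(2))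
    qed
    ultimately have "u * (p * f) + v * (q * f) \<in> S"
      by (intro subring_add[OF S] subring_mult[OF S uv(1)] subring_mult[OF S uv(2)])
    moreover have "u * (p * f) + v * (q * f) = f"
      using arg_cong[OF uv(5), of "\<lambda>t. t * f"] by (simp add: algebra_simps)
    ultimately show ?thesis by simp
  qed
qed

lemma localization_subring:
  assumes S: "subring S ambient" and p: "p \<in> S"
  shows "subring {f. \<exists>N. p ^ N * f \<in> S} ambient"
  unfolding subring_ambient_iff
proof (intro conjI ballI)
  show "1 \<in> {f. \<exists>N. p ^ N * f \<in> S}" using subring_one[OF S] by (auto intro!: exI[of _ 0])
next
  fix f assume "f \<in> {f. \<exists>N. p ^ N * f \<in> S}"
  then obtain N where "p ^ N * f \<in> S" by blast
  then have "p ^ N * (- f) \<in> S" using subring_uminus[OF S] by simp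
  then show "- f \<in> {f. \<exists>N. p ^ N * f \<in> S}" by blast
next
  fix f g assume "f \<in> {f. \<exists>N. p ^ N * f \<in> S}" "g \<in> {f. \<exists>N. p ^ N * f \<in> S}"
  then obtain N M where N: "p ^ N * f \<in> S" "p ^ M * g \<in> S" by blast
  have "p ^ (N + M) * (f + g) = p ^ M * (p ^ N * f) + p ^ N * (p ^ M * g)"
    by (simp add: power_add algebra_simps)
  then have "p ^ (N + M) * (f + g) \<in> S"
    using N p by (simp add: subring_add[OF S] subring_mult[OF S] subring_power[OF S])
  then show "f + g \<in> {f. \<exists>N. p ^ N * f \<in> S}" by blast
  have eq: "p ^ (N + M) * (f * g) = (p ^ N * f) * (p ^ M * g)" by (simp only: power_add ac_simps)
  have "p ^ (N + M) * (f * g) \<in> S" unfolding eq by (rule subring_mult[OF S N])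
  then show "f * g \<in> {f. \<exists>N. p ^ N * f \<in> S}" by blast
qed

lemma localizationI: "p ^ N * f \<in> S \<Longrightarrow> f \<in> {f. \<exists>N. p ^ N * f \<in> S}"
  by blast

lemma expansion_gen:
  assumes x: "x \<noteq> 0" and e: "expansion C x f N P"
    and b: "\<And>l. 1 \<le> l \<Longrightarrow> l \<le> N \<Longrightarrow> \<exists>b\<in>C. coeff P (N - l) = b * p ^ l"
  shows "f \<in> gen (C \<union> {x, p / x})"
proof -
  have "coeff P (N - l) * inverse x ^ l \<in> gen (C \<union> {x, p / x})" if l: "l \<in> {1..N}" for l
  proof -
    obtain b where "b \<in> C" "coeff P (N - l) = b * p ^ l" using b l by auto
    then have "coeff P (N - l) * inverse x ^ l = b * (p / x) ^ l" by (simp add: divide_inverse power_mult_distrib)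
    moreover have "b * (p / x) ^ l \<in> gen (C \<union> {x, p / x})"
      using \<open>b \<in> C\<close> by (intro gen_closed gen_incl) auto
    ultimately show ?thesis by simp
  qed
  moreover have "coeff P i * x ^ j \<in> gen (C \<union> {x, p / x})" for i j
    using e by (intro gen_closed gen_incl) (auto simp: expansion_def)
  ultimately show ?thesis
    using expansion_sum[OF x e] gen_closed(3) subring_sum[OF gen_subring]
    by (metis (no_types, lifting))
qed

lemma insert2_subset: "\<lbrakk>A \<subseteq> L; a \<in> L; b \<in> L\<rbrakk> \<Longrightarrow> A \<union> {a, b} \<subseteq> L"
  and insert4_subset: "\<lbrakk>A \<subseteq> L; a \<in> L; b \<in> L; c \<in> L; d \<in> L\<rbrakk> \<Longrightarrow> A \<union> {a, b, c, d} \<subseteq> L"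
  by simp_all

lemma rank2_connected:
  assumes B: "subring B ambient" and x: "x1 \<noteq> 0" "x2 \<noteq> 0" and b: "b \<ge> 1"
    and mn: "m1 \<in> B" "m2 \<in> B" "inverse m2 \<in> B" "m2 \<noteq> 0" "n1 \<in> B" "n2 \<in> B"
    and w: "w \<in> B" "inverse w \<in> B" "w \<noteq> 0"
    and y1: "y1 = (m2 + m1 * x2 ^ b) / x1" "y1 \<noteq> 0"
    and y2: "y2 = (n1 * x1 ^ b + n2) / x2" "y2 \<noteq> 0"
    and z2: "z2 = w * (n2 * y1 ^ b + n1 * m2 ^ b) / x2" "z2 \<noteq> 0"
    and tr: "transc (gen (B \<union> {x1, inverse x1})) x2"
    and f: "f \<in> gen (gen (B \<union> {x1, inverse x1}) \<union> {x2, inverse x2})"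
      "f \<in> gen (gen (B \<union> {x1, inverse x1}) \<union> {y2, inverse y2})"
      "f \<in> gen (B \<union> {y1, inverse y1, x2, inverse x2})"
  shows "f \<in> gen (B \<union> {y1, inverse y1, z2, inverse z2})"
proof -
  let ?C = "gen (B \<union> {x1, inverse x1})" and ?S = "gen (B \<union> {y1, inverse y1, x2, z2})"
  define p1 where "p1 = m2 + m1 * x2 ^ b"
  define p2 where "p2 = n1 * x1 ^ b + n2"
  have B_C: "a \<in> ?C" if "a \<in> B" for a using that by (auto intro: gen_incl)
  have x1_C: "x1 \<in> ?C" by (auto intro: gen_incl)
  then have p2: "p2 \<in> ?C" unfolding p2_def by (intro gen_closed B_C[OF mn(5)] B_C[OF mn(6)] x1_C)
  have p2': "p2 \<noteq> 0" using y2 by (auto simp: p2_def)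
  obtain N P b' where e: "expansion ?C x2 f N P" "\<And>l. b' l \<in> ?C"
    "\<And>l. 1 \<le> l \<Longrightarrow> l \<le> N \<Longrightarrow> coeff P (N - l) = b' l * p2 ^ l"
    using expansion_divisible[OF gen_subring tr x(2) p2 p2' f(1)] f(2) unfolding y2(1) p2_def by blast
  have f_C: "f \<in> gen (?C \<union> {x2, y2})"
    unfolding y2(1) p2_def[symmetric] by (rule expansion_gen[OF x(2) e(1)]) (use e in blast)
  have B_S: "a \<in> ?S" if "a \<in> B" for a using that by (auto intro: gen_incl)
  note mn_S = B_S[OF mn(1)] B_S[OF mn(2)] B_S[OF mn(3)] B_S[OF mn(5)] B_S[OF mn(6)] B_S[OF w(1)] B_S[OF w(2)]
  have y1_S: "y1 \<in> ?S" "inverse y1 \<in> ?S" "x2 \<in> ?S" "z2 \<in> ?S" by (auto intro: gen_incl)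
  have p1_S: "p1 \<in> ?S" unfolding p1_def by (intro gen_closed mn_S y1_S)
  have xy: "x1 * y1 = p1" using x y1 by (simp add: p1_def)
  have y2_S: "y2 \<in> ?S"
  proof -
    obtain c where c: "b = Suc c" using b by (cases b) auto
    define t where "t = m1 * x2 ^ c * (\<Sum>i<Suc c. p1 ^ i * m2 ^ (c - i))"
    have "p1 ^ b - m2 ^ b = (p1 - m2) * (\<Sum>i<Suc c. p1 ^ i * m2 ^ (c - i))"
      unfolding c by (rule diff_power_eq_sum)
    also have "p1 - m2 = x2 * (m1 * x2 ^ c)" by (simp add: p1_def c)
    finally have t: "p1 ^ b - m2 ^ b = x2 * t" by (simp add: t_def mult.assoc)
    have "t \<in> ?S" unfolding t_def by (intro gen_closed mn_S y1_S p1_S)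
    have "x2 * y2 = n1 * x1 ^ b + n2" using x(2) by (simp add: y2(1))
    then have "x2 * (y2 * y1 ^ b) = (n1 * x1 ^ b + n2) * y1 ^ b" by (simp add: mult.assoc[symmetric])
    also have "\<dots> = n1 * (x1 * y1) ^ b + n2 * y1 ^ b" by (simp add: power_mult_distrib distrib_right)
    also have "\<dots> = n1 * (p1 ^ b - m2 ^ b) + (n2 * y1 ^ b + n1 * m2 ^ b)"
      unfolding xy by (simp add: algebra_simps)
    also have "n2 * y1 ^ b + n1 * m2 ^ b = x2 * (inverse w * z2)"
      using x(2) w(3) by (simp add: z2(1) field_simps)
    finally have "x2 * (y2 * y1 ^ b) = x2 * (n1 * t + inverse w * z2)"
      unfolding t by (simp add: algebra_simps)
    then have "y2 * y1 ^ b = n1 * t + inverse w * z2" using x(2) by simp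
    then have "y2 = (n1 * t + inverse w * z2) * inverse y1 ^ b"
      using y1(2) by (simp add: field_simps power_inverse)
    also have "\<dots> \<in> ?S" by (intro gen_closed mn_S y1_S \<open>t \<in> ?S\<close>)
    finally show ?thesis .
  qed
  have "\<exists>N. p1 ^ N * f \<in> ?S"
  proof -
    let ?L = "{f. \<exists>N. p1 ^ N * f \<in> ?S}"
    have L: "subring ?L ambient" by (rule localization_subring[OF gen_subring p1_S])
    have S_L: "a \<in> ?L" if "a \<in> ?S" for a using that by (intro localizationI[of _ 0]) simp
    have BL: "B \<subseteq> ?L" by (rule subsetI) (rule S_L[OF B_S])
    have "x1 = p1 * inverse y1" using xy y1(2) by (simp add: field_simps)
    then have "x1 \<in> ?L" by (metis S_L gen_closed(4) p1_S y1_S(2))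
    moreover have "p1 ^ 1 * inverse x1 = y1" using xy x(1) by (simp add: field_simps)
    then have "inverse x1 \<in> ?L" using y1_S(1) by (intro localizationI[of _ 1]) simp
    ultimately have "?C \<subseteq> ?L" by (intro gen_least[OF L] insert2_subset BL)
    then have "gen (?C \<union> {x2, y2}) \<subseteq> ?L"
      by (rule gen_least[OF L insert2_subset[OF _ S_L[OF y1_S(3)] S_L[OF y2_S]]])
    from subsetD[OF this f_C] show ?thesis by simp
  qed
  then obtain N1 where N1: "p1 ^ N1 * f \<in> ?S" by blast
  have "\<exists>M. x2 ^ M * f \<in> ?S"
  proof -
    let ?L = "{f. \<exists>N. x2 ^ N * f \<in> ?S}"
    have L: "subring ?L ambient" by (rule localization_subring[OF gen_subring y1_S(3)])
    have S_L: "a \<in> ?L" if "a \<in> ?S" for a using that by (intro localizationI[of _ 0]) simp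
    have BL: "B \<subseteq> ?L" by (rule subsetI) (rule S_L[OF B_S])
    have "inverse x2 \<in> ?L" by (rule localizationI[of _ 1]) (simp add: x(2) gen_closed(1))
    then have "gen (B \<union> {y1, inverse y1, x2, inverse x2}) \<subseteq> ?L"
      by (intro gen_least[OF L] insert4_subset BL S_L[OF y1_S(1)] S_L[OF y1_S(2)] S_L[OF y1_S(3)])
    from subsetD[OF this f(3)] show ?thesis by simp
  qed
  then obtain M1 where M1: "x2 ^ M1 * f \<in> ?S" by blast
  have "f \<in> ?S"
  proof (rule comaximal_descent[OF gen_subring _ _ p1_S y1_S(3) _ N1 M1])
    show "inverse m2 \<in> ?S" by (rule B_S[OF mn(3)])
    show "- (inverse m2 * m1 * x2 ^ (b - 1)) \<in> ?S" by (intro gen_closed mn_S y1_S)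
    show "inverse m2 * p1 + - (inverse m2 * m1 * x2 ^ (b - 1)) * x2 = 1"
      using mn(4) b by (cases b) (auto simp: p1_def algebra_simps)
  qed
  moreover have "?S \<subseteq> gen (B \<union> {y1, inverse y1, z2, inverse z2})" (is "_ \<subseteq> ?R")
  proof (rule gen_mono)
    have R: "a \<in> ?R" if "a \<in> B" for a using that by (auto intro: gen_incl)
    note mn_R = R[OF mn(1)] R[OF mn(2)] R[OF mn(3)] R[OF mn(5)] R[OF mn(6)] R[OF w(1)] R[OF w(2)]
    have yz: "y1 \<in> ?R" "inverse y1 \<in> ?R" "z2 \<in> ?R" "inverse z2 \<in> ?R" by (auto intro: gen_incl)
    have "x2 = w * (n2 * y1 ^ b + n1 * m2 ^ b) * inverse z2"
      using x(2) z2 by (simp add: field_simps)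
    also have "\<dots> \<in> ?R" by (intro gen_closed mn_R yz)
    finally show "B \<union> {y1, inverse y1, x2, z2} \<subseteq> ?R" using R yz by auto
  qed
  ultimately show ?thesis by blast
qed

text \<open>Divisibility by powers of \<open>p\<close> is unaffected by a factor that is regular modulo \<open>p\<close>.\<close>

lemma regular_power_cancel:
  assumes B: "subring B ambient" and p: "p \<noteq> 0" "p \<in> B" "q \<in> B"
    and reg: "\<And>h g. h \<in> B \<Longrightarrow> g \<in> B \<Longrightarrow> q * h = p * g \<Longrightarrow> \<exists>g'\<in>B. h = p * g'"
    and "h \<in> B" "g \<in> B" "q ^ m * h = p ^ l * g"
  shows "\<exists>g'\<in>B. h = p ^ l * g'"
proof -
  have reg': "\<exists>g'\<in>B. h = p * g'" if "h \<in> B" "g \<in> B" "q ^ m * h = p * g" for h g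
    using that
  proof (induction m arbitrary: h g)
    case (Suc m)
    have "q * (q ^ m * h) = p * g" using Suc.prems by (simp add: ac_simps)
    from reg[OF _ _ this] Suc.prems p obtain g' where "g' \<in> B" "q ^ m * h = p * g'"
      by (auto intro: subring_mult[OF B] subring_power[OF B])
    then show ?case using Suc.IH[OF Suc.prems(1)] by blast
  qed auto
  show ?thesis using assms(6-8)
  proof (induction l arbitrary: h g)
    case (Suc l)
    have "p ^ l * g \<in> B" using Suc.prems p by (auto intro: subring_mult[OF B] subring_power[OF B])
    moreover have "q ^ m * h = p * (p ^ l * g)" using Suc.prems by (simp add: ac_simps)
    ultimately obtain h' where h': "h' \<in> B" "h = p * h'" using reg'[OF Suc.prems(1)] by blast
    then have "q ^ m * h' = p ^ l * g" using Suc.prems(3) p(1) by (simp add: ac_simps)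
    then obtain g' where "g' \<in> B" "h' = p ^ l * g'" using Suc.IH[OF h'(1) Suc.prems(2)] by blast
    then show ?case using h' by (auto simp: ac_simps)
  qed auto
qed

lemma mutated_laurent_cancel:
  assumes B: "subring B ambient" and tr: "transc B x" and x: "x \<noteq> 0" and p: "p \<in> B" "p \<noteq> 0" and q: "q \<in> B"
    and reg: "\<And>h g l. h \<in> B \<Longrightarrow> g \<in> B \<Longrightarrow> q * h = p ^ l * g \<Longrightarrow> \<exists>g'\<in>B. h = p ^ l * g'"
    and g: "g \<in> gen (B \<union> {x, inverse x})" and gq: "g * q \<in> gen (B \<union> {p / x, inverse (p / x)})"
  shows "g \<in> gen (B \<union> {p / x, inverse (p / x)})"
proof -
  have "g * q \<in> gen (B \<union> {x, inverse x})" using g q by (auto intro: gen_closed gen_incl)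
  from expansion_divisible[OF B tr x p this gq] obtain N' P' b' where e':
    "expansion B x (g * q) N' P'" "\<And>l. b' l \<in> B"
    "\<And>l. 1 \<le> l \<Longrightarrow> l \<le> N' \<Longrightarrow> coeff P' (N' - l) = b' l * p ^ l" by blast
  obtain N2 G where e: "expansion B x g N2 G" using expansion_exists[OF B x g] by blast
  define H where "H = Polynomial.monom 1 N' * G"
  have eH: "expansion B x g (N2 + N') H" unfolding H_def by (rule expansion_pad[OF B e])
  have "expansion B x (g * q) (N2 + N') (smult q H)"
    using eH q by (auto simp: expansion_def ac_simps intro: subring_mult[OF B])
  moreover have "expansion B x (g * q) (N2 + N') (Polynomial.monom 1 N2 * P')"
    using expansion_pad[OF B e'(1), of N2] by (simp add: add.commute)
  ultimately have eq: "smult q H = Polynomial.monom 1 N2 * P'"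
    by (rule expansion_unique[OF B tr subset_refl subset_refl])
  have "g \<in> gen (B \<union> {x, p / x})"
  proof (rule expansion_gen[OF x eH])
    fix l assume l: "1 \<le> l" "l \<le> N2 + N'"
    have "q * coeff H (N2 + N' - l) = coeff (Polynomial.monom 1 N2 * P') (N2 + N' - l)"
      unfolding eq[symmetric] by simp
    also have "\<dots> = (if l \<le> N' then coeff P' (N' - l) else 0)"
      using l by (auto simp: coeff_monom_mult)
    also have "\<dots> = p ^ l * (if l \<le> N' then b' l else 0)" using e'(3) l by simp
    finally have "q * coeff H (N2 + N' - l) = p ^ l * (if l \<le> N' then b' l else 0)" .
    from reg[OF _ _ this] show "\<exists>b\<in>B. coeff H (N2 + N' - l) = b * p ^ l"
      using eH e'(2) subring_zero[OF B] by (auto simp: expansion_def mult.commute)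
  qed
  also have "\<dots> \<subseteq> gen (B \<union> {p / x, inverse (p / x)})" (is "_ \<subseteq> ?R")
  proof (rule gen_mono)
    have "x = p * inverse (p / x)" using p x by simp
    also have "\<dots> \<in> ?R" using p by (intro gen_closed gen_incl) auto
    finally show "B \<union> {x, p / x} \<subseteq> ?R" by (auto intro: gen_incl)
  qed
  finally show ?thesis .
qed

lemma rank2_disconnected:
  assumes B: "subring B ambient" and x: "x1 \<noteq> 0" "x2 \<noteq> 0"
    and p: "p1 \<in> B" "p1 \<noteq> 0" "p2 \<in> B" "p2 \<noteq> 0"
    and y: "y1 = p1 / x1" "y2 = p2 / x2"
    and reg: "\<And>h g. h \<in> B \<Longrightarrow> g \<in> B \<Longrightarrow> p2 * h = p1 * g \<Longrightarrow> \<exists>g'\<in>B. h = p1 * g'"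
    and tr: "transc B x1" and E: "subring E ambient" "transc E x2"
    and BE: "gen (B \<union> {x1, inverse x1}) \<subseteq> E" "gen (B \<union> {y1, inverse y1}) \<subseteq> E"
    and f: "f \<in> gen (gen (B \<union> {x1, inverse x1}) \<union> {x2, inverse x2})"
      "f \<in> gen (gen (B \<union> {x1, inverse x1}) \<union> {y2, inverse y2})"
      "f \<in> gen (gen (B \<union> {y1, inverse y1}) \<union> {x2, inverse x2})"
  shows "f \<in> gen (B \<union> {y1, inverse y1, y2, inverse y2})"
proof -
  let ?C = "gen (B \<union> {x1, inverse x1})" and ?D = "gen (B \<union> {y1, inverse y1})"
  have p2: "p2 \<in> ?C" "p2 \<in> ?D" using p by (auto intro: gen_incl)
  from expansion_divisible[OF gen_subring transc_mono[OF E(2) BE(1)] x(2) p2(1) p(4) f(1)] f(2)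
  obtain N P b where e: "expansion ?C x2 f N P" "\<And>l. b l \<in> ?C"
    "\<And>l. 1 \<le> l \<Longrightarrow> l \<le> N \<Longrightarrow> coeff P (N - l) = b l * p2 ^ l"
    unfolding y(2) by blast
  obtain M R where e': "expansion ?D x2 f M R" using expansion_exists[OF gen_subring x(2) f(3)] by blast
  have eq: "Polynomial.monom 1 M * P = Polynomial.monom 1 N * R"
    by (rule expansion_unique[OF E BE, of f "N + M"])
      (use expansion_pad[OF gen_subring e(1), of M] expansion_pad[OF gen_subring e', of N] in
        \<open>simp_all add: add.commute\<close>)
  have D: "coeff P i \<in> ?D" for i
  proof -
    have "coeff P i = coeff (Polynomial.monom 1 M * P) (i + M)" by (simp add: coeff_monom_mult)
    also have "\<dots> = coeff (Polynomial.monom 1 N * R) (i + M)" unfolding eq ..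
    also have "\<dots> \<in> ?D" using e' by (auto simp: coeff_monom_mult expansion_def intro: gen_closed)
    finally show ?thesis .
  qed
  have "f \<in> gen (?D \<union> {x2, p2 / x2})"
  proof (rule expansion_gen[OF x(2)])
    show "expansion ?D x2 f N P" using e(1) D by (auto simp: expansion_def)
    fix l assume l: "1 \<le> l" "l \<le> N"
    have "b l \<in> ?D"
      unfolding y(1)
    proof (rule mutated_laurent_cancel[OF B tr x(1) p(1,2) _ _ e(2)])
      show "p2 ^ l \<in> B" by (rule subring_power[OF B p(3)])
      show "\<exists>g'\<in>B. h = p1 ^ k * g'" if "h \<in> B" "g \<in> B" "p2 ^ l * h = p1 ^ k * g" for h g k
        by (rule regular_power_cancel[OF B p(2,1,3) reg that])
      show "b l * p2 ^ l \<in> gen (B \<union> {p1 / x1, inverse (p1 / x1)})"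
        using D[of "N - l"] e(3)[OF l] unfolding y(1) by simp
    qed
    then show "\<exists>b\<in>?D. coeff P (N - l) = b * p2 ^ l" using e(3)[OF l] by blast
  qed
  also have "\<dots> \<subseteq> gen (B \<union> {y1, inverse y1, y2, inverse y2})" (is "_ \<subseteq> ?R")
  proof (rule gen_mono)
    have "x2 = p2 * inverse y2" using p x by (simp add: y)
    also have "\<dots> \<in> ?R" using p by (intro gen_closed gen_incl) auto
    finally have "x2 \<in> ?R" .
    moreover have "p2 / x2 \<in> ?R" unfolding y(2)[symmetric] by (rule gen_incl) simp
    moreover have "?D \<subseteq> ?R" by (rule gen_mono') auto
    ultimately show "?D \<union> {x2, p2 / x2} \<subseteq> ?R" by blast
  qed
  finally show ?thesis .
qed

text \<open>Two binomials with independent exponents are coprime.\<close>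

lemma coprime_binomials:
  fixes wt :: "nat \<Rightarrow> int"
  assumes K: "subring K ambient" and J: "finite J" and x: "lindep K J x"
    and ac: "a \<in> exponents J" "c \<in> exponents J"
    and L: "(\<Sum>i\<in>J. wt i * a i) = 0" "(\<Sum>i\<in>J. wt i * c i) > 0"
    and hg: "h \<in> laurent_ring K (x ` J)" "g \<in> laurent_ring K (x ` J)"
      "(1 + lmonom J x c) * h = (1 + lmonom J x a) * g"
  shows "\<exists>g'\<in>laurent_ring K (x ` J). h = (1 + lmonom J x a) * g'"
proof -
  define deg where "deg m = (\<Sum>i\<in>J. wt i * m i)" for m
  let ?lo = "\<lambda>T. {m \<in> exponents J. deg m < T}" and ?hi = "\<lambda>T. {m \<in> exponents J. T \<le> deg m}"
  have nz: "\<And>i. i \<in> J \<Longrightarrow> x i \<noteq> 0" using lindep_nonzero[OF x] by blast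
  have B: "laurent_ring K (x ` J) = lspan K J x (exponents J)"
    by (rule laurent_ring_lspan[OF K J]) (rule nz)
  have deg_add: "deg (\<lambda>i. m i + k i) = deg m + deg k" for m k
    by (simp add: deg_def distrib_left sum.distrib)
  have exp_add: "(\<lambda>i. m i + k i) \<in> exponents J" if "m \<in> exponents J" "k \<in> exponents J" for m k
    using that by (simp add: exponents_def)
  have one: "1 \<in> K" "-1 \<in> K" using subring_closed[OF K] by auto
  have lo_ex: "\<exists>T. v \<in> lspan K J x (?lo T)" if "v \<in> lspan K J x (exponents J)" for v
    using that
  proof (induction rule: lspan.induct)
    case (lspan_step v d m)
    then obtain T where T: "v \<in> lspan K J x (?lo T)" by blast
    have "v \<in> lspan K J x (?lo (max T (deg m + 1)))" by (rule lspan_mono[OF T]) auto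
    then have "v + d * lmonom J x m \<in> lspan K J x (?lo (max T (deg m + 1)))"
      by (rule lspan.lspan_step) (use lspan_step in auto)
    then show ?case by blast
  qed (auto intro: lspan_zero)
  have hi_ex: "\<exists>T. v \<in> lspan K J x (?hi T)" if "v \<in> lspan K J x (exponents J)" for v
    using that
  proof (induction rule: lspan.induct)
    case (lspan_step v d m)
    then obtain T where T: "v \<in> lspan K J x (?hi T)" by blast
    have "v \<in> lspan K J x (?hi (min T (deg m)))" by (rule lspan_mono[OF T]) auto
    then have "v + d * lmonom J x m \<in> lspan K J x (?hi (min T (deg m)))"
      by (rule lspan.lspan_step) (use lspan_step in auto)
    then show ?case by blast
  qed (auto intro: lspan_zero)
  have split: "\<exists>v1 v2. v = v1 + v2 \<and> v1 \<in> lspan K J x (?lo T) \<and> v2 \<in> lspan K J x (?hi T)"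
    if "v \<in> lspan K J x (exponents J)" for v T
    using that
  proof (induction rule: lspan.induct)
    case lspan_zero
    show ?case by (intro exI[of _ 0]) (simp add: lspan.lspan_zero)
  next
    case (lspan_step v d m)
    then obtain v1 v2 where v: "v = v1 + v2" "v1 \<in> lspan K J x (?lo T)" "v2 \<in> lspan K J x (?hi T)" by blast
    show ?case
    proof (cases "deg m < T")
      case True
      then have "v1 + d * lmonom J x m \<in> lspan K J x (?lo T)"
        using v lspan_step by (intro lspan.lspan_step) auto
      then show ?thesis using v by (intro exI[of _ "v1 + d * lmonom J x m"] exI[of _ v2]) simp
    next
      case False
      then have "v2 + d * lmonom J x m \<in> lspan K J x (?hi T)"
        using v lspan_step by (intro lspan.lspan_step) auto
      then show ?thesis using v by (intro exI[of _ v1] exI[of _ "v2 + d * lmonom J x m"]) simp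
    qed
  qed
  let ?a = "lmonom J x a" and ?c = "lmonom J x c"
  have mult_a: "(1 + ?a) * v \<in> lspan K J x P" if v: "v \<in> lspan K J x P" and P: "P = ?lo T \<or> P = ?hi T" for v P T
  proof -
    have "v * (1 * ?a) \<in> lspan K J x P"
      by (rule lspan_mult_monom[OF K _ v one(1)])
        (use P ac L(1) exp_add deg_add nz in \<open>auto simp: deg_def\<close>)
    from lspan_add[OF v this] show ?thesis by (simp add: algebra_simps)
  qed
  from lo_ex[OF hg(1)[unfolded B]] obtain T where T: "h \<in> lspan K J x (?lo T)" ..
  from hi_ex[OF hg(1)[unfolded B]] obtain T' where T': "h \<in> lspan K J x (?hi T')" ..
  define N where "N = nat (T - T')"
  have shift: "(- ?c) ^ i * h \<in> lspan K J x (?hi (T' + int i))" for i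
  proof (induction i)
    case (Suc i)
    have "((- ?c) ^ i * h) * ((-1) * ?c) \<in> lspan K J x (?hi (T' + int (Suc i)))"
      by (rule lspan_mult_monom[OF K _ Suc one(2)])
        (use ac L(2) exp_add deg_add nz in \<open>auto simp: deg_def\<close>)
    then show ?case by (simp add: ac_simps)
  qed (use T' in simp)
  define u where "u = g * (\<Sum>i<N. (- ?c) ^ i)"
  have "?c \<in> lspan K J x (exponents J)" using lspan_single[OF one(1) ac(2)] by simp
  then have "?c \<in> laurent_ring K (x ` J)" unfolding B .
  then have "u \<in> laurent_ring K (x ` J)"
    unfolding u_def using hg(2) by (intro subring_closed[OF laurent_ring_subring])
  from split[OF this[unfolded B], of T] obtain u1 u2 where u: "u = u1 + u2" "u1 \<in> lspan K J x (?lo T)" "u2 \<in> lspan K J x (?hi T)"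
    by (elim exE conjE)
  have "(1 + ?a) * u = (1 + ?c) * h * (\<Sum>i<N. (- ?c) ^ i)" using hg(3) by (simp add: u_def ac_simps)
  also have "\<dots> = h * ((1 - (- ?c)) * (\<Sum>i<N. (- ?c) ^ i))" by (simp add: ac_simps)
  also have "(1 - (- ?c)) * (\<Sum>i<N. (- ?c) ^ i) = 1 - (- ?c) ^ N" by (rule one_diff_power_eq[symmetric])
  finally have eq: "h - (1 + ?a) * u1 = (1 + ?a) * u2 + (- ?c) ^ N * h"
    unfolding u(1) by (simp add: algebra_simps)
  have "(- ?c) ^ N * h \<in> lspan K J x (?hi T)"
    by (rule lspan_mono[OF shift]) (auto simp: N_def)
  then have "h - (1 + ?a) * u1 \<in> lspan K J x (?hi T)"
    unfolding eq by (intro lspan_add mult_a[OF u(3)]) auto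
  moreover have "h - (1 + ?a) * u1 \<in> lspan K J x (?lo T)"
    by (intro lspan_diff[OF K T] mult_a[OF u(2)]) auto
  ultimately have "h - (1 + ?a) * u1 = 0"
    by (intro lindep_disjoint[OF K x, of _ "?hi T" "?lo T"]) auto
  moreover have "u1 \<in> laurent_ring K (x ` J)" unfolding B by (rule lspan_mono[OF u(2)]) auto
  ultimately show ?thesis by (intro bexI[of _ u1]) auto
qed

section \<open>Mutation of seeds\<close>

lemma mutate_quiver_eq:
  assumes "is_quiver N q"
  shows "mutate_quiver l q i j =
    (if i = l \<or> j = l then q j i else (q i j + q i l * q l j) - (q j i + q j l * q l i))"
proof -
  have "q l l = 0" "q i j = 0 \<or> q j i = 0" using assms by (auto simp: is_quiver_def)
  then show ?thesis by (auto simp: mutate_quiver_def Let_def)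
qed

lemma mutate_quiver_is_quiver:
  assumes q: "is_quiver N q" and l: "l \<in> {1..N}"
  shows "is_quiver N (mutate_quiver l q)"
  unfolding is_quiver_def
proof (intro conjI allI impI)
  have pos: "i \<in> {1..N} \<and> j \<in> {1..N}" if "q i j > 0" for i j
    using q that by (simp add: is_quiver_def)
  have mem: "i \<in> {1..N} \<and> j \<in> {1..N}" if m: "mutate_quiver l q i j > 0" for i j
  proof -
    consider "q j i > 0" | "q i j > 0" | "q i l > 0" "q l j > 0"
      using m unfolding mutate_quiver_eq[OF q] by (cases "q i j"; cases "q i l"; cases "q l j") (auto split: if_splits)
    then show ?thesis by cases (use pos in blast)+
  qed
  show "i \<in> {1..N}" "j \<in> {1..N}" if "mutate_quiver l q i j > 0" for i j using mem[OF that] by blast+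
  show "mutate_quiver l q i i = 0" for i using q by (auto simp: mutate_quiver_eq[OF q] is_quiver_def)
  show "mutate_quiver l q i j = 0 \<or> mutate_quiver l q j i = 0" for i j
    using q by (auto simp: mutate_quiver_eq[OF q] is_quiver_def)
qed

lemma mutate_quiver_involutive:
  assumes q: "is_quiver N q" and l: "l \<in> {1..N}"
  shows "mutate_quiver l (mutate_quiver l q) = q"
proof (intro ext)
  fix i j
  note mq = mutate_quiver_eq[OF q] and mq' = mutate_quiver_eq[OF mutate_quiver_is_quiver[OF q l]]
  have arith: "((u + a) - (v + b) + b) - ((v + b) - (u + a) + a) = u" if "u = 0 \<or> v = 0" for u v a b :: nat
    using that by arith
  show "mutate_quiver l (mutate_quiver l q) i j = q i j"
  proof (cases "i = l \<or> j = l")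
    case True
    then show ?thesis by (auto simp: mq mq')
  next
    case False
    have "q i j = 0 \<or> q j i = 0" using q by (auto simp: is_quiver_def)
    from arith[OF this, of "q i l * q l j" "q j l * q l i"] show ?thesis
      using False by (simp add: mq mq' mult.commute)
  qed
qed

definition exchange :: "nat \<Rightarrow> (nat \<Rightarrow> nat \<Rightarrow> nat) \<Rightarrow> (nat \<Rightarrow> 'f::field) \<Rightarrow> nat \<Rightarrow> 'f" where
  "exchange N q x l = (\<Prod>i\<in>{1..N}. x i ^ q i l) + (\<Prod>i\<in>{1..N}. x i ^ q l i)"

lemma mutate_seed_simps [simp]:
  "arrows (mutate_seed N l s) = mutate_quiver l (arrows s)"
  "frozen (mutate_seed N l s) = frozen s"
  "cvar (mutate_seed N l s) = (cvar s)(l := exchange N (arrows s) (cvar s) l / cvar s l)"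
  by (simp_all add: mutate_seed_def exchange_def divide_inverse)

definition good_seed :: "'f::field set \<Rightarrow> nat \<Rightarrow> 'f seed \<Rightarrow> bool" where
  "good_seed K N s \<longleftrightarrow> is_quiver N (arrows s) \<and> frozen s \<subseteq> {1..N} \<and>
     (\<forall>j\<in>{1..N} - frozen s. \<exists>i\<in>{1..N}. arrows s i j \<noteq> arrows s j i) \<and>
     lindep K {1..N} (cvar s)"

definition full_rank :: "nat \<Rightarrow> 'f::field seed \<Rightarrow> bool" where
  "full_rank N s \<longleftrightarrow> (\<forall>c :: nat \<Rightarrow> int.
     (\<forall>i\<in>{1..N}. (\<Sum>j\<in>{1..N} - frozen s. (int (arrows s i j) - int (arrows s j i)) * c j) = 0) \<longrightarrow>
     (\<forall>j\<in>{1..N} - frozen s. c j = 0))"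

abbreviation cluster_ring :: "'f::field set \<Rightarrow> nat \<Rightarrow> 'f seed \<Rightarrow> 'f set" where
  "cluster_ring K N s \<equiv> laurent_ring K (cvar s ` {1..N})"

lemma laurent_monomial:
  assumes "\<And>i. i \<in> I \<Longrightarrow> i \<notin> J \<Longrightarrow> e i = 0"
  shows "(\<Prod>i\<in>I. x i ^ e i) \<in> laurent_ring K (x ` J)" "inverse (\<Prod>i\<in>I. x i ^ e i) \<in> laurent_ring K (x ` J)"
proof -
  note L = laurent_ring_subring[of K "x ` J"]
  have "x i ^ e i \<in> laurent_ring K (x ` J)" "inverse (x i ^ e i) \<in> laurent_ring K (x ` J)" if "i \<in> I" for i
  proof -
    have "x i ^ e i \<in> laurent_ring K (x ` J) \<and> inverse (x i) ^ e i \<in> laurent_ring K (x ` J)"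
    proof (cases "i \<in> J")
      case True
      then show ?thesis by (auto intro!: subring_power[OF L] intro: laurent_var laurent_inverse)
    qed (use assms[OF that] subring_one[OF L] in simp)
    then show "x i ^ e i \<in> laurent_ring K (x ` J)" "inverse (x i ^ e i) \<in> laurent_ring K (x ` J)"
      by (simp_all add: power_inverse)
  qed
  then show "(\<Prod>i\<in>I. x i ^ e i) \<in> laurent_ring K (x ` J)" "inverse (\<Prod>i\<in>I. x i ^ e i) \<in> laurent_ring K (x ` J)"
    by (auto simp: prod_inversef[symmetric] comp_def intro!: subring_prod[OF L])
qed

lemma exchange_mem:
  assumes "is_quiver N q" shows "exchange N q x l \<in> laurent_ring K (x ` ({1..N} - {l}))"
  unfolding exchange_def using assms
  by (intro subring_add[OF laurent_ring_subring] laurent_monomial) (auto simp: is_quiver_def)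

lemma exchange_nonzero:
  assumes K: "subring K ambient" and x: "lindep K {1..N} x" and q: "is_quiver N q"
    and i: "i \<in> {1..N}" "q i l \<noteq> q l i"
  shows "exchange N q x l \<noteq> 0"
proof
  let ?J = "{1..N} - {i}"
  assume zero: "exchange N q x l = 0"
  have nz: "x i \<noteq> 0" if "i \<in> {1..N}" for i using lindep_nonzero[OF x that] .
  have tr: "transc (laurent_ring K (x ` ?J)) (x i)" by (rule lindep_transc[OF K _ i(1) x]) simp
  have split: "(\<Prod>m\<in>{1..N}. x m ^ e m) = x i ^ e i * (\<Prod>m\<in>?J. x m ^ e m)" for e
    using i(1) by (simp add: prod.remove)
  have key: False
    if eq: "x i ^ a * \<alpha> + \<beta> = 0" and a: "a > 0" and \<alpha>: "\<alpha> \<in> laurent_ring K (x ` ?J)"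
      and \<beta>: "\<beta> \<in> laurent_ring K (x ` ?J)" "\<beta> \<noteq> 0" for a \<alpha> \<beta>
  proof -
    let ?p = "Polynomial.monom \<alpha> a + [:\<beta>:]"
    have "?p = 0"
    proof (rule transcD[OF tr])
      show "poly ?p (x i) = 0" using eq by (simp add: poly_monom mult.commute)
      show "coeff ?p m \<in> laurent_ring K (x ` ?J)" for m
        using \<alpha> \<beta> subring_zero[OF laurent_ring_subring] subring_add[OF laurent_ring_subring]
        by (auto simp: coeff_pCons split: nat.splits)
    qed
    then have "coeff ?p 0 = 0" by simp
    then show False using a \<beta>(2) by simp
  qed
  have mem: "(\<Prod>m\<in>?J. x m ^ e m) \<in> laurent_ring K (x ` ?J)" for e by (rule laurent_monomial) auto
  have nz': "(\<Prod>m\<in>?J. x m ^ e m) \<noteq> 0" for e using nz by auto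
  have "q i l = 0 \<or> q l i = 0" using q by (auto simp: is_quiver_def)
  then consider "q i l > 0" "q l i = 0" | "q l i > 0" "q i l = 0" using i(2) by auto
  then show False
  proof cases
    case 1
    have "exchange N q x l = x i ^ q i l * (\<Prod>m\<in>?J. x m ^ q m l) + (\<Prod>m\<in>?J. x m ^ q l m)"
      unfolding exchange_def split using 1 by simp
    then show False using key[OF _ 1(1) mem mem nz'] zero by metis
  next
    case 2
    have "exchange N q x l = x i ^ q l i * (\<Prod>m\<in>?J. x m ^ q l m) + (\<Prod>m\<in>?J. x m ^ q m l)"
      unfolding exchange_def split using 2 by simp
    then show False using key[OF _ 2(1) mem mem nz'] zero by metis
  qed
qed

lemma good_seedD:
  assumes "good_seed K N s"
  shows "is_quiver N (arrows s)" "frozen s \<subseteq> {1..N}" "lindep K {1..N} (cvar s)"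
    "j \<in> {1..N} - frozen s \<Longrightarrow> \<exists>i\<in>{1..N}. arrows s i j \<noteq> arrows s j i"
  using assms unfolding good_seed_def by blast+

lemma good_exchange_nonzero:
  assumes "subring K ambient" "good_seed K N s" "l \<in> {1..N} - frozen s"
  shows "exchange N (arrows s) (cvar s) l \<noteq> 0"
proof -
  obtain i where "i \<in> {1..N}" "arrows s i l \<noteq> arrows s l i"
    using good_seedD(4)[OF assms(2,3)] by blast
  then show ?thesis by (rule exchange_nonzero[OF assms(1) good_seedD(3,1)[OF assms(2)]])
qed

lemma good_cvar_nonzero: "good_seed K N s \<Longrightarrow> i \<in> {1..N} \<Longrightarrow> cvar s i \<noteq> 0"
  by (rule lindep_nonzero[OF good_seedD(3)])

lemma lindep_cong:
  assumes "\<And>i. i \<in> I \<Longrightarrow> x i = y i" "lindep K I x" shows "lindep K I y"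
proof -
  have "lmonom I x m = lmonom I y m" for m by (rule lmonom_cong) (use assms in auto)
  then show ?thesis using assms by (auto simp: lindep_def)
qed

lemma good_mutate:
  assumes K: "subring K ambient" and s: "good_seed K N s" and l: "l \<in> {1..N} - frozen s"
  shows "good_seed K N (mutate_seed N l s)"
proof -
  let ?q = "arrows s" and ?x = "cvar s" and ?y = "cvar (mutate_seed N l s)"
  have q: "is_quiver N ?q" and x: "lindep K {1..N} ?x" using s by (auto simp: good_seed_def)
  note mq = mutate_quiver_eq[OF q]
  have P: "exchange N ?q ?x l \<noteq> 0" by (rule good_exchange_nonzero[OF K s l])
  have xl: "?x l \<noteq> 0" using good_cvar_nonzero[OF s] l by blast
  have img: "?y ` ({1..N} - {l}) = ?x ` ({1..N} - {l})" by auto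
  have "lindep K {1..N} ?y"
  proof (rule lindep_extend[OF K])
    show "lindep K ({1..N} - {l}) ?y"
      by (rule lindep_cong[of _ ?x]) (auto intro: lindep_mono[OF x])
    show "?y l \<noteq> 0" using P xl by simp
    have "transc (laurent_ring K (?x ` ({1..N} - {l}))) (?x l)"
      by (rule lindep_transc[OF K _ _ x]) (use l in auto)
    from transc_exchange[OF laurent_ring_subring this xl exchange_mem[OF q] P]
    show "transc (laurent_ring K (?y ` ({1..N} - {l}))) (?y l)" unfolding img by simp
  qed (use l in auto)
  moreover have "\<exists>i\<in>{1..N}. mutate_quiver l ?q i j \<noteq> mutate_quiver l ?q j i"
    if j: "j \<in> {1..N} - frozen s" for j
  proof (cases "j = l \<or> ?q l j = ?q j l")
    case False
    then show ?thesis using l by (intro bexI[of _ l]) (auto simp: mq)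
  next
    case True
    obtain i where i: "i \<in> {1..N}" "?q i j \<noteq> ?q j i" using good_seedD(4)[OF s j] by blast
    have cyc: "?q i j = 0 \<or> ?q j i = 0" "?q l j = 0 \<or> ?q j l = 0" using q by (auto simp: is_quiver_def)
    show ?thesis
    proof (cases "j = l")
      case True
      then show ?thesis using i by (intro bexI[of _ i]) (auto simp: mq)
    next
      case jl: False
      then have "?q l j = 0" "?q j l = 0" using True cyc by auto
      moreover have "i \<noteq> l" using i(2) calculation by auto
      ultimately show ?thesis using i cyc(1) jl by (intro bexI[of _ i]) (auto simp: mq)
    qed
  qed
  moreover have "is_quiver N (mutate_quiver l ?q)" by (rule mutate_quiver_is_quiver[OF q]) (use l in blast)
  ultimately show ?thesis
    using good_seedD(2)[OF s] unfolding good_seed_def mutate_seed_simps by blast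
qed

lemma mutate_seed_involutive:
  assumes s: "good_seed K N s" and K: "subring K ambient" and l: "l \<in> {1..N} - frozen s"
  shows "mutate_seed N l (mutate_seed N l s) = s"
proof (rule seed.equality)
  let ?q = "arrows s" and ?x = "cvar s"
  have q: "is_quiver N ?q" using s by (simp add: good_seed_def)
  show "arrows (mutate_seed N l (mutate_seed N l s)) = ?q"
    using mutate_quiver_involutive[OF q] l by simp
  let ?y = "?x(l := exchange N ?q ?x l / ?x l)"
  have fac: "?y i ^ mutate_quiver l ?q i l = ?x i ^ ?q l i" "?y i ^ mutate_quiver l ?q l i = ?x i ^ ?q i l" for i
    using q by (auto simp: mutate_quiver_eq[OF q] is_quiver_def)
  have "exchange N (mutate_quiver l ?q) ?y l =
      (\<Prod>i\<in>{1..N}. ?y i ^ mutate_quiver l ?q i l) + (\<Prod>i\<in>{1..N}. ?y i ^ mutate_quiver l ?q l i)"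
    by (rule exchange_def)
  also have "\<dots> = (\<Prod>i\<in>{1..N}. ?x i ^ ?q l i) + (\<Prod>i\<in>{1..N}. ?x i ^ ?q i l)"
    by (simp only: fac)
  also have "\<dots> = exchange N ?q ?x l" unfolding exchange_def by (rule add.commute)
  finally have "exchange N (mutate_quiver l ?q) ?y l = exchange N ?q ?x l" .
  then show "cvar (mutate_seed N l (mutate_seed N l s)) = ?x"
    using good_cvar_nonzero[OF s, of l] good_exchange_nonzero[OF K s l] l by (auto simp: fun_eq_iff)
qed simp_all

lemma full_rank_mutate:
  assumes s: "is_quiver N (arrows s)" and fr: "full_rank N s" and l: "l \<in> {1..N} - frozen s"
  shows "full_rank N (mutate_seed N l s)"
  unfolding full_rank_def
proof (intro allI impI)
  let ?q = "arrows s" and ?M = "{1..N} - frozen s"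
  define b where "b i j = int (?q i j) - int (?q j i)" for i j
  define b' where "b' i j = int (mutate_quiver l ?q i j) - int (mutate_quiver l ?q j i)" for i j
  fix c :: "nat \<Rightarrow> int"
  assume "\<forall>i\<in>{1..N}. (\<Sum>j\<in>{1..N} - frozen (mutate_seed N l s).
    (int (arrows (mutate_seed N l s) i j) - int (arrows (mutate_seed N l s) j i)) * c j) = 0"
  then have c: "(\<Sum>j\<in>?M. b' i j * c j) = 0" if "i \<in> {1..N}" for i
    using that by (simp add: b'_def)
  have cyc: "?q i j = 0 \<or> ?q j i = 0" and ll: "?q l l = 0" for i j using s by (auto simp: is_quiver_def)
  have b'l: "b' i l = - b i l" "b' l i = - b l i" for i
    by (simp_all add: b_def b'_def mutate_quiver_eq[OF s])
  have b': "b' i j = b i j + int (?q i l) * b l j + b i l * int (?q j l)" if "i \<noteq> l" "j \<noteq> l" for i j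
  proof -
    have "int ((?q i j + u) - (?q j i + v)) - int ((?q j i + v) - (?q i j + u)) = b i j + int u - int v" for u v
      unfolding b_def by linarith
    from this[of "?q i l * ?q l j" "?q j l * ?q l i"]
    have "b' i j = b i j + int (?q i l * ?q l j) - int (?q j l * ?q l i)"
      using that by (simp add: b'_def mutate_quiver_eq[OF s])
    then show ?thesis using cyc[of i l] cyc[of j l] by (auto simp: b_def algebra_simps)
  qed
  define c' where "c' = c(l := (\<Sum>j\<in>?M - {l}. int (?q j l) * c j) - c l)"
  have split: "(\<Sum>j\<in>?M. g j) = g l + (\<Sum>j\<in>?M - {l}. g j)" for g :: "nat \<Rightarrow> int"
    using l by (subst sum.remove[of _ l]) auto
  have row_l: "(\<Sum>j\<in>?M - {l}. b l j * c j) = 0"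
  proof -
    have "b l l = 0" by (simp add: b_def)
    then show ?thesis using c[of l] l unfolding split b'l(2) by (simp add: sum_negf)
  qed
  have "(\<Sum>j\<in>?M. b i j * c' j) = 0" if i: "i \<in> {1..N}" for i
  proof -
    have tail: "(\<Sum>j\<in>?M - {l}. b i j * c' j) = (\<Sum>j\<in>?M - {l}. b i j * c j)"
      by (rule sum.cong) (auto simp: c'_def)
    show ?thesis
    proof (cases "i = l")
      case True
      then show ?thesis unfolding split tail using row_l by (simp add: b_def)
    next
      case False
      have "0 = (\<Sum>j\<in>?M. b' i j * c j)" using c[OF i] by simp
      also have "\<dots> = - b i l * c l + (\<Sum>j\<in>?M - {l}. b' i j * c j)" unfolding split by (simp add: b'l)
      also have "(\<Sum>j\<in>?M - {l}. b' i j * c j) =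
          (\<Sum>j\<in>?M - {l}. b i j * c j + (int (?q i l) * (b l j * c j) + b i l * (int (?q j l) * c j)))"
        by (rule sum.cong) (use False in \<open>auto simp: b' algebra_simps\<close>)
      also have "\<dots> = (\<Sum>j\<in>?M - {l}. b i j * c j) + (int (?q i l) * (\<Sum>j\<in>?M - {l}. b l j * c j) +
          b i l * (\<Sum>j\<in>?M - {l}. int (?q j l) * c j))"
        by (simp only: sum.distrib sum_distrib_left)
      finally show ?thesis
        unfolding split tail row_l by (simp add: c'_def algebra_simps)
    qed
  qed
  then have c'0: "c' j = 0" if "j \<in> ?M" for j
    using fr that unfolding full_rank_def b_def by blast
  have cj: "c j = 0" if "j \<in> ?M - {l}" for j using c'0[of j] that by (auto simp: c'_def)
  have cl: "c l = 0" using c'0[of l] l cj by (simp add: c'_def)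
  show "\<forall>j\<in>{1..N} - frozen (mutate_seed N l s). c j = 0"
  proof
    fix j assume "j \<in> {1..N} - frozen (mutate_seed N l s)"
    then show "c j = 0" using cj[of j] cl by (cases "j = l") simp_all
  qed
qed

section \<open>The Laurent phenomenon for seeds of full rank\<close>

lemma gen_gen: "gen (gen A \<union> A') = gen (A \<union> A')"
proof
  have "gen A \<subseteq> gen (A \<union> A')" by (rule gen_mono') auto
  then show "gen (gen A \<union> A') \<subseteq> gen (A \<union> A')" by (intro gen_mono) (auto intro: gen_incl)
  show "gen (A \<union> A') \<subseteq> gen (gen A \<union> A')" by (rule gen_mono') (auto intro: gen_incl)
qed

lemma laurent_insert: "laurent_ring K (insert y Y) = gen (laurent_ring K Y \<union> {y, inverse y})"
proof -
  have "K \<union> insert y Y \<union> inverse ` insert y Y = (K \<union> Y \<union> inverse ` Y) \<union> {y, inverse y}" by blast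
  then show ?thesis by (simp only: laurent_ring_def gen_gen)
qed

lemma laurent_insert2:
  "laurent_ring K (insert y (insert z Y)) = gen (laurent_ring K Y \<union> {z, inverse z, y, inverse y})"
proof -
  have "{z, inverse z, y, inverse y} = {z, inverse z} \<union> {y, inverse y}" by blast
  then show ?thesis by (simp only: laurent_insert gen_gen Un_assoc)
qed

definition opposite :: "'f seed \<Rightarrow> 'f seed" where
  "opposite s = s\<lparr>arrows := \<lambda>i j. arrows s j i\<rparr>"

lemma opposite_simps [simp]:
  "arrows (opposite s) = (\<lambda>i j. arrows s j i)" "frozen (opposite s) = frozen s" "cvar (opposite s) = cvar s"
  by (simp_all add: opposite_def)

lemma is_quiver_opposite:
  assumes "is_quiver N q" shows "is_quiver N (\<lambda>i j. q j i)"
proof -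
  have q: "\<And>i j. q i j > 0 \<Longrightarrow> i \<in> {1..N} \<and> j \<in> {1..N}" "\<And>i. q i i = 0"
    "\<And>i j. q i j = 0 \<or> q j i = 0"
    using assms by (simp_all add: is_quiver_def)
  show ?thesis
    unfolding is_quiver_def
  proof (intro conjI allI impI)
    show "i \<in> {1..N}" "j \<in> {1..N}" if "q j i > 0" for i j using q(1)[OF that] by simp_all
    show "q i i = 0" for i by (rule q(2))
    show "q j i = 0 \<or> q i j = 0" for i j by (rule q(3))
  qed
qed

lemma cvar_mutate_opposite: "cvar (mutate_seed N l (opposite s)) = cvar (mutate_seed N l s)"
  by (simp add: exchange_def add.commute)

lemma mutate_quiver_opposite:
  assumes "is_quiver N q"
  shows "mutate_quiver l (\<lambda>i j. q j i) = (\<lambda>i j. mutate_quiver l q j i)"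
  by (intro ext) (simp add: mutate_quiver_eq[OF assms] mutate_quiver_eq[OF is_quiver_opposite[OF assms]] mult.commute)

lemma mutate_opposite:
  assumes "is_quiver N (arrows s)"
  shows "mutate_seed N l (opposite s) = opposite (mutate_seed N l s)"
  by (rule seed.equality)
    (simp_all add: mutate_quiver_opposite[OF assms] cvar_mutate_opposite[unfolded mutate_seed_simps opposite_simps])

lemma good_opposite:
  assumes s: "good_seed K N s" shows "good_seed K N (opposite s)"
  unfolding good_seed_def opposite_simps
proof (intro conjI ballI)
  show "\<exists>i\<in>{1..N}. arrows s j i \<noteq> arrows s i j" if "j \<in> {1..N} - frozen s" for j
    using good_seedD(4)[OF s that] by metis
qed (use good_seedD(1-3)[OF s] is_quiver_opposite in simp_all)

locale mutation_pair =
  fixes K :: "'f::field set" and N :: nat and s :: "'f seed" and j k :: nat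
  assumes K: "subring K ambient" and s: "good_seed K N s"
    and j: "j \<in> {1..N} - frozen s" and k: "k \<in> {1..N} - frozen s" and jk: "j \<noteq> k"
begin

abbreviation "q \<equiv> arrows s"
abbreviation "x \<equiv> cvar s"
abbreviation "J \<equiv> {1..N} - {j, k}"
abbreviation "B \<equiv> laurent_ring K (x ` J)"
abbreviation "yj \<equiv> exchange N q x j / x j"
abbreviation "yk \<equiv> exchange N q x k / x k"
abbreviation "zj \<equiv> exchange N (mutate_quiver k q) (x(k := yk)) j / x j"

lemma quiver: "is_quiver N q" by (rule good_seedD(1)[OF s])

lemma no_2cycles: "q a b = 0 \<or> q b a = 0" and no_loops: "q a a = 0"
  using quiver by (auto simp: is_quiver_def)

lemma vertices: "{1..N} = insert j (insert k J)" using j k by auto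

lemma prod_vertices: "(\<Prod>i\<in>{1..N}. f i) = f j * (f k * (\<Prod>i\<in>J. f i))"
proof -
  have "(\<Prod>i\<in>{1..N}. f i) = (\<Prod>i\<in>insert j (insert k J). f i)"
    by (rule arg_cong[OF vertices])
  also have "\<dots> = f j * (\<Prod>i\<in>insert k J. f i)" by (rule prod.insert) (use jk in auto)
  also have "(\<Prod>i\<in>insert k J. f i) = f k * (\<Prod>i\<in>J. f i)" by (rule prod.insert) auto
  finally show ?thesis .
qed

lemma J_image:
  "(x(l := u)) ` J = x ` J" if "l \<in> {j, k}" for l u
  using that by auto

lemma cluster_rings:
  "cluster_ring K N s = gen (gen (B \<union> {x k, inverse (x k)}) \<union> {x j, inverse (x j)})"
  "cluster_ring K N (mutate_seed N j s) = gen (gen (B \<union> {x k, inverse (x k)}) \<union> {yj, inverse yj})"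
  "cluster_ring K N (mutate_seed N k s) = gen (B \<union> {yk, inverse yk, x j, inverse (x j)})"
  "cluster_ring K N (mutate_seed N j (mutate_seed N k s)) = gen (B \<union> {yk, inverse yk, zj, inverse zj})"
proof -
  have img: "f ` {1..N} = insert (f j) (insert (f k) (f ` J))" for f :: "nat \<Rightarrow> 'f"
  proof -
    have "f ` {1..N} = f ` insert j (insert k J)" by (rule arg_cong[OF vertices])
    then show ?thesis by (simp only: image_insert)
  qed
  have J2: "((x(k := yk))(j := u)) ` J = x ` J" for u by auto
  show "cluster_ring K N s = gen (gen (B \<union> {x k, inverse (x k)}) \<union> {x j, inverse (x j)})"
    unfolding img laurent_insert ..
  show "cluster_ring K N (mutate_seed N j s) = gen (gen (B \<union> {x k, inverse (x k)}) \<union> {yj, inverse yj})"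
    unfolding img laurent_insert mutate_seed_simps J_image[of j, simplified] using jk by simp
  show "cluster_ring K N (mutate_seed N k s) = gen (B \<union> {yk, inverse yk, x j, inverse (x j)})"
    unfolding img laurent_insert2 mutate_seed_simps J_image[of k, simplified] using jk by simp
  show "cluster_ring K N (mutate_seed N j (mutate_seed N k s)) = gen (B \<union> {yk, inverse yk, zj, inverse zj})"
    unfolding img laurent_insert2 mutate_seed_simps J2 using jk by simp
qed

lemma x_nonzero: "i \<in> {1..N} \<Longrightarrow> x i \<noteq> 0" by (rule good_cvar_nonzero[OF s])

lemma xj: "x j \<noteq> 0" and xk: "x k \<noteq> 0" using x_nonzero j k by auto

lemma yj_nonzero: "yj \<noteq> 0" and yk_nonzero: "yk \<noteq> 0"
  using good_exchange_nonzero[OF K s] j k xj xk by auto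

lemma zj_nonzero: "zj \<noteq> 0"
  using good_exchange_nonzero[OF K good_mutate[OF K s k], of j] j xj by simp

lemma B_eq: "laurent_ring K (x ` ({1..N} - {j})) = gen (B \<union> {x k, inverse (x k)})"
  "laurent_ring K (x ` ({1..N} - {k})) = gen (B \<union> {x j, inverse (x j)})"
proof -
  have "{1..N} - {j} = insert k J" "{1..N} - {k} = insert j J" using j k jk by auto
  then show "laurent_ring K (x ` ({1..N} - {j})) = gen (B \<union> {x k, inverse (x k)})"
    "laurent_ring K (x ` ({1..N} - {k})) = gen (B \<union> {x j, inverse (x j)})"
    by (simp_all only: image_insert laurent_insert)
qed

lemma transc_j: "transc (gen (B \<union> {x k, inverse (x k)})) (x j)"
  unfolding B_eq[symmetric] by (rule lindep_transc[OF K _ _ good_seedD(3)[OF s]]) (use j in auto)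

lemma transc_k: "transc B (x k)"
proof (rule transc_mono)
  show "transc (gen (B \<union> {x j, inverse (x j)})) (x k)"
    unfolding B_eq[symmetric] by (rule lindep_transc[OF K _ _ good_seedD(3)[OF s]]) (use k in auto)
  show "B \<subseteq> gen (B \<union> {x j, inverse (x j)})" by (auto intro: gen_incl)
qed

lemma J_monomial: "(\<Prod>i\<in>J. x i ^ e i) \<in> B" "inverse (\<Prod>i\<in>J. x i ^ e i) \<in> B"
    "(\<Prod>i\<in>J. x i ^ e i) \<noteq> 0"
  using x_nonzero by (auto intro: laurent_monomial)

lemma step_connected:
  assumes b: "q k j > 0"
    and f: "f \<in> cluster_ring K N s" "f \<in> cluster_ring K N (mutate_seed N j s)" "f \<in> cluster_ring K N (mutate_seed N k s)"
  shows "f \<in> cluster_ring K N (mutate_seed N j (mutate_seed N k s))"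
proof -
  let ?mon = "\<lambda>e. \<Prod>i\<in>J. x i ^ e i"
  let ?b = "q k j"
  have jk0: "q j k = 0" using no_2cycles[of j k] b by simp
  define A where "A i = q i j + q i k * ?b" for i
  define w where "w = inverse (?mon (\<lambda>i. min (A i) (q j i)))"
  have mon_add: "?mon (\<lambda>i. e i + e' i) = ?mon e * ?mon e'" for e e' :: "nat \<Rightarrow> nat"
    by (simp add: power_add prod.distrib)
  have mon_pow: "?mon (\<lambda>i. e i * m) = ?mon e ^ m" for e and m :: nat
    by (simp add: power_mult prod_power_distrib)
  have "exchange N q x k = ?mon (\<lambda>i. q i k) + ?mon (\<lambda>i. q k i) * x j ^ ?b"
    unfolding exchange_def prod_vertices using jk0 by (simp add: no_loops mult.commute)
  moreover have "exchange N q x j = ?mon (\<lambda>i. q i j) * x k ^ ?b + ?mon (\<lambda>i. q j i)"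
    unfolding exchange_def prod_vertices using jk0 by (simp add: no_loops mult.commute)
  moreover have "exchange N (mutate_quiver k q) (x(k := yk)) j =
      w * (?mon (\<lambda>i. q j i) * yk ^ ?b + ?mon (\<lambda>i. q i j) * ?mon (\<lambda>i. q i k) ^ ?b)"
  proof -
    have mq: "mutate_quiver k q i j = A i - q j i" "mutate_quiver k q j i = q j i - A i" if "i \<in> J" for i
      using that jk jk0 by (auto simp: mutate_quiver_eq[OF quiver] A_def)
    have mq': "mutate_quiver k q k j = 0" "mutate_quiver k q j k = ?b" "mutate_quiver k q j j = 0"
      using jk0 by (auto simp: mutate_quiver_eq[OF quiver])
    have "(\<Prod>i\<in>J. (x(k := yk)) i ^ mutate_quiver k q i j) = ?mon (\<lambda>i. A i - q j i)"
      "(\<Prod>i\<in>J. (x(k := yk)) i ^ mutate_quiver k q j i) = ?mon (\<lambda>i. q j i - A i)"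
      by (rule prod.cong; simp add: mq)+
    then have 1: "exchange N (mutate_quiver k q) (x(k := yk)) j =
        ?mon (\<lambda>i. A i - q j i) + yk ^ ?b * ?mon (\<lambda>i. q j i - A i)"
      unfolding exchange_def prod_vertices using jk mq' by simp
    have "A i - q j i + min (A i) (q j i) = A i" "q j i - A i + min (A i) (q j i) = q j i" for i by auto
    then have 2: "?mon (\<lambda>i. A i - q j i) * ?mon (\<lambda>i. min (A i) (q j i)) = ?mon A"
      "?mon (\<lambda>i. q j i - A i) * ?mon (\<lambda>i. min (A i) (q j i)) = ?mon (\<lambda>i. q j i)"
      by (simp_all only: mon_add[symmetric])
    have 3: "?mon A = ?mon (\<lambda>i. q i j) * ?mon (\<lambda>i. q i k) ^ ?b"
      unfolding A_def by (simp only: mon_add mon_pow)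
    show ?thesis
      unfolding 1 w_def 2[symmetric] 3[symmetric] using J_monomial(3)[of "\<lambda>i. min (A i) (q j i)"]
      by (simp add: field_simps)
  qed
  ultimately have y: "yk = (?mon (\<lambda>i. q i k) + ?mon (\<lambda>i. q k i) * x j ^ ?b) / x k"
      "yj = (?mon (\<lambda>i. q i j) * x k ^ ?b + ?mon (\<lambda>i. q j i)) / x j"
      "zj = w * (?mon (\<lambda>i. q j i) * yk ^ ?b + ?mon (\<lambda>i. q i j) * ?mon (\<lambda>i. q i k) ^ ?b) / x j"
    by simp_all
  show ?thesis
    unfolding cluster_rings(4)
  proof (rule rank2_connected[OF laurent_ring_subring xk xj _ _ _ _ _ _ _ _ _ _ y(1) yk_nonzero y(2) yj_nonzero
        y(3) zj_nonzero transc_j f(1)[unfolded cluster_rings(1)] f(2)[unfolded cluster_rings(2)]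
        f(3)[unfolded cluster_rings(3)]])
    show "1 \<le> ?b" using b by simp
    show "w \<in> B" "inverse w \<in> B" "w \<noteq> 0" unfolding w_def using J_monomial by simp_all
  qed (use J_monomial in auto)
qed

lemma step_disconnected:
  assumes b: "q k j = 0" "q j k = 0" and fr: "full_rank N s"
    and f: "f \<in> cluster_ring K N s" "f \<in> cluster_ring K N (mutate_seed N j s)" "f \<in> cluster_ring K N (mutate_seed N k s)"
  shows "f \<in> cluster_ring K N (mutate_seed N j (mutate_seed N k s))"
proof -
  let ?mon = "\<lambda>e. \<Prod>i\<in>J. x i ^ e i"
  have P: "exchange N q x l = ?mon (\<lambda>i. q i l) + ?mon (\<lambda>i. q l i)" if "l \<in> {j, k}" for l
    unfolding exchange_def prod_vertices using that b by (auto simp: no_loops)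
  have "exchange N (mutate_quiver k q) (x(k := yk)) j = exchange N q x j"
  proof -
    have mq: "mutate_quiver k q i j = q i j" "mutate_quiver k q j i = q j i" for i
      using b no_2cycles[of i j] jk by (auto simp: mutate_quiver_eq[OF quiver])
    have "(x(k := yk)) i ^ q i j = x i ^ q i j" "(x(k := yk)) i ^ q j i = x i ^ q j i" for i
      using b by auto
    then show ?thesis unfolding exchange_def mq by simp
  qed
  then have zj: "zj = exchange N q x j / x j" by simp
  define b where "b i l = int (q i l) - int (q l i)" for i l
  define ex where "ex l = (\<lambda>i. if i \<in> J then b i l else 0)" for l
  have binom: "exchange N q x l = ?mon (\<lambda>i. q l i) * (1 + lmonom J x (ex l))" if "l \<in> {j, k}" for l
  proof -
    have "?mon (\<lambda>i. q l i) * lmonom J x (ex l) = ?mon (\<lambda>i. q i l)"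
      unfolding lmonom_def prod.distrib[symmetric]
    proof (rule prod.cong)
      fix i assume i: "i \<in> J"
      then have "x i \<noteq> 0" using x_nonzero by auto
      then have "x i powi (int (q l i) + b i l) = x i ^ q l i * x i powi b i l" by (simp add: power_int_add)
      then show "x i ^ q l i * x i powi ex l i = x i ^ q i l" using i by (simp add: ex_def b_def)
    qed simp
    then show ?thesis unfolding P[OF that] by (simp add: distrib_left)
  qed
  have b0: "b a c = 0" if "a \<in> {j, k}" "c \<in> {j, k}" for a c using that assms(1,2) by (auto simp: b_def)
  have indep: "u = 0 \<and> v = 0" if uv: "\<And>i. i \<in> J \<Longrightarrow> u * b i k + v * b i j = 0" for u v
  proof -
    define c where "c m = (if m = k then u else if m = j then v else 0)" for m
    have "(\<Sum>m\<in>{1..N} - frozen s. b i m * c m) = 0" if i: "i \<in> {1..N}" for i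
    proof -
      have "(\<Sum>m\<in>{1..N} - frozen s. b i m * c m) = (\<Sum>m\<in>{j, k}. b i m * c m)"
        by (rule sum.mono_neutral_right) (use j k in \<open>auto simp: c_def\<close>)
      also have "\<dots> = u * b i k + v * b i j" using jk by (simp add: c_def)
      also have "\<dots> = 0" using uv[of i] i b0[of i k] b0[of i j] by (cases "i \<in> J") auto
      finally show ?thesis .
    qed
    then have "\<forall>m\<in>{1..N} - frozen s. c m = 0" using fr unfolding full_rank_def b_def by blast
    then have "c k = 0" "c j = 0" using j k by blast+
    then show ?thesis using jk by (simp add: c_def)
  qed
  define naa where "naa = (\<Sum>i\<in>J. b i k * b i k)"
  define nac where "nac = (\<Sum>i\<in>J. b i k * b i j)"
  define wt where "wt i = naa * b i j - nac * b i k" for i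
  have orth: "(\<Sum>i\<in>J. wt i * b i k) = 0"
    by (simp add: wt_def left_diff_distrib sum_subtractf mult.assoc sum_distrib_left[symmetric] naa_def nac_def
        mult.commute[of "b _ j"])
  have naa_pos: "naa > 0"
  proof -
    have "\<not> (\<forall>i\<in>J. b i k * b i k = 0)"
    proof
      assume "\<forall>i\<in>J. b i k * b i k = 0"
      then have "1 * b i k + 0 * b i j = 0" if "i \<in> J" for i using that by auto
      from indep[of 1 0, OF this] show False by simp
    qed
    then have "naa \<noteq> 0" unfolding naa_def by (subst sum_nonneg_eq_0_iff) auto
    moreover have "naa \<ge> 0" unfolding naa_def by (rule sum_nonneg) simp
    ultimately show ?thesis by simp
  qed
  have "\<not> (\<forall>i\<in>J. wt i * wt i = 0)"
  proof
    assume "\<forall>i\<in>J. wt i * wt i = 0"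
    then have "wt i = 0" if "i \<in> J" for i using that by auto
    then have "- nac * b i k + naa * b i j = 0" if "i \<in> J" for i using that by (simp add: wt_def)
    from indep[of "- nac" naa, OF this] show False using naa_pos by simp
  qed
  then have "(\<Sum>i\<in>J. wt i * wt i) \<noteq> 0" by (subst sum_nonneg_eq_0_iff) auto
  moreover have "(\<Sum>i\<in>J. wt i * wt i) \<ge> 0" by (rule sum_nonneg) simp
  ultimately have "(\<Sum>i\<in>J. wt i * wt i) > 0" by simp
  also have "(\<Sum>i\<in>J. wt i * wt i) = (\<Sum>i\<in>J. naa * (wt i * b i j) - nac * (wt i * b i k))"
    by (rule sum.cong) (auto simp: wt_def algebra_simps)
  also have "\<dots> = naa * (\<Sum>i\<in>J. wt i * b i j) - nac * (\<Sum>i\<in>J. wt i * b i k)"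
    by (simp only: sum_subtractf sum_distrib_left)
  also have "(\<Sum>i\<in>J. wt i * b i k) = 0" by (rule orth)
  finally have pos: "(\<Sum>i\<in>J. wt i * b i j) > 0" using naa_pos by (simp add: zero_less_mult_iff)
  have exJ: "ex l \<in> exponents J" for l by (simp add: ex_def exponents_def)
  have sum_ex: "(\<Sum>i\<in>J. wt i * ex l i) = (\<Sum>i\<in>J. wt i * b i l)" for l by (rule sum.cong) (auto simp: ex_def)
  have reg: "\<exists>g'\<in>B. h = exchange N q x k * g'"
    if hg: "h \<in> B" "g \<in> B" "exchange N q x j * h = exchange N q x k * g" for h g
  proof -
    note L = laurent_ring_subring[of K "x ` J"]
    let ?mj = "?mon (\<lambda>i. q j i)" and ?mk = "?mon (\<lambda>i. q k i)"
    have "?mj * ((1 + lmonom J x (ex j)) * h) = ?mj * ((1 + lmonom J x (ex k)) * (inverse ?mj * ?mk * g))"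
      using hg(3) J_monomial(3)[of "\<lambda>i. q j i"] by (simp add: binom ac_simps)
    then have eq: "(1 + lmonom J x (ex j)) * h = (1 + lmonom J x (ex k)) * (inverse ?mj * ?mk * g)"
      using J_monomial(3)[of "\<lambda>i. q j i"] by (simp only: mult_cancel_left) simp
    have mem: "inverse ?mj * ?mk * g \<in> B"
      by (rule subring_mult[OF L subring_mult[OF L J_monomial(2) J_monomial(1)] hg(2)])
    have "\<exists>g'\<in>B. h = (1 + lmonom J x (ex k)) * g'"
    proof (rule coprime_binomials[OF K _ _ exJ exJ _ _ hg(1) mem eq])
      show "lindep K J x" by (rule lindep_mono[OF good_seedD(3)[OF s]]) auto
      show "(\<Sum>i\<in>J. wt i * ex k i) = 0" unfolding sum_ex by (rule orth)
      show "(\<Sum>i\<in>J. wt i * ex j i) > 0" unfolding sum_ex by (rule pos)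
    qed simp
    then obtain g' where g': "g' \<in> B" "h = (1 + lmonom J x (ex k)) * g'" by (elim bexE)
    then have "h = exchange N q x k * (inverse ?mk * g')"
      using J_monomial(3)[of "\<lambda>i. q k i"] by (simp add: binom)
    moreover have "inverse ?mk * g' \<in> B" by (rule subring_mult[OF L J_monomial(2) g'(1)])
    ultimately show ?thesis by (rule rev_bexI[rotated])
  qed
  have mem: "exchange N q x l \<in> B" if "l \<in> {j, k}" for l
    unfolding P[OF that] by (intro subring_add[OF laurent_ring_subring] J_monomial)
  let ?C = "gen (B \<union> {x k, inverse (x k)})"
  note E = frac_subring[OF gen_subring, of "B \<union> {x k, inverse (x k)}"]
  have CE: "?C \<subseteq> fracs ?C" by (rule frac_incl[OF gen_subring])
  have yk: "yk \<in> fracs ?C"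
  proof (rule fracsI)
    show "exchange N q x k \<in> ?C" using mem[of k] by (auto intro: gen_incl)
    show "x k \<in> ?C" by (rule gen_incl) simp
  qed (rule xk)
  have "B \<subseteq> ?C" by (auto intro: gen_incl)
  then have DE: "gen (B \<union> {yk, inverse yk}) \<subseteq> fracs ?C"
    using CE yk frac_inverse[OF gen_subring yk] by (intro gen_least[OF E] insert2_subset) auto
  have f3: "f \<in> gen (gen (B \<union> {yk, inverse yk}) \<union> {x j, inverse (x j)})"
  proof -
    have "B \<union> {yk, inverse yk} \<union> {x j, inverse (x j)} = B \<union> {yk, inverse yk, x j, inverse (x j)}" by blast
    then show ?thesis using f(3) unfolding cluster_rings(3) gen_gen by simp
  qed
  have "f \<in> gen (B \<union> {yk, inverse yk, yj, inverse yj})"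
    by (rule rank2_disconnected[OF laurent_ring_subring xk xj mem _ mem _ HOL.refl HOL.refl reg transc_k E
          transc_frac[OF gen_subring transc_j] CE DE f(1)[unfolded cluster_rings(1)]
          f(2)[unfolded cluster_rings(2)] f3])
      (use good_exchange_nonzero[OF K s] j k in auto)
  then show ?thesis unfolding cluster_rings(4) zj .
qed

end

lemma laurent_mono: "Y \<subseteq> Z \<Longrightarrow> laurent_ring K Y \<subseteq> laurent_ring K Z"
  unfolding laurent_ring_def by (rule gen_mono') auto

definition upper_bound :: "'f::field set \<Rightarrow> nat \<Rightarrow> 'f seed \<Rightarrow> 'f set" where
  "upper_bound K N s = cluster_ring K N s \<inter> (\<Inter>l\<in>{1..N} - frozen s. cluster_ring K N (mutate_seed N l s))"

lemma upper_bound_subset: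
  assumes K: "subring K ambient" and s: "good_seed K N s" and fr: "full_rank N s" and k: "k \<in> {1..N} - frozen s"
  shows "upper_bound K N s \<subseteq> upper_bound K N (mutate_seed N k s)"
proof
  fix f assume f: "f \<in> upper_bound K N s"
  then have fs: "f \<in> cluster_ring K N s"
    and fl: "\<And>l. l \<in> {1..N} - frozen s \<Longrightarrow> f \<in> cluster_ring K N (mutate_seed N l s)"
    unfolding upper_bound_def by simp_all
  have q: "is_quiver N (arrows s)" "is_quiver N (arrows (mutate_seed N k s))"
    using good_seedD(1)[OF s] good_seedD(1)[OF good_mutate[OF K s k]] by simp_all
  have "f \<in> cluster_ring K N (mutate_seed N j (mutate_seed N k s))" if j: "j \<in> {1..N} - frozen s" for j
  proof (cases "j = k")
    case True
    then show ?thesis using mutate_seed_involutive[OF s K k] fs by simp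
  next
    case False
    consider "arrows s k j > 0" | "arrows s j k > 0" | "arrows s k j = 0" "arrows s j k = 0" by blast
    then show ?thesis
    proof cases
      case 1
      show ?thesis by (rule mutation_pair.step_connected[OF mutation_pair.intro[OF K s j k False] 1 fs fl[OF j] fl[OF k]])
    next
      case 2
      have "f \<in> cluster_ring K N (mutate_seed N j (mutate_seed N k (opposite s)))"
      proof (rule mutation_pair.step_connected)
        show "mutation_pair K N (opposite s) j k"
          by (rule mutation_pair.intro[OF K good_opposite[OF s]]) (use j k False in simp_all)
        show "arrows (opposite s) k j > 0" using 2 by simp
        show "f \<in> cluster_ring K N (opposite s)" using fs by simp
        show "f \<in> cluster_ring K N (mutate_seed N j (opposite s))" unfolding cvar_mutate_opposite by (rule fl[OF j])
        show "f \<in> cluster_ring K N (mutate_seed N k (opposite s))" unfolding cvar_mutate_opposite by (rule fl[OF k])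
      qed
      then show ?thesis unfolding mutate_opposite[OF q(1)] cvar_mutate_opposite .
    next
      case 3
      show ?thesis by (rule mutation_pair.step_disconnected[OF mutation_pair.intro[OF K s j k False] 3 fr fs fl[OF j] fl[OF k]])
    qed
  qed
  then show "f \<in> upper_bound K N (mutate_seed N k s)"
    using fl[OF k] unfolding upper_bound_def mutate_seed_simps(2) by blast
qed

lemma mutation_equivalent_invariants:
  assumes K: "subring K ambient" and s: "good_seed K N s" and st: "mutation_equivalent N s t"
  shows "good_seed K N t \<and> frozen t = frozen s \<and>
    (full_rank N s \<longrightarrow> full_rank N t \<and> upper_bound K N t = upper_bound K N s)"
  using st
proof (induction rule: mutation_equivalent.induct)
  case refl
  show ?case using s by blast
next
  case (step t l)
  have t: "good_seed K N t" and l: "l \<in> {1..N} - frozen t" using step by blast+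
  have good: "good_seed K N (mutate_seed N l t)" by (rule good_mutate[OF K t l])
  have "full_rank N (mutate_seed N l t) \<and> upper_bound K N (mutate_seed N l t) = upper_bound K N s"
    if "full_rank N s"
  proof -
    have fr: "full_rank N t" and eq: "upper_bound K N t = upper_bound K N s" using step.IH that by blast+
    have fr': "full_rank N (mutate_seed N l t)" by (rule full_rank_mutate[OF good_seedD(1)[OF t] fr l])
    have l': "l \<in> {1..N} - frozen (mutate_seed N l t)" using l by simp
    show ?thesis
      using upper_bound_subset[OF K t fr l] upper_bound_subset[OF K good fr' l']
      unfolding mutate_seed_involutive[OF t K l] eq[symmetric] using fr' by blast
  qed
  then show ?case using good step.IH by simp
qed

lemma cvar_upper_bound:
  assumes K: "subring K ambient" and s: "good_seed K N s" and i: "i \<in> {1..N}"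
  shows "cvar s i \<in> upper_bound K N s"
  unfolding upper_bound_def
proof (intro IntI INT_I)
  show "cvar s i \<in> cluster_ring K N s" using i by (intro laurent_var) auto
  fix l assume l: "l \<in> {1..N} - frozen s"
  let ?y = "cvar (mutate_seed N l s)" and ?P = "exchange N (arrows s) (cvar s) l"
  show "cvar s i \<in> cluster_ring K N (mutate_seed N l s)"
  proof (cases "i = l")
    case False
    have "?y i \<in> cluster_ring K N (mutate_seed N l s)" by (rule laurent_var) (rule imageI[OF i])
    then show ?thesis using False by simp
  next
    case True
    have "cvar s ` ({1..N} - {l}) = ?y ` ({1..N} - {l})" by auto
    then have "?P \<in> laurent_ring K (?y ` ({1..N} - {l}))"
      using exchange_mem[OF good_seedD(1)[OF s], of "cvar s" l K] by simp
    then have "?P \<in> cluster_ring K N (mutate_seed N l s)"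
      using laurent_mono[of "?y ` ({1..N} - {l})" "?y ` {1..N}" K] by blast
    moreover have "inverse (?y l) \<in> cluster_ring K N (mutate_seed N l s)"
      using l by (intro laurent_inverse) blast
    moreover have "cvar s i = ?P * inverse (?y l)"
      using True good_exchange_nonzero[OF K s l] by (simp add: field_simps)
    ultimately show ?thesis by (simp only: subring_mult[OF laurent_ring_subring])
  qed
qed

theorem laurent_phenomenon_full_rank:
  assumes K: "subring K ambient" and s: "good_seed K N s" and fr: "full_rank N s"
    and t: "mutation_equivalent N s t" and t': "mutation_equivalent N s t'" and i: "i \<in> {1..N}"
  shows "cvar t i \<in> cluster_ring K N t'"
proof -
  note inv = mutation_equivalent_invariants[OF K s]
  have "cvar t i \<in> upper_bound K N t" by (rule cvar_upper_bound[OF K conjunct1[OF inv[OF t]] i])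
  also have "upper_bound K N t = upper_bound K N s" using inv[OF t] fr by blast
  also have "\<dots> = upper_bound K N t'" using inv[OF t'] fr by blast
  finally show ?thesis by (simp add: upper_bound_def)
qed

section \<open>Principal coefficients and the Laurent phenomenon\<close>

type_synonym 'f ext = "((nat \<Rightarrow>\<^sub>0 nat) \<Rightarrow>\<^sub>0 'f) fract"

definition embed :: "'f::field \<Rightarrow> 'f ext" where
  "embed a = Fract (Poly_Mapping.single 0 a) 1"

definition coefficient_var :: "nat \<Rightarrow> 'f::field ext" where
  "coefficient_var i = Fract (Poly_Mapping.single (Poly_Mapping.single i 1) 1) 1"

definition eval_one :: "((nat \<Rightarrow>\<^sub>0 nat) \<Rightarrow>\<^sub>0 'f::field) \<Rightarrow> 'f" where
  "eval_one p = (\<Sum>m\<in>Poly_Mapping.keys p. Poly_Mapping.lookup p m)"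

lemma poly_mapping_sum_singles:
  fixes p :: "'a \<Rightarrow>\<^sub>0 'b::comm_monoid_add"
  shows "p = (\<Sum>m\<in>Poly_Mapping.keys p. Poly_Mapping.single m (Poly_Mapping.lookup p m))"
proof (rule poly_mapping_eqI)
  fix k
  show "Poly_Mapping.lookup p k =
      Poly_Mapping.lookup (\<Sum>m\<in>Poly_Mapping.keys p. Poly_Mapping.single m (Poly_Mapping.lookup p m)) k"
    by (cases "k \<in> Poly_Mapping.keys p")
      (simp_all add: lookup_sum lookup_single when_def in_keys_iff)
qed

lemma eval_one_superset: "finite A \<Longrightarrow> Poly_Mapping.keys p \<subseteq> A \<Longrightarrow> eval_one p = (\<Sum>m\<in>A. Poly_Mapping.lookup p m)"
  unfolding eval_one_def by (rule sum.mono_neutral_left) (auto simp: in_keys_iff)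

lemma eval_one_add: "eval_one (p + q) = eval_one p + eval_one q"
proof -
  let ?A = "Poly_Mapping.keys p \<union> Poly_Mapping.keys q"
  have "finite ?A" by simp
  then show ?thesis
    using eval_one_superset[of ?A "p + q"] eval_one_superset[of ?A p] eval_one_superset[of ?A q] keys_add[of p q]
    by (simp add: lookup_add sum.distrib)
qed

lemma eval_one_single [simp]: "eval_one (Poly_Mapping.single m a) = a"
  by (simp add: eval_one_def)

lemma eval_one_zero [simp]: "eval_one 0 = 0" and eval_one_one [simp]: "eval_one 1 = 1"
  using eval_one_single[of 0 1] by (simp_all add: eval_one_def)

lemma eval_one_sum: "eval_one (sum f A) = (\<Sum>a\<in>A. eval_one (f a))"
  by (induction A rule: infinite_finite_induct) (simp_all add: eval_one_add)

lemma eval_one_mult: "eval_one (p * q) = eval_one p * eval_one q"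
proof -
  have "eval_one (p * q) = eval_one ((\<Sum>m\<in>Poly_Mapping.keys p. Poly_Mapping.single m (Poly_Mapping.lookup p m)) *
      (\<Sum>m\<in>Poly_Mapping.keys q. Poly_Mapping.single m (Poly_Mapping.lookup q m)))"
    by (simp only: poly_mapping_sum_singles[symmetric])
  also have "\<dots> = eval_one p * eval_one q"
    by (simp only: sum_product mult_single eval_one_sum eval_one_single) (simp only: eval_one_def sum_product)
  finally show ?thesis .
qed

lemma eval_one_uminus: "eval_one (- p) = - eval_one p"
proof -
  have "eval_one p + eval_one (- p) = 0" unfolding eval_one_add[symmetric] by simp
  then show ?thesis by (rule minus_unique[symmetric])
qed

text \<open>The specialization of all coefficient variables to \<open>1\<close>.\<close>

definition specializes :: "'f::field ext \<Rightarrow> 'f \<Rightarrow> bool" where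
  "specializes f r \<longleftrightarrow> (\<exists>p q. f = Fract p q \<and> eval_one q \<noteq> 0 \<and> r = eval_one p / eval_one q)"

lemma specializes_unique:
  assumes "specializes f r" "specializes f r'" shows "r = r'"
proof -
  obtain p q where p: "f = Fract p q" "eval_one q \<noteq> 0" "r = eval_one p / eval_one q"
    using assms(1) unfolding specializes_def by blast
  obtain p' q' where p': "f = Fract p' q'" "eval_one q' \<noteq> 0" "r' = eval_one p' / eval_one q'"
    using assms(2) unfolding specializes_def by blast
  have "q \<noteq> 0" "q' \<noteq> 0" using p(2) p'(2) by auto
  then have "p * q' = p' * q" using p(1) p'(1) by (simp add: eq_fract)
  then have "eval_one p * eval_one q' = eval_one p' * eval_one q"
    by (simp only: eval_one_mult[symmetric])
  then show ?thesis using p p' by (simp add: frac_eq_eq)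
qed

lemma specializes_embed: "specializes (embed a) a"
  unfolding specializes_def embed_def by (intro exI[of _ "Poly_Mapping.single 0 a"] exI[of _ 1]) simp

lemma specializes_coefficient: "specializes (coefficient_var i) 1"
  unfolding specializes_def coefficient_var_def
  by (intro exI[of _ "Poly_Mapping.single (Poly_Mapping.single i 1) 1"] exI[of _ 1]) simp

lemma specializes_add:
  assumes "specializes f r" "specializes g t" shows "specializes (f + g) (r + t)"
proof -
  obtain p q where p: "f = Fract p q" "eval_one q \<noteq> 0" "r = eval_one p / eval_one q"
    using assms(1) unfolding specializes_def by blast
  obtain p' q' where p': "g = Fract p' q'" "eval_one q' \<noteq> 0" "t = eval_one p' / eval_one q'"
    using assms(2) unfolding specializes_def by blast
  have "q \<noteq> 0" "q' \<noteq> 0" using p(2) p'(2) by auto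
  then have "f + g = Fract (p * q' + p' * q) (q * q')" using p(1) p'(1) by simp
  then show ?thesis
    unfolding specializes_def using p p'
    by (intro exI[of _ "p * q' + p' * q"] exI[of _ "q * q'"])
      (simp add: eval_one_add eval_one_mult add_frac_eq)
qed

lemma specializes_mult:
  assumes "specializes f r" "specializes g t" shows "specializes (f * g) (r * t)"
proof -
  obtain p q where p: "f = Fract p q" "eval_one q \<noteq> 0" "r = eval_one p / eval_one q"
    using assms(1) unfolding specializes_def by blast
  obtain p' q' where p': "g = Fract p' q'" "eval_one q' \<noteq> 0" "t = eval_one p' / eval_one q'"
    using assms(2) unfolding specializes_def by blast
  show ?thesis
    unfolding specializes_def using p p'
    by (intro exI[of _ "p * p'"] exI[of _ "q * q'"]) (simp add: eval_one_mult)
qed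

lemma specializes_uminus:
  assumes "specializes f r" shows "specializes (- f) (- r)"
proof -
  obtain p q where p: "f = Fract p q" "eval_one q \<noteq> 0" "r = eval_one p / eval_one q"
    using assms(1) unfolding specializes_def by blast
  then show ?thesis
    unfolding specializes_def by (intro exI[of _ "- p"] exI[of _ q]) (simp add: eval_one_uminus)
qed

lemma specializes_inverse:
  assumes "specializes f r" "r \<noteq> 0" shows "specializes (inverse f) (inverse r)"
proof -
  obtain p q where p: "f = Fract p q" "eval_one q \<noteq> 0" "r = eval_one p / eval_one q"
    using assms(1) unfolding specializes_def by blast
  then show ?thesis
    using assms(2) unfolding specializes_def by (intro exI[of _ q] exI[of _ p]) simp
qed

lemma embed_one [simp]: "embed 1 = 1" and embed_zero [simp]: "embed 0 = 0"
  by (simp_all add: embed_def One_fract_def Zero_fract_def)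

lemma specializes_one: "specializes 1 1"
  using specializes_embed[of 1] by simp

lemma specializes_power: "specializes f r \<Longrightarrow> specializes (f ^ e) (r ^ e)"
  by (induction e) (simp_all add: specializes_one specializes_mult)

lemma specializes_prod: "(\<And>i. i \<in> A \<Longrightarrow> specializes (f i) (r i)) \<Longrightarrow> specializes (prod f A) (prod r A)"
  by (induction A rule: infinite_finite_induct) (simp_all add: specializes_one specializes_mult)

lemma specializes_laurent:
  assumes Y: "\<And>y. y \<in> Y' \<Longrightarrow> \<exists>r. specializes y r \<and> r \<noteq> 0 \<and> r \<in> insert 1 Y"
    and f: "f \<in> laurent_ring (embed ` K) Y'"
  shows "\<exists>r. specializes f r \<and> r \<in> laurent_ring K Y"
  using f unfolding laurent_ring_def
proof (induction rule: generate_ring.induct)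
  case one
  then show ?case using specializes_one gen_closed(1) by auto
next
  case (incl h)
  have mem: "r \<in> gen (K \<union> Y \<union> inverse ` Y)" "inverse r \<in> gen (K \<union> Y \<union> inverse ` Y)" if "r \<in> insert 1 Y" for r
    using that gen_closed(1)[of "K \<union> Y \<union> inverse ` Y"] by (auto intro: gen_incl)
  consider a where "a \<in> K" "h = embed a" | "h \<in> Y'" | y where "y \<in> Y'" "h = inverse y" using incl by blast
  then show ?case
  proof cases
    case 1
    have "specializes h a" "a \<in> gen (K \<union> Y \<union> inverse ` Y)"
      using 1 specializes_embed by (auto intro: gen_incl)
    then show ?thesis by (intro exI conjI)
  next
    case 2
    then obtain r where "specializes h r" "r \<in> insert 1 Y" using Y by blast
    then show ?thesis using mem(1)[of r] by (intro exI conjI)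
  next
    case 3
    then obtain r where "specializes y r" "r \<noteq> 0" "r \<in> insert 1 Y" using Y by blast
    then have "specializes h (inverse r)" "inverse r \<in> gen (K \<union> Y \<union> inverse ` Y)"
      using specializes_inverse[of y r] mem(2)[of r] 3(2) by simp_all
    then show ?thesis by (intro exI conjI)
  qed
next
  case (a_inv h)
  then obtain r where r: "specializes h r" "r \<in> gen (K \<union> Y \<union> inverse ` Y)" by (elim exE conjE)
  have "specializes (\<ominus>\<^bsub>ambient\<^esub> h) (- r)" using specializes_uminus[OF r(1)] by simp
  then show ?case using gen_closed(2)[OF r(2)] by (intro exI conjI)
next
  case (eng_add h1 h2)
  then obtain r1 r2 where r: "specializes h1 r1" "r1 \<in> gen (K \<union> Y \<union> inverse ` Y)"
    "specializes h2 r2" "r2 \<in> gen (K \<union> Y \<union> inverse ` Y)" by (elim exE conjE)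
  have "specializes (h1 \<oplus>\<^bsub>ambient\<^esub> h2) (r1 + r2)" using specializes_add[OF r(1,3)] by simp
  then show ?case using gen_closed(3)[OF r(2,4)] by (intro exI conjI)
next
  case (eng_mult h1 h2)
  then obtain r1 r2 where r: "specializes h1 r1" "r1 \<in> gen (K \<union> Y \<union> inverse ` Y)"
    "specializes h2 r2" "r2 \<in> gen (K \<union> Y \<union> inverse ` Y)" by (elim exE conjE)
  have "specializes (h1 \<otimes>\<^bsub>ambient\<^esub> h2) (r1 * r2)" using specializes_mult[OF r(1,3)] by simp
  then show ?case using gen_closed(4)[OF r(2,4)] by (intro exI conjI)
qed

lemma embed_add: "embed (a + b) = embed a + embed b"
  and embed_mult: "embed (a * b) = embed a * embed b"
  and embed_uminus: "embed (- a) = - embed a"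
  by (simp_all add: embed_def single_add mult_single single_uminus)

lemma embed_inject: "embed a = embed b \<Longrightarrow> a = b"
  using specializes_unique[OF specializes_embed[of a]] specializes_embed[of b] by metis

lemma embed_inverse: "embed (inverse a) = inverse (embed a)"
proof (cases "a = 0")
  case False
  then have "embed a * embed (inverse a) = 1" by (simp add: embed_mult[symmetric])
  then show ?thesis by (rule inverse_unique[symmetric])
qed simp

lemma embed_power: "embed (a ^ e) = embed a ^ e"
  by (induction e) (simp_all add: embed_mult)

lemma embed_powi: "embed (a powi e) = embed a powi e"
  by (simp add: power_int_def embed_power embed_inverse)

lemma embed_sum: "embed (sum f A) = (\<Sum>a\<in>A. embed (f a))"
  by (induction A rule: infinite_finite_induct) (simp_all add: embed_add)

lemma embed_prod: "embed (prod f A) = (\<Prod>a\<in>A. embed (f a))"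
  by (induction A rule: infinite_finite_induct) (simp_all add: embed_mult)

lemma embed_subring: "subring K ambient \<Longrightarrow> subring (embed ` K) ambient"
  unfolding subring_ambient_iff
  by (auto simp: embed_add[symmetric] embed_mult[symmetric] embed_uminus[symmetric] image_iff
      intro: bexI[of _ 1])

lemma lindep_embed:
  assumes x: "lindep K I x" shows "lindep (embed ` K) I (\<lambda>i. embed (x i))"
  unfolding lindep_def
proof (intro conjI ballI allI impI)
  show "embed (x i) \<noteq> 0" if "i \<in> I" for i
    using lindep_nonzero[OF x that] embed_inject[of "x i" 0] by auto
  fix A c m
  assume A: "finite A \<and> A \<subseteq> exponents I \<and> (\<forall>m\<in>A. c m \<in> embed ` K) \<and> (\<Sum>m\<in>A. c m * lmonom I (\<lambda>i. embed (x i)) m) = 0"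
    and m: "m \<in> A"
  have "\<forall>m\<in>A. \<exists>d. d \<in> K \<and> c m = embed d" using A by blast
  then obtain d where d: "\<And>m. m \<in> A \<Longrightarrow> d m \<in> K" "\<And>m. m \<in> A \<Longrightarrow> c m = embed (d m)" by metis
  have mon: "lmonom I (\<lambda>i. embed (x i)) m = embed (lmonom I x m)" for m
    unfolding lmonom_def embed_prod embed_powi ..
  have "embed (\<Sum>m\<in>A. d m * lmonom I x m) = (\<Sum>m\<in>A. c m * lmonom I (\<lambda>i. embed (x i)) m)"
    unfolding embed_sum embed_mult mon by (rule sum.cong) (simp_all only: d(2))
  also have "\<dots> = embed 0" using A by simp
  finally have sum0: "(\<Sum>m\<in>A. d m * lmonom I x m) = 0" by (rule embed_inject)
  have "d m = 0" by (rule lindepD[OF x conjunct1[OF A] conjunct1[OF conjunct2[OF A]] d(1) sum0 m])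
  then show "c m = 0" using d m by simp
qed

text \<open>Polynomials that do not involve the variable \<open>k\<close>.\<close>

definition free_of :: "nat \<Rightarrow> 'f::field ext set" where
  "free_of k = {Fract p 1 | p. \<forall>m\<in>Poly_Mapping.keys p. Poly_Mapping.lookup m k = 0}"

lemma free_ofI: "(\<And>m. m \<in> Poly_Mapping.keys p \<Longrightarrow> Poly_Mapping.lookup m k = 0) \<Longrightarrow> Fract p 1 \<in> free_of k"
  unfolding free_of_def by blast

lemma free_of_subring: "subring (free_of k) ambient"
  unfolding subring_ambient_iff
proof (intro conjI ballI)
  show "1 \<in> free_of k"
    unfolding One_fract_def by (rule free_ofI) (simp flip: single_one)
next
  fix f :: "'a ext" assume "f \<in> free_of k"
  then obtain p where p: "f = Fract p 1" "\<And>m. m \<in> Poly_Mapping.keys p \<Longrightarrow> Poly_Mapping.lookup m k = 0"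
    unfolding free_of_def by blast
  have "- f = Fract (- p) 1" by (simp add: p)
  also have "\<dots> \<in> free_of k" by (rule free_ofI) (use p(2) in \<open>simp add: in_keys_iff\<close>)
  finally show "- f \<in> free_of k" .
next
  fix f g :: "'a ext" assume "f \<in> free_of k" "g \<in> free_of k"
  then obtain p q where p: "f = Fract p 1" "\<And>m. m \<in> Poly_Mapping.keys p \<Longrightarrow> Poly_Mapping.lookup m k = 0"
    and q: "g = Fract q 1" "\<And>m. m \<in> Poly_Mapping.keys q \<Longrightarrow> Poly_Mapping.lookup m k = 0"
    unfolding free_of_def by blast
  have "f + g = Fract (p + q) 1" by (simp add: p q)
  also have "\<dots> \<in> free_of k" by (rule free_ofI) (use p(2) q(2) keys_add[of p q] in blast)
  finally show "f + g \<in> free_of k" .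
  have "f * g = Fract (p * q) 1" by (simp add: p q)
  also have "\<dots> \<in> free_of k"
    by (rule free_ofI) (use p(2) q(2) keys_mult[of p q] in \<open>fastforce simp: lookup_add\<close>)
  finally show "f * g \<in> free_of k" .
qed

lemma transc_coefficient_var: "transc (free_of k) (coefficient_var k :: 'f::field ext)"
  unfolding transc_def
proof (intro allI impI, elim conjE)
  fix P :: "'f ext poly" assume co: "\<forall>i. coeff P i \<in> free_of k" and root: "poly P (coefficient_var k) = 0"
  have "\<forall>i. \<exists>p. coeff P i = Fract p 1 \<and> (\<forall>m\<in>Poly_Mapping.keys p. Poly_Mapping.lookup m k = 0)"
    using co unfolding free_of_def by blast
  then obtain p where p: "\<And>i. coeff P i = Fract (p i) 1"
    "\<And>i m. m \<in> Poly_Mapping.keys (p i) \<Longrightarrow> Poly_Mapping.lookup m k = 0" by metis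
  define v where "v i = Poly_Mapping.single k i" for i :: nat
  have pow: "coefficient_var k ^ i = (Fract (Poly_Mapping.single (v i) 1) 1 :: 'f ext)" for i
  proof (induction i)
    case (Suc i)
    have "v 1 + v i = v (Suc i)" by (simp add: v_def single_add[symmetric])
    then show ?case using Suc by (simp add: coefficient_var_def mult_single flip: v_def)
  qed (simp add: v_def One_fract_def)
  have fsum: "Fract (sum g A) 1 = (\<Sum>a\<in>A. Fract (g a) 1)" for g :: "nat \<Rightarrow> (nat \<Rightarrow>\<^sub>0 nat) \<Rightarrow>\<^sub>0 'f" and A
  proof (induction A rule: infinite_finite_induct)
    case (insert a A)
    have "Fract (g a + sum g A) 1 = Fract (g a) 1 + Fract (sum g A) 1" by simp
    then show ?case using insert by simp
  qed (simp_all add: Zero_fract_def)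
  have "0 = (\<Sum>i\<le>degree P. Fract (p i * Poly_Mapping.single (v i) 1) 1 :: 'f ext)"
    using root by (simp add: poly_altdef p(1) pow)
  then have "Fract (\<Sum>i\<le>degree P. p i * Poly_Mapping.single (v i) 1) 1 = (0 :: 'f ext)" by (simp only: fsum)
  then have zero: "(\<Sum>i\<le>degree P. p i * Poly_Mapping.single (v i) 1) = 0"
    by (simp add: Zero_fract_def eq_fract)
  have prod: "p i * Poly_Mapping.single (v i) 1 =
      (\<Sum>m\<in>Poly_Mapping.keys (p i). Poly_Mapping.single (m + v i) (Poly_Mapping.lookup (p i) m))" for i
    by (subst poly_mapping_sum_singles[of "p i"]) (simp only: sum_distrib_right mult_single mult_1_right)
  have "Poly_Mapping.lookup (p i) m = 0" if i: "i \<le> degree P" for i m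
  proof (rule ccontr)
    assume nz: "Poly_Mapping.lookup (p i) m \<noteq> 0"
    then have m: "m \<in> Poly_Mapping.keys (p i)" by (simp add: in_keys_iff)
    have eq: "(m' + v j = m + v i) \<longleftrightarrow> j = i \<and> m' = m" if "m' \<in> Poly_Mapping.keys (p j)" for m' j
    proof
      assume e: "m' + v j = m + v i"
      have "j = i" using arg_cong[OF e, of "\<lambda>t. Poly_Mapping.lookup t k"] p(2)[OF m] p(2)[OF that]
        by (simp add: lookup_add v_def)
      then show "j = i \<and> m' = m" using e by simp
    qed auto
    have "Poly_Mapping.lookup (p j * Poly_Mapping.single (v j) 1) (m + v i) =
        (if j = i then Poly_Mapping.lookup (p i) m else 0)" for j
    proof -
      have "Poly_Mapping.lookup (p j * Poly_Mapping.single (v j) 1) (m + v i) =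
          (\<Sum>m'\<in>Poly_Mapping.keys (p j). if j = i \<and> m' = m then Poly_Mapping.lookup (p j) m' else 0)"
        unfolding prod lookup_sum lookup_single when_def by (rule sum.cong) (simp_all add: eq)
      also have "\<dots> = (if j = i then Poly_Mapping.lookup (p i) m else 0)" using m by (cases "j = i") simp_all
      finally show ?thesis .
    qed
    then have "Poly_Mapping.lookup (\<Sum>j\<le>degree P. p j * Poly_Mapping.single (v j) 1) (m + v i) =
        Poly_Mapping.lookup (p i) m"
      using i by (simp add: lookup_sum)
    then show False using nz zero by simp
  qed
  then have "p i = 0" if "i \<le> degree P" for i using that by (intro poly_mapping_eqI) simp
  then have "coeff P i = 0" if "i \<le> degree P" for i using that by (simp add: p(1) Zero_fract_def)
  then show "P = 0" by (metis leading_coeff_0_iff order_refl)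
qed

lemma alg_independent_lindep:
  assumes K: "subring K ambient" and I: "finite I" and x: "alg_independent K I x"
  shows "lindep K I x"
  unfolding lindep_def
proof (intro conjI ballI allI impI)
  have indep: "p = 0"
    if "\<And>m. Poly_Mapping.lookup p m \<in> K" "\<And>m. m \<in> Poly_Mapping.keys p \<Longrightarrow> Poly_Mapping.keys m \<subseteq> I"
      "(\<Sum>m \<in> Poly_Mapping.keys p. Poly_Mapping.lookup p m *
           (\<Prod>i \<in> Poly_Mapping.keys m. x i ^ Poly_Mapping.lookup m i)) = 0" for p
    using x that unfolding alg_independent_def by blast
  show nz: "x i \<noteq> 0" if i: "i \<in> I" for i
  proof
    assume zero: "x i = 0"
    let ?m = "Poly_Mapping.single i (1 :: nat)"
    have "Poly_Mapping.single ?m (1 :: 'a) = 0"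
      by (rule indep)
        (use i zero subring_zero[OF K] subring_one[OF K] in \<open>auto simp: lookup_single when_def split: if_splits\<close>)
    then show False by (metis lookup_single_eq lookup_zero zero_neq_one)
  qed
  fix A c m0
  assume A: "finite A \<and> A \<subseteq> exponents I \<and> (\<forall>m\<in>A. c m \<in> K) \<and> (\<Sum>m\<in>A. c m * lmonom I x m) = 0" and m0: "m0 \<in> A"
  \<comment> \<open>Multiplying by a high power of all the variables makes the exponents nonnegative.\<close>
  define M where "M = (\<Sum>m\<in>A. \<Sum>i\<in>I. nat \<bar>m i\<bar>)"
  have M: "\<bar>m i\<bar> \<le> int M" if "m \<in> A" "i \<in> I" for m i
  proof -
    have "nat \<bar>m i\<bar> \<le> (\<Sum>i\<in>I. nat \<bar>m i\<bar>)" by (rule member_le_sum) (use that I in auto)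
    also have "\<dots> \<le> M" unfolding M_def
      by (rule member_le_sum[of m A "\<lambda>m. \<Sum>i\<in>I. nat \<bar>m i\<bar>"]) (use that A in auto)
    finally show ?thesis by linarith
  qed
  define e where "e m = (\<lambda>i. if i \<in> I then nat (m i + int M) else 0)" for m :: "nat \<Rightarrow> int"
  define h where "h m = Abs_poly_mapping (e m)" for m
  have "finite {i. e m i \<noteq> 0}" for m by (rule finite_subset[OF _ I]) (auto simp: e_def)
  then have lh: "Poly_Mapping.lookup (h m) = e m" for m by (simp add: h_def)
  have inj: "inj_on h A"
  proof (rule inj_onI)
    fix m m' assume m: "m \<in> A" "m' \<in> A" "h m = h m'"
    then have eq: "e m = e m'" by (metis lh)
    have "m i = m' i" for i
    proof (cases "i \<in> I")
      case True
      then show ?thesis using fun_cong[OF eq, of i] M[OF m(1) True] M[OF m(2) True] by (simp add: e_def)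
    next
      case False
      have "m \<in> exponents I" "m' \<in> exponents I" using A m(1,2) by blast+
      then show ?thesis using False by (simp add: exponents_def)
    qed
    then show "m = m'" by (rule ext)
  qed
  define p where "p = (\<Sum>m\<in>A. Poly_Mapping.single (h m) (c m))"
  have lp: "Poly_Mapping.lookup p k = (\<Sum>m\<in>A. if h m = k then c m else 0)" for k
    by (simp add: p_def lookup_sum lookup_single when_def)
  have lph: "Poly_Mapping.lookup p (h m) = c m" if "m \<in> A" for m
  proof -
    have "Poly_Mapping.lookup p (h m) = (\<Sum>m'\<in>A. if m' = m then c m' else 0)"
      unfolding lp by (rule sum.cong) (use inj_on_eq_iff[OF inj _ that] in auto)
    then show ?thesis using that A by simp
  qed
  have keys: "Poly_Mapping.keys p \<subseteq> h ` A"
  proof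
    fix k assume "k \<in> Poly_Mapping.keys p"
    then have "(\<Sum>m\<in>A. if h m = k then c m else 0) \<noteq> 0" by (simp add: in_keys_iff lp)
    moreover have "(\<Sum>m\<in>A. if h m = k then c m else 0) = 0" if "k \<notin> h ` A"
      by (rule sum.neutral) (use that in auto)
    ultimately show "k \<in> h ` A" by blast
  qed
  have keys_h: "Poly_Mapping.keys (h m) \<subseteq> I" for m by (auto simp: in_keys_iff lh e_def split: if_splits)
  have mon: "(\<Prod>i\<in>Poly_Mapping.keys (h m). x i ^ Poly_Mapping.lookup (h m) i) = (\<Prod>i\<in>I. x i) ^ M * lmonom I x m"
    if m: "m \<in> A" for m
  proof -
    have "(\<Prod>i\<in>Poly_Mapping.keys (h m). x i ^ Poly_Mapping.lookup (h m) i) = (\<Prod>i\<in>I. x i ^ Poly_Mapping.lookup (h m) i)"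
      by (rule prod.mono_neutral_left) (use I keys_h in \<open>auto simp: in_keys_iff\<close>)
    also have "\<dots> = (\<Prod>i\<in>I. x i ^ M * x i powi m i)"
    proof (rule prod.cong)
      fix i assume i: "i \<in> I"
      have "int (e m i) = int M + m i" using M[OF m i] i by (simp add: e_def)
      then have "x i ^ e m i = x i powi (int M + m i)"
        using power_int_of_nat[of "x i" "e m i"] by simp
      then show "x i ^ Poly_Mapping.lookup (h m) i = x i ^ M * x i powi m i"
        using nz[OF i] by (simp add: lh power_int_add)
    qed simp
    finally show ?thesis by (simp add: prod.distrib lmonom_def prod_power_distrib)
  qed
  have "p = 0"
  proof (rule indep)
    show "Poly_Mapping.lookup p k \<in> K" for k
      unfolding lp using A by (intro subring_sum[OF K]) (simp add: subring_zero[OF K])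
    show "Poly_Mapping.keys k \<subseteq> I" if "k \<in> Poly_Mapping.keys p" for k using keys keys_h that by blast
    let ?t = "\<lambda>k. Poly_Mapping.lookup p k * (\<Prod>i\<in>Poly_Mapping.keys k. x i ^ Poly_Mapping.lookup k i)"
    have "sum ?t (Poly_Mapping.keys p) = sum ?t (h ` A)"
      by (rule sum.mono_neutral_left) (use A keys in \<open>auto simp: in_keys_iff\<close>)
    also have "\<dots> = (\<Sum>m\<in>A. ?t (h m))" using sum.reindex[OF inj, of ?t] by (simp add: comp_def)
    also have "\<dots> = (\<Sum>m\<in>A. (\<Prod>i\<in>I. x i) ^ M * (c m * lmonom I x m))"
      by (rule sum.cong) (simp_all add: lph mon ac_simps)
    also have "\<dots> = (\<Prod>i\<in>I. x i) ^ M * (\<Sum>m\<in>A. c m * lmonom I x m)" by (simp only: sum_distrib_left)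
    finally show "sum ?t (Poly_Mapping.keys p) = 0" using A by simp
  qed
  then show "c m0 = 0" using lph[OF m0] by simp
qed

definition principal_extension :: "nat \<Rightarrow> 'f::field seed \<Rightarrow> 'f ext seed" where
  "principal_extension n s =
     \<lparr>arrows = (\<lambda>i j. arrows s i j + (if j \<in> {1..n} \<and> i = n + j then 1 else 0)),
      frozen = frozen s \<union> {n + 1..n + n},
      cvar = (\<lambda>i. if i \<le> n then embed (cvar s i) else coefficient_var i)\<rparr>"

lemma principal_extension_simps [simp]:
  "arrows (principal_extension n s) i j = arrows s i j + (if j \<in> {1..n} \<and> i = n + j then 1 else 0)"
  "frozen (principal_extension n s) = frozen s \<union> {n + 1..n + n}"
  "cvar (principal_extension n s) i = (if i \<le> n then embed (cvar s i) else coefficient_var i)"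
  by (simp_all add: principal_extension_def)

lemma embed_free_of: "embed a \<in> free_of k"
  unfolding embed_def by (rule free_ofI) (simp split: if_splits)

lemma coefficient_var_free_of: "i \<noteq> k \<Longrightarrow> coefficient_var i \<in> free_of k"
  unfolding coefficient_var_def by (rule free_ofI) (simp add: lookup_single split: if_splits)

lemma principal_extension_lindep:
  assumes K: "subring K ambient" and x: "lindep K {1..n} (cvar s)"
  shows "lindep (embed ` K) {1..n + n} (cvar (principal_extension n s))"
proof -
  let ?x = "cvar (principal_extension n s)"
  have "lindep (embed ` K) {1..n + m} ?x" for m
  proof (induction m)
    case 0
    have "lindep (embed ` K) {1..n} ?x"
      by (rule lindep_cong[OF _ lindep_embed[OF x]]) simp
    then show ?case by (simp only: add_0_right)
  next
    case (Suc m)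
    let ?k = "n + Suc m"
    have J: "{1..?k} - {?k} = {1..n + m}" by auto
    have free: "?x i \<in> free_of ?k" if "i \<in> {1..n + m}" for i
      using that embed_free_of[of "cvar s i" ?k] coefficient_var_free_of[of i ?k] by (cases "i \<le> n") simp_all
    note F = frac_incl[OF free_of_subring, of ?k]
    have "laurent_ring (embed ` K) (?x ` {1..n + m}) \<subseteq> fracs (free_of ?k)"
      unfolding laurent_ring_def
    proof (rule gen_least[OF frac_subring[OF free_of_subring]], intro Un_least subsetI)
      show "y \<in> fracs (free_of ?k)" if "y \<in> embed ` K" for y using that F embed_free_of by blast
      show "y \<in> fracs (free_of ?k)" if "y \<in> ?x ` {1..n + m}" for y using that F free by blast
      show "y \<in> fracs (free_of ?k)" if "y \<in> inverse ` ?x ` {1..n + m}" for y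
        using that F free frac_inverse[OF free_of_subring] by blast
    qed
    from transc_mono[OF transc_frac[OF free_of_subring transc_coefficient_var[of ?k]] this]
    have tr0: "transc (laurent_ring (embed ` K) (?x ` {1..n + m})) (coefficient_var ?k)" .
    have xk: "?x ?k = coefficient_var ?k" by simp
    have tr: "transc (laurent_ring (embed ` K) (?x ` {1..n + m})) (?x ?k)" unfolding xk by (rule tr0)
    have sp: "specializes (?x ?k) 1" unfolding xk by (rule specializes_coefficient)
    have "?x ?k \<noteq> 0"
    proof
      assume "?x ?k = 0"
      then have "?x ?k = embed 0" by (simp only: embed_zero)
      then have "(1 :: 'a) = 0" using specializes_unique[OF sp, of 0] specializes_embed[of 0] by metis
      then show False by simp
    qed
    have k: "?k \<in> {1..?k}" by simp
    have "lindep (embed ` K) {1..?k} ?x"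
      by (rule lindep_extend[OF embed_subring[OF K] finite_atLeastAtMost k, unfolded J, OF Suc.IH \<open>?x ?k \<noteq> 0\<close> tr])
    then show ?case .
  qed
  then show ?thesis .
qed

lemma principal_extension_good:
  assumes K: "subring K ambient" and s: "good_seed K n s"
  shows "good_seed (embed ` K) (n + n) (principal_extension n s)"
  unfolding good_seed_def
proof (intro conjI ballI)
  have q: "arrows s i j = 0" if "i \<notin> {1..n} \<or> j \<notin> {1..n}" for i j
    using good_seedD(1)[OF s] that unfolding is_quiver_def by (metis not_gr_zero)
  have ll: "arrows s i i = 0" "arrows s i j = 0 \<or> arrows s j i = 0" for i j
    using good_seedD(1)[OF s] unfolding is_quiver_def by simp_all
  show "is_quiver (n + n) (arrows (principal_extension n s))"
    unfolding is_quiver_def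
  proof (intro conjI allI impI)
    fix i j assume "arrows (principal_extension n s) i j > 0"
    then have "arrows s i j > 0 \<or> (j \<in> {1..n} \<and> i = n + j)" by (simp split: if_splits)
    then show "i \<in> {1..n + n}" "j \<in> {1..n + n}" using q[of i j] by (cases "i \<in> {1..n}"; cases "j \<in> {1..n}"; auto)+
  next
    show "arrows (principal_extension n s) i i = 0" for i using ll by simp
    show "arrows (principal_extension n s) i j = 0 \<or> arrows (principal_extension n s) j i = 0" for i j
      using ll(2)[of i j] q[of i j] q[of j i] by (auto split: if_splits)
  qed
  show "frozen (principal_extension n s) \<subseteq> {1..n + n}" using good_seedD(2)[OF s] by auto
  show "lindep (embed ` K) {1..n + n} (cvar (principal_extension n s))"
    by (rule principal_extension_lindep[OF K good_seedD(3)[OF s]])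
  show "\<exists>i\<in>{1..n + n}. arrows (principal_extension n s) i j \<noteq> arrows (principal_extension n s) j i"
    if "j \<in> {1..n + n} - frozen (principal_extension n s)" for j
    by (rule bexI[of _ "n + j"]) (use that q[of j "n + j"] q[of "n + j" j] in auto)
qed

lemma principal_extension_full_rank:
  assumes s: "good_seed K n s"
  shows "full_rank (n + n) (principal_extension n s)"
  unfolding full_rank_def
proof (intro allI impI ballI)
  fix c :: "nat \<Rightarrow> int" and j
  let ?p = "principal_extension n s"
  assume c: "\<forall>i\<in>{1..n + n}. (\<Sum>j\<in>{1..n + n} - frozen ?p. (int (arrows ?p i j) - int (arrows ?p j i)) * c j) = 0"
    and j: "j \<in> {1..n + n} - frozen ?p"
  have q: "arrows s i j = 0" if "i \<notin> {1..n} \<or> j \<notin> {1..n}" for i j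
    using good_seedD(1)[OF s] that unfolding is_quiver_def by (metis not_gr_zero)
  have jn: "j \<in> {1..n}" using j by auto
  have "0 = (\<Sum>m\<in>{1..n + n} - frozen ?p. (int (arrows ?p (n + j) m) - int (arrows ?p m (n + j))) * c m)"
    by (rule bspec[OF c, THEN HOL.sym]) (use jn in simp)
  also have "\<dots> = (\<Sum>m\<in>{1..n + n} - frozen ?p. if m = j then c m else 0)"
  proof (rule sum.cong)
    fix m assume m: "m \<in> {1..n + n} - frozen ?p"
    then have "m \<in> {1..n}" by auto
    then show "(int (arrows ?p (n + j) m) - int (arrows ?p m (n + j))) * c m = (if m = j then c m else 0)"
      using q[of "n + j" m] q[of m "n + j"] jn by auto
  qed simp
  also have "\<dots> = c j" using j jn by (simp add: sum.delta del: principal_extension_simps)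
  finally show "c j = 0" by simp
qed

lemma mutation_lift:
  assumes K: "subring K ambient" and s: "good_seed K n s" and st: "mutation_equivalent n s t"
  shows "\<exists>t'. mutation_equivalent (n + n) (principal_extension n s) t' \<and>
    (\<forall>i\<in>{1..n}. \<forall>j\<in>{1..n}. arrows t' i j = arrows t i j) \<and>
    (\<forall>i\<in>{1..n + n}. specializes (cvar t' i) (if i \<le> n then cvar t i else 1))"
  using st
proof (induction rule: mutation_equivalent.induct)
  case refl
  show ?case
    by (rule exI[of _ "principal_extension n s"])
      (auto simp: mutation_equivalent.refl specializes_embed specializes_coefficient)
next
  case (step t l)
  then obtain t' where t': "mutation_equivalent (n + n) (principal_extension n s) t'"
    and arr: "\<And>i j. i \<in> {1..n} \<Longrightarrow> j \<in> {1..n} \<Longrightarrow> arrows t' i j = arrows t i j"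
    and spec: "\<And>i. i \<in> {1..n + n} \<Longrightarrow> specializes (cvar t' i) (if i \<le> n then cvar t i else 1)"
    by blast
  note inv = mutation_equivalent_invariants[OF K s step(1)]
  note inv' = mutation_equivalent_invariants[OF embed_subring[OF K] principal_extension_good[OF K s] t']
  note good = conjunct1[OF inv] and good' = conjunct1[OF inv']
  note fr = conjunct1[OF conjunct2[OF inv]] and fr' = conjunct1[OF conjunct2[OF inv']]
  have l: "l \<in> {1..n}" "l \<in> {1..n} - frozen t" using step(2) by auto
  have l': "l \<in> {1..n + n} - frozen t'" using l(1) l(2)[unfolded fr] unfolding fr' by auto
  let ?u = "mutate_seed (n + n) l t'" and ?v = "mutate_seed n l t"
  have "mutation_equivalent (n + n) (principal_extension n s) ?u"
    by (rule mutation_equivalent.step[OF t' l'])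
  moreover have "arrows ?u i j = arrows ?v i j" if "i \<in> {1..n}" "j \<in> {1..n}" for i j
    using that l(1) by (simp add: mutate_quiver_eq[OF good_seedD(1)[OF good]]
        mutate_quiver_eq[OF good_seedD(1)[OF good']] arr)
  moreover have "specializes (cvar ?u i) (if i \<le> n then cvar ?v i else 1)" if i: "i \<in> {1..n + n}" for i
  proof (cases "i = l")
    case False
    then show ?thesis using spec[OF i] by (cases "i \<le> n") simp_all
  next
    case True
    have mon: "specializes (\<Prod>i\<in>{1..n + n}. cvar t' i ^ e' i) (\<Prod>i\<in>{1..n}. cvar t i ^ e i)"
      if ee: "\<And>i. i \<in> {1..n} \<Longrightarrow> e' i = e i" for e e' :: "nat \<Rightarrow> nat"
    proof -
      have "specializes (\<Prod>i\<in>{1..n + n}. cvar t' i ^ e' i) (\<Prod>i\<in>{1..n + n}. (if i \<le> n then cvar t i else 1) ^ e' i)"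
        by (intro specializes_prod specializes_power spec)
      also have "(\<Prod>i\<in>{1..n + n}. (if i \<le> n then cvar t i else 1) ^ e' i) = (\<Prod>i\<in>{1..n}. (if i \<le> n then cvar t i else 1) ^ e' i)"
        by (rule prod.mono_neutral_right) auto
      also have "\<dots> = (\<Prod>i\<in>{1..n}. cvar t i ^ e i)" 
      proof (rule prod.cong[OF HOL.refl])
        fix i assume i: "i \<in> {1..n}"
        then have "i \<le> n" by simp
        then show "(if i \<le> n then cvar t i else 1) ^ e' i = cvar t i ^ e i" using ee[OF i] by simp
      qed
      finally show ?thesis .
    qed
    have arr': "arrows t' i l = arrows t i l" "arrows t' l i = arrows t l i" if "i \<in> {1..n}" for i
      using arr that l(1) by blast+
    have P: "specializes (exchange (n + n) (arrows t') (cvar t') l) (exchange n (arrows t) (cvar t) l)"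
      unfolding exchange_def by (intro specializes_add mon arr')
    have "specializes (inverse (cvar t' l)) (inverse (cvar t l))"
      using spec[of l] l good_cvar_nonzero[OF good l(1)] by (intro specializes_inverse) auto
    from specializes_mult[OF P this] show ?thesis using True l by (simp add: divide_inverse)
  qed
  ultimately show ?case by blast
qed

theorem laurent_phenomenon:
  assumes K: "subring K ambient" and s: "good_seed K n s"
    and t: "mutation_equivalent n s t" and u: "mutation_equivalent n s u" and i: "i \<in> {1..n}"
  shows "cvar t i \<in> cluster_ring K n u"
proof -
  note K' = embed_subring[OF K] and s' = principal_extension_good[OF K s]
  obtain t' where t_lift: "mutation_equivalent (n + n) (principal_extension n s) t' \<and>
    (\<forall>i\<in>{1..n}. \<forall>j\<in>{1..n}. arrows t' i j = arrows t i j) \<and>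
    (\<forall>i\<in>{1..n + n}. specializes (cvar t' i) (if i \<le> n then cvar t i else 1))"
    using mutation_lift[OF K s t] by (rule exE)
  note t' = conjunct1[OF t_lift] and spec_t = bspec[OF conjunct2[OF conjunct2[OF t_lift]]]
  obtain u' where u_lift: "mutation_equivalent (n + n) (principal_extension n s) u' \<and>
    (\<forall>i\<in>{1..n}. \<forall>j\<in>{1..n}. arrows u' i j = arrows u i j) \<and>
    (\<forall>i\<in>{1..n + n}. specializes (cvar u' i) (if i \<le> n then cvar u i else 1))"
    using mutation_lift[OF K s u] by (rule exE)
  note u' = conjunct1[OF u_lift] and spec_u = bspec[OF conjunct2[OF conjunct2[OF u_lift]]]
  note good = conjunct1[OF mutation_equivalent_invariants[OF K s u]]
  have i': "i \<in> {1..n + n}" using i by auto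
  have mem: "cvar t' i \<in> cluster_ring (embed ` K) (n + n) u'"
    by (rule laurent_phenomenon_full_rank[OF K' s' principal_extension_full_rank[OF s] t' u' i'])
  have "\<exists>r. specializes y r \<and> r \<noteq> 0 \<and> r \<in> insert 1 (cvar u ` {1..n})" if y: "y \<in> cvar u' ` {1..n + n}" for y
  proof -
    obtain j where j: "j \<in> {1..n + n}" "y = cvar u' j" using y by blast
    show ?thesis
    proof (cases "j \<le> n")
      case True
      then have "j \<in> {1..n}" using j(1) unfolding atLeastAtMost_iff by blast
      then show ?thesis using good_cvar_nonzero[OF good] spec_u[OF j(1)] True j(2) by auto
    next
      case False
      then show ?thesis using spec_u[OF j(1)] j(2) by auto
    qed
  qed
  from specializes_laurent[OF this mem]
  obtain r where r: "specializes (cvar t' i) r" "r \<in> cluster_ring K n u" by blast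
  have "specializes (cvar t' i) (cvar t i)" using spec_t[OF i'] i by simp
  from specializes_unique[OF this r(1)] show ?thesis using r(2) by simp
qed

definition fraction_of :: "'f::field set \<Rightarrow> 'f \<Rightarrow> 'f \<Rightarrow> 'f poly \<Rightarrow> 'f poly \<Rightarrow> bool" where
  "fraction_of E x f p q \<longleftrightarrow>
     (\<forall>i. coeff p i \<in> E) \<and> (\<forall>i. coeff q i \<in> E) \<and> poly q x \<noteq> 0 \<and> f * poly q x = poly p x"

context
  fixes E :: "'f::field set" and x :: 'f
  assumes E: "subring E ambient" and x: "transc E x"
begin

lemma coeff_closed:
  assumes "\<forall>i. coeff p i \<in> E" "\<forall>i. coeff q i \<in> E"
  shows "\<forall>i. coeff (p + q) i \<in> E" "\<forall>i. coeff (p - q) i \<in> E" "\<forall>i. coeff (p * q) i \<in> E" "\<forall>i. coeff (- p) i \<in> E"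
  using assms by (simp_all add: coeff_mult subring_closed[OF E])

lemma coeff_const: "c \<in> E \<Longrightarrow> \<forall>i. coeff [:c:] i \<in> E"
  by (simp add: coeff_pCons subring_zero[OF E] split: nat.split)

lemma coeff_x: "\<forall>i. coeff [:0, 1:] i \<in> E"
  by (simp add: coeff_pCons subring_zero[OF E] subring_one[OF E] split: nat.split)

lemma coeffs:
  assumes "fraction_of E x f p q" shows "\<forall>i. coeff p i \<in> E" "\<forall>i. coeff q i \<in> E"
  using assms by (simp_all add: fraction_of_def)

lemma fraction_add:
  assumes "fraction_of E x f p q" "fraction_of E x g r t"
  shows "fraction_of E x (f + g) (p * t + r * q) (q * t)"
proof -
  have e: "f * poly q x = poly p x" "g * poly t x = poly r x" using assms by (auto simp: fraction_of_def)
  have "(f + g) * poly (q * t) x = poly (p * t + r * q) x"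
    unfolding poly_mult poly_add e[symmetric] by (simp add: algebra_simps)
  moreover have "poly (q * t) x \<noteq> 0" using assms by (simp add: fraction_of_def)
  moreover note co = coeffs[OF assms(1)] coeffs[OF assms(2)]
  ultimately show ?thesis unfolding fraction_of_def
    using coeff_closed(1)[OF coeff_closed(3)[OF co(1) co(4)] coeff_closed(3)[OF co(3) co(2)]] coeff_closed(3)[OF co(2) co(4)] by blast
qed

lemma fraction_mult:
  assumes "fraction_of E x f p q" "fraction_of E x g r t"
  shows "fraction_of E x (f * g) (p * r) (q * t)"
proof -
  have e: "f * poly q x = poly p x" "g * poly t x = poly r x" using assms by (auto simp: fraction_of_def)
  have "(f * g) * poly (q * t) x = poly (p * r) x"
    unfolding poly_mult poly_add e[symmetric] by (simp add: algebra_simps)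
  moreover have "poly (q * t) x \<noteq> 0" using assms by (simp add: fraction_of_def)
  moreover note co = coeffs[OF assms(1)] coeffs[OF assms(2)]
  ultimately show ?thesis unfolding fraction_of_def
    using coeff_closed(3)[OF co(1) co(3)] coeff_closed(3)[OF co(2) co(4)] by blast
qed

lemma fraction_const: "c \<in> E \<Longrightarrow> fraction_of E x c [:c:] [:1:]"
  unfolding fraction_of_def using coeff_const[of c] coeff_const[OF subring_one[OF E]] by simp

lemma fraction_x: "fraction_of E x x [:0, 1:] [:1:]"
  unfolding fraction_of_def using coeff_x coeff_const[OF subring_one[OF E]] by simp

lemma fraction_uminus: "fraction_of E x f p q \<Longrightarrow> fraction_of E x (- f) (- p) q"
  unfolding fraction_of_def using coeff_closed(4) by auto

lemma fraction_inverse: "fraction_of E x f p q \<Longrightarrow> f \<noteq> 0 \<Longrightarrow> fraction_of E x (inverse f) q p"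
  unfolding fraction_of_def by (auto simp: field_simps)

lemma fraction_exists:
  assumes f: "f \<in> generate_field ambient H" and H: "H \<subseteq> insert x E"
  shows "\<exists>p q. fraction_of E x f p q"
  using f
proof (induction rule: generate_field.induct)
  case one
  then show ?case using fraction_const[OF subring_one[OF E]] by auto
next
  case (incl h)
  then show ?case using H fraction_const fraction_x by blast
next
  case (a_inv h)
  then show ?case using fraction_uminus unfolding ambient_a_inv by blast
next
  case (m_inv h)
  then have "h \<noteq> 0" by simp
  then show ?case using fraction_inverse m_inv(3) unfolding ambient_m_inv[OF \<open>h \<noteq> 0\<close>] by blast
next
  case (eng_add h1 h2)
  then show ?case using fraction_add by (simp only: ambient_ops) blast
next
  case (eng_mult h1 h2)
  then show ?case using fraction_mult by (simp only: ambient_ops) blast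
qed

lemma fraction_derivative_unique:
  assumes "fraction_of E x f p q" "fraction_of E x f r t"
  shows "(poly (pderiv p) x - f * poly (pderiv q) x) / poly q x =
    (poly (pderiv r) x - f * poly (pderiv t) x) / poly t x"
proof -
  have e: "f * poly q x = poly p x" "f * poly t x = poly r x" "poly q x \<noteq> 0" "poly t x \<noteq> 0"
    using assms by (auto simp: fraction_of_def)
  have "p * t - r * q = 0"
  proof (rule transcD[OF x])
    show "coeff (p * t - r * q) i \<in> E" for i
      using assms coeff_closed(2)[OF coeff_closed(3) coeff_closed(3)] unfolding fraction_of_def by blast
    show "poly (p * t - r * q) x = 0"
      unfolding poly_mult poly_diff e(1,2)[symmetric] by (simp add: algebra_simps)
  qed
  then have "pderiv (p * t) = pderiv (r * q)" by simp
  then have "poly (pderiv (p * t)) x = poly (pderiv (r * q)) x" by simp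
  then have "f * poly q x * poly (pderiv t) x + poly t x * poly (pderiv p) x =
      f * poly t x * poly (pderiv q) x + poly q x * poly (pderiv r) x"
    unfolding pderiv_mult poly_add poly_mult e(1,2) .
  then show ?thesis using e(3,4) by (simp add: frac_eq_eq algebra_simps)
qed

lemma partial_derivative_exists:
  assumes H: "generate_field ambient H = UNIV" "H \<subseteq> insert x E"
  shows "\<exists>d. derivation E UNIV d \<and> d x = 1"
proof -
  define v where "v f p q = (poly (pderiv p) x - f * poly (pderiv q) x) / poly q x" for f p q
  define d where "d f = (THE y. \<exists>p q. fraction_of E x f p q \<and> y = v f p q)" for f
  have d: "d f = v f p q" if "fraction_of E x f p q" for f p q
    unfolding d_def
  proof (rule the_equality)
    show "\<exists>p' q'. fraction_of E x f p' q' \<and> v f p q = v f p' q'" using that by blast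
    fix y assume "\<exists>p q. fraction_of E x f p q \<and> y = v f p q"
    then obtain p' q' where "fraction_of E x f p' q'" "y = v f p' q'" by blast
    then show "y = v f p q" using fraction_derivative_unique[OF that] unfolding v_def by simp
  qed
  have ex: "\<exists>p q. fraction_of E x f p q" for f using fraction_exists[OF _ H(2)] H(1) by blast
  have "d (f + g) = d f + d g \<and> d (f * g) = f * d g + g * d f" for f g
  proof -
    obtain p q where f: "fraction_of E x f p q" using ex by blast
    obtain r t where g: "fraction_of E x g r t" using ex by blast
    note fr = f g
    from f g have e: "poly p x = f * poly q x" "poly r x = g * poly t x" and nz: "poly q x \<noteq> 0" "poly t x \<noteq> 0"
      by (auto simp: fraction_of_def)
    have dd: "d f = v f p q" "d g = v g r t" "d (f + g) = v (f + g) (p * t + r * q) (q * t)"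
      "d (f * g) = v (f * g) (p * r) (q * t)"
      by (rule d, rule fr fraction_add[OF fr] fraction_mult[OF fr])+
    show ?thesis
      unfolding dd v_def pderiv_mult pderiv_add poly_add poly_mult e
      using nz by (simp add: field_simps)
  qed
  moreover have "d c = 0" if "c \<in> E" for c using d[OF fraction_const[OF that]] by (simp add: v_def)
  moreover have "d x = 1" using d[OF fraction_x] by (simp add: v_def pderiv_pCons)
  ultimately show ?thesis by (intro exI[of _ d]) (simp add: derivation_to_def)
qed

end

lemma log_derivations_exist:
  fixes x :: "nat \<Rightarrow> 'f::field"
  assumes K: "subring K ambient" and x: "lindep K {1..n} x"
    and gen: "generate_field ambient (K \<union> x ` {1..n}) = UNIV"
  shows "\<exists>\<theta>. (\<forall>j. derivation K UNIV (\<theta> j)) \<and>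
    (\<forall>i<n. \<forall>j<n. \<theta> j (x (Suc i)) = (if i = j then x (Suc j) else 0))"
proof -
  have "\<exists>d. derivation K UNIV d \<and> (j < n \<longrightarrow> (\<forall>i<n. d (x (Suc i)) = (if i = j then x (Suc j) else 0)))" for j
  proof (cases "j < n")
    case False
    have "derivation K UNIV (\<lambda>_. 0)" by (simp add: derivation_to_def)
    then show ?thesis using False by blast
  next
    case True
    let ?k = "Suc j" let ?E = "laurent_ring K (x ` ({1..n} - {?k}))"
    have k: "?k \<in> {1..n}" using True by simp
    have sub: "K \<union> x ` {1..n} \<subseteq> insert (x ?k) ?E"
    proof (intro Un_least subsetI)
      show "a \<in> insert (x ?k) ?E" if "a \<in> K" for a using laurent_const[OF that] by blast
      show "a \<in> insert (x ?k) ?E" if a: "a \<in> x ` {1..n}" for a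
      proof -
        obtain i where i: "a = x i" "i \<in> {1..n}" using a by blast
        show ?thesis
        proof (cases "i = ?k")
          case False
          then have "x i \<in> ?E" using i(2) by (intro laurent_var imageI) simp
          then show ?thesis unfolding i(1) by blast
        qed (simp add: i(1))
      qed
    qed
    obtain d where d: "derivation ?E UNIV d" "d (x ?k) = 1"
      using partial_derivative_exists[OF laurent_ring_subring lindep_transc[OF K finite_atLeastAtMost k x] gen sub] by blast
    have kill: "d (x (Suc i)) = 0" if "i < n" "i \<noteq> j" for i
    proof -
      have "Suc i \<in> {1..n} - {?k}" using that by simp
      then have "x (Suc i) \<in> ?E" by (intro laurent_var imageI)
      then show ?thesis using d(1) by (simp add: derivation_to_def)
    qed
    have "derivation K UNIV (\<lambda>a. x ?k * d a)"
      using d(1) laurent_const[of _ K] by (simp add: derivation_to_def algebra_simps)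
    moreover have "\<forall>i<n. x ?k * d (x (Suc i)) = (if i = j then x ?k else 0)" using kill d(2) by simp
    ultimately show ?thesis by (intro exI[of _ "\<lambda>a. x ?k * d a"]) blast
  qed
  then show ?thesis by metis
qed

lemma jacobian_log_derivations:
  assumes \<theta>: "\<And>i j. i < n \<Longrightarrow> j < n \<Longrightarrow> \<theta> j (x (Suc i)) = (if i = j then x (Suc j) else 0)"
  shows "jacobian \<theta> (map x [1..<Suc n]) = prod_list (map x [1..<Suc n])"
proof -
  let ?xs = "map x [1..<Suc n]"
  have nth: "?xs ! i = x (Suc i)" if "i < n" for i using that by (simp add: nth_append del: upt_Suc)
  have len: "length ?xs = n" by simp
  have "jacobian \<theta> ?xs = leibniz_det n (\<lambda>i j. \<theta> j (?xs ! i))" unfolding jacobian_def len ..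
  also have "\<dots> = (\<Prod>i<n. \<theta> i (?xs ! i))" by (rule leibniz_det_diagonal) (simp only: nth \<theta> if_False)
  also have "\<dots> = (\<Prod>i<n. x (Suc i))" by (rule prod.cong) (simp_all add: nth \<theta> del: upt_Suc)
  also have "\<dots> = prod_list (map (\<lambda>i. x (Suc i)) [0..<n])"
    using prod.distinct_set_conv_list[of "[0..<n]" "\<lambda>i. x (Suc i)"]
    by (simp only: distinct_upt set_upt atLeast0LessThan)
  also have "map (\<lambda>i. x (Suc i)) [0..<n] = ?xs"
    unfolding One_nat_def map_Suc_upt[symmetric] map_map comp_def ..
  finally show ?thesis .
qed

lemma derivation_UNIV:
  "derivation K UNIV d \<longleftrightarrow>
     (\<forall>a b. d (a + b) = d a + d b) \<and> (\<forall>a b. d (a * b) = a * d b + b * d a) \<and> (\<forall>c\<in>K. d c = 0)"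
  by (simp add: derivation_to_def)

context
  fixes K :: "'f::field set" and d :: "'f \<Rightarrow> 'f"
  assumes d: "derivation K UNIV d" and one: "1 \<in> K"
begin

lemma derivation_add: "d (a + b) = d a + d b"
  and derivation_mult: "d (a * b) = a * d b + b * d a"
  and derivation_const: "c \<in> K \<Longrightarrow> d c = 0"
  using d unfolding derivation_UNIV by blast+

lemma derivation_zero: "d 0 = 0"
  using derivation_mult[of 0 0] by simp

lemma derivation_uminus: "d (- a) = - d a"
  using derivation_add[of a "- a"] derivation_zero by (simp add: eq_neg_iff_add_eq_0 add.commute)

lemma derivation_inverse: "d (inverse a) = - d a * inverse a ^ 2"
proof (cases "a = 0")
  case False
  have "d (a * inverse a) = 0" using False derivation_const[OF one] by simp
  then have "a * d (inverse a) = - (inverse a * d a)" unfolding derivation_mult by (simp add: eq_neg_iff_add_eq_0)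
  then have "inverse a * (a * d (inverse a)) = inverse a * - (inverse a * d a)" by simp
  then show ?thesis using False by (simp add: power2_eq_square mult.assoc[symmetric])
qed (simp add: derivation_zero)

lemma derivation_kernel_subring: "subring {a. d a = 0} ambient"
  unfolding subring_ambient_iff
  by (simp add: derivation_add derivation_mult derivation_uminus derivation_const[OF one])

lemma derivation_laurent:
  assumes Y: "\<And>y. y \<in> Y \<Longrightarrow> d y \<in> laurent_ring K Y" and f: "f \<in> laurent_ring K Y"
  shows "d f \<in> laurent_ring K Y"
proof -
  note L = laurent_ring_subring[of K Y]
  have "f \<in> laurent_ring K Y \<and> d f \<in> laurent_ring K Y"
    using f unfolding laurent_ring_def[of K Y]
  proof (induction rule: generate_ring.induct)
    case one
    then show ?case unfolding laurent_ring_def[symmetric] ambient_ops derivation_const[OF \<open>1 \<in> K\<close>]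
      using subring_one[OF L] subring_zero[OF L] by blast
  next
    case (incl h)
    then consider "h \<in> K" | "h \<in> Y" | y where "y \<in> Y" "h = inverse y" by blast
    then show ?case unfolding laurent_ring_def[symmetric]
    proof cases
      case 1
      then show "h \<in> laurent_ring K Y \<and> d h \<in> laurent_ring K Y"
        using derivation_const subring_zero[OF L] laurent_const by auto
    next
      case 2
      then show "h \<in> laurent_ring K Y \<and> d h \<in> laurent_ring K Y" using Y laurent_var by blast
    next
      case 3
      have "- d y * inverse y ^ 2 \<in> laurent_ring K Y"
        by (rule subring_mult[OF L subring_uminus[OF L Y[OF 3(1)]] subring_power[OF L laurent_inverse[OF 3(1)]]])
      then show "h \<in> laurent_ring K Y \<and> d h \<in> laurent_ring K Y"
        unfolding 3(2) derivation_inverse using laurent_inverse[OF 3(1)] by blast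
    qed
  next
    case (a_inv h)
    then have m: "h \<in> laurent_ring K Y" "d h \<in> laurent_ring K Y" unfolding laurent_ring_def by simp_all
    show ?case unfolding laurent_ring_def[symmetric] ambient_a_inv derivation_uminus
      by (intro conjI subring_uminus[OF L] m)
  next
    case (eng_add a b)
    then have m: "a \<in> laurent_ring K Y" "d a \<in> laurent_ring K Y" "b \<in> laurent_ring K Y" "d b \<in> laurent_ring K Y"
      unfolding laurent_ring_def by simp_all
    show ?case unfolding laurent_ring_def[symmetric] ambient_ops derivation_add
      by (intro conjI subring_add[OF L] m)
  next
    case (eng_mult a b)
    then have m: "a \<in> laurent_ring K Y" "d a \<in> laurent_ring K Y" "b \<in> laurent_ring K Y" "d b \<in> laurent_ring K Y"
      unfolding laurent_ring_def by simp_all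
    show ?case unfolding laurent_ring_def[symmetric] ambient_ops derivation_mult
      by (intro conjI subring_add[OF L] subring_mult[OF L] m)
  qed
  then show ?thesis by blast
qed

end

lemma seed_good:
  assumes K: "subring K ambient" and s: "is_seed K n s"
  shows "good_seed K n s"
  unfolding good_seed_def
proof (intro conjI ballI)
  have q: "is_quiver n (arrows s)" and fr: "frozen s \<subseteq> {1..n}" and x: "alg_independent K {1..n} (cvar s)"
    and iso: "\<forall>i\<in>{1..n}. (\<forall>j. arrows s i j = 0 \<and> arrows s j i = 0) \<longrightarrow> i \<in> frozen s"
    using s unfolding is_seed_def by blast+
  show "is_quiver n (arrows s)" "frozen s \<subseteq> {1..n}" by (fact q fr)+
  show "lindep K {1..n} (cvar s)" by (rule alg_independent_lindep[OF K finite_atLeastAtMost x])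
  fix j assume j: "j \<in> {1..n} - frozen s"
  then obtain i where i: "arrows s j i \<noteq> 0 \<or> arrows s i j \<noteq> 0" using iso by blast
  then have "i \<in> {1..n}" using q unfolding is_quiver_def by (metis not_gr_zero)
  moreover have "arrows s i j \<noteq> arrows s j i" using q i unfolding is_quiver_def by metis
  ultimately show "\<exists>i\<in>{1..n}. arrows s i j \<noteq> arrows s j i" by blast
qed

lemma generate_field_fraction:
  assumes H: "generate_field ambient H = UNIV"
  shows "\<exists>p\<in>gen H. \<exists>q\<in>gen H. q \<noteq> 0 \<and> a * q = p"
proof -
  note S = frac_subring[OF gen_subring[of H]]
  have "a \<in> generate_field ambient H" using H by simp
  then have "a \<in> fracs (gen H)"
  proof (induction rule: generate_field.induct)
    case one
    then show ?case using subring_one[OF S] by simp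
  next
    case (incl h)
    then show ?case using frac_incl[OF gen_subring] gen_incl by blast
  next
    case (a_inv h)
    then show ?case using subring_uminus[OF S] by simp
  next
    case (m_inv h)
    then have "h \<noteq> 0" by simp
    then show ?case using frac_inverse[OF gen_subring m_inv(3)] by simp
  next
    case (eng_add h1 h2)
    then show ?case using subring_add[OF S] by simp
  next
    case (eng_mult h1 h2)
    then show ?case using subring_mult[OF S] by simp
  qed
  then obtain p q where "a = p / q" "p \<in> gen H" "q \<in> gen H" "q \<noteq> 0" unfolding fracs_def by blast
  then show ?thesis by (intro bexI[of _ p] bexI[of _ q]) simp_all
qed

lemma lindep_inj:
  assumes K: "subring K ambient" and I: "finite I" and x: "lindep K I x"
  shows "inj_on x I"
proof (rule inj_onI, rule ccontr)
  fix i j assume ij: "i \<in> I" "j \<in> I" "x i = x j" "i \<noteq> j"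
  let ?E = "laurent_ring K (x ` (I - {i}))"
  have mem: "x j \<in> ?E" by (rule laurent_var, rule imageI) (use ij in blast)
  note L = laurent_ring_subring[of K "x ` (I - {i})"]
  have "[:- x j, 1:] = 0"
  proof (rule transcD[OF lindep_transc[OF K I ij(1) x]])
    show "coeff [:- x j, 1:] k \<in> ?E" for k
      using subring_uminus[OF L mem] subring_zero[OF L] subring_one[OF L]
      by (simp add: coeff_pCons split: nat.split)
    show "poly [:- x j, 1:] (x i) = 0" using ij(3) by simp
  qed
  then show False by simp
qed

abbreviation cluster_list :: "nat \<Rightarrow> 'f seed \<Rightarrow> 'f list" where
  "cluster_list n t \<equiv> map (cvar t) [1..<Suc n]"

lemma cluster_list_tuple: "set (cluster_list n t) \<subseteq> C \<Longrightarrow> cluster_list n t \<in> tuples C n"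
  by (simp add: tuples_def del: upt_Suc)

lemma set_cluster_list: "set (cluster_list n t) = cvar t ` {1..n}"
  by (simp only: set_map set_upt atLeastLessThanSuc_atLeastAtMost)

lemma prod_cluster_list: "prod_list (cluster_list n t) = (\<Prod>i\<in>{1..n}. cvar t i)"
  using prod.distinct_set_conv_list[of "[1..<Suc n]" "cvar t"]
  by (simp only: distinct_upt set_upt atLeastLessThanSuc_atLeastAtMost)

lemma nth_cluster_list: "i \<in> {1..n} \<Longrightarrow> cluster_list n t ! (i - 1) = cvar t i"
  by (subst nth_map) (auto simp del: upt_Suc)

context
  fixes K :: "'f::field set" and n :: nat and s :: "'f seed" and D :: "'f list \<Rightarrow> 'f"
  assumes K: "subring K ambient" and s: "good_seed K n s"
    and D: "multiderivation K UNIV n D"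
    and initial: "D (cluster_list n s) = prod_list (cluster_list n s)"
begin

lemmas one_K = subring_one[OF K]

lemma slot_derivation: "as \<in> tuples UNIV n \<Longrightarrow> i < n \<Longrightarrow> derivation K UNIV (\<lambda>a. D (as[i := a]))"
  using D unfolding multiderivation_to_def by blast

lemma slot_repeat: "as \<in> tuples UNIV n \<Longrightarrow> i < n \<Longrightarrow> j < n \<Longrightarrow> i \<noteq> j \<Longrightarrow> D (as[i := as ! j]) = 0"
proof -
  assume a: "as \<in> tuples UNIV n" "i < n" "j < n" "i \<noteq> j"
  then have m: "as[i := as ! j] \<in> tuples UNIV n" and eq: "as[i := as ! j] ! i = as[i := as ! j] ! j"
    by (auto simp: tuples_def)
  show ?thesis using D m eq a unfolding multiderivation_to_def by (metis field_module_simps(2) linorder_neqE_nat)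
qed

lemma mutated_volume:
  assumes t: "good_seed K n t" and l: "l \<in> {1..n} - frozen t"
    and \<epsilon>: "D (cluster_list n t) = \<epsilon> * prod_list (cluster_list n t)"
  shows "D (cluster_list n (mutate_seed n l t)) = - \<epsilon> * prod_list (cluster_list n (mutate_seed n l t))"
proof -
  let ?y = "cvar t" and ?i = "l - 1" and ?ys = "cluster_list n t" and ?t' = "mutate_seed n l t"
  let ?P = "exchange n (arrows t) ?y l" and ?R = "\<Prod>i\<in>{1..n} - {l}. cvar t i"
  define d where "d a = D (?ys[?i := a])" for a
  have l1: "l \<in> {1..n}" and i: "?i < n" using l by auto
  have ys: "?ys \<in> tuples UNIV n" by (rule cluster_list_tuple) simp
  have d: "derivation K UNIV d" unfolding d_def[abs_def] by (rule slot_derivation[OF ys i])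
  note ker = derivation_kernel_subring[OF d one_K]
  have y0: "?y l \<noteq> 0" by (rule good_cvar_nonzero[OF t l1])
  have dy: "d (?y m) = 0" if m: "m \<in> {1..n}" "m \<noteq> l" for m
  proof -
    have "m - 1 < n" "?i \<noteq> m - 1" using m l1 by auto
    from slot_repeat[OF ys i this] show ?thesis unfolding d_def nth_cluster_list[OF m(1)] .
  qed
  have loop: "arrows t l l = 0" using good_seedD(1)[OF t] unfolding is_quiver_def by blast
  have pow: "?y m ^ e m \<in> {a. d a = 0}" if "m \<in> {1..n}" "e l = 0" for m and e :: "nat \<Rightarrow> nat"
  proof (cases "m = l")
    case True
    then show ?thesis using that(2) subring_one[OF ker] by simp
  next
    case False
    then show ?thesis using subring_power[OF ker, of "?y m"] dy[OF that(1)] by blast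
  qed
  have "?P \<in> {a. d a = 0}"
    unfolding exchange_def
    by (rule subring_add[OF ker subring_prod[OF ker pow] subring_prod[OF ker pow]]) (rule loop | assumption)+
  then have dP: "d ?P = 0" by blast
  have y': "cvar ?t' l = ?P * inverse (?y l)" by (simp add: divide_inverse)
  have dl: "d (?y l) = \<epsilon> * (?y l * ?R)"
  proof -
    have "?ys[?i := ?y l] = ?ys" using nth_cluster_list[OF l1, of t] by (metis list_update_id)
    then have "d (?y l) = D ?ys" unfolding d_def by simp
    also have "\<dots> = \<epsilon> * (?y l * ?R)"
      unfolding \<epsilon> prod_cluster_list prod.remove[OF finite_atLeastAtMost l1, of "cvar t"] ..
    finally show ?thesis .
  qed
  have upd: "cluster_list n ?t' = ?ys[?i := cvar ?t' l]"
  proof (rule nth_equalityI)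
    fix m assume "m < length (cluster_list n ?t')"
    then have m: "Suc m \<in> {1..n}" by (simp del: upt_Suc)
    have n1: "cluster_list n ?t' ! m = cvar ?t' (Suc m)" "?ys ! m = cvar t (Suc m)"
      using nth_cluster_list[OF m, of ?t'] nth_cluster_list[OF m, of t] by (simp_all only: diff_Suc_1)
    show "cluster_list n ?t' ! m = ?ys[?i := cvar ?t' l] ! m"
    proof (cases "Suc m = l")
      case True
      then show ?thesis unfolding n1 using i by (auto simp del: upt_Suc mutate_seed_simps)
    next
      case False
      then have "?i \<noteq> m" using l1 by auto
      then show ?thesis unfolding n1 nth_list_update_neq[OF \<open>?i \<noteq> m\<close>] using False by simp
    qed
  qed (simp del: upt_Suc)
  have "(\<Prod>i\<in>{1..n} - {l}. cvar ?t' i) = ?R" by (rule prod.cong) auto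
  then have prod': "prod_list (cluster_list n ?t') = cvar ?t' l * ?R"
    unfolding prod_cluster_list prod.remove[OF finite_atLeastAtMost l1, of "cvar ?t'"] by simp
  have "D (cluster_list n ?t') = d (?P * inverse (?y l))" unfolding upd d_def y' ..
  also have "\<dots> = ?P * (- (\<epsilon> * (?y l * ?R)) * inverse (?y l) ^ 2)"
    unfolding derivation_mult[OF d one_K] derivation_inverse[OF d one_K] dP dl by simp
  also have "\<dots> = - \<epsilon> * (?P * inverse (?y l) * ?R)"
    using y0 by (simp add: power2_eq_square field_simps)
  also have "\<dots> = - \<epsilon> * prod_list (cluster_list n ?t')" unfolding prod' y' ..
  finally show ?thesis .
qed

lemma seed_volume:
  assumes t: "mutation_equivalent n s t"
  shows "\<exists>\<epsilon>. (\<epsilon> = 1 \<or> \<epsilon> = - 1) \<and> D (cluster_list n t) = \<epsilon> * prod_list (cluster_list n t)"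
  using t
proof (induction rule: mutation_equivalent.induct)
  case refl
  show ?case by (rule exI[of _ 1]) (simp only: initial mult_1 simp_thms)
next
  case (step t l)
  obtain \<epsilon> where \<epsilon>0: "(\<epsilon> = 1 \<or> \<epsilon> = - 1) \<and> D (cluster_list n t) = \<epsilon> * prod_list (cluster_list n t)"
    using step(3) by (rule exE)
  note \<epsilon> = conjunct1[OF \<epsilon>0] conjunct2[OF \<epsilon>0]
  note good = conjunct1[OF mutation_equivalent_invariants[OF K s step(1)]]
  show ?case
    by (rule exI[of _ "- \<epsilon>"], rule conjI[OF _ mutated_volume[OF good step(2) \<epsilon>(2)]]) (use \<epsilon>(1) in auto)
qed

lemma clustersE:
  assumes "Y \<in> clusters n s"
  obtains t where "mutation_equivalent n s t" "good_seed K n t" "Y = cvar t ` {1..n}"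
  using assms mutation_equivalent_invariants[OF K s] unfolding clusters_def by blast

lemma distinct_cluster_list: "good_seed K n t \<Longrightarrow> distinct (cluster_list n t)"
  using lindep_inj[OF K finite_atLeastAtMost good_seedD(3)]
  by (simp only: distinct_map distinct_upt set_upt atLeastLessThanSuc_atLeastAtMost simp_thms)

lemma cluster_volume:
  assumes ys: "set ys \<in> clusters n s" "distinct ys"
  shows "length ys = n \<and> prod_list ys \<noteq> 0 \<and>
    (\<exists>\<epsilon>. (\<epsilon> = 1 \<or> \<epsilon> = - 1) \<and> D ys = \<epsilon> * prod_list ys)"
proof -
  obtain t where t: "mutation_equivalent n s t" "good_seed K n t" "set ys = cvar t ` {1..n}"
    using ys(1) by (rule clustersE)
  have mset: "mset ys = mset (cluster_list n t)"
    using set_eq_iff_mset_eq_distinct[OF ys(2) distinct_cluster_list[OF t(2)]] t(3) set_cluster_list by metis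
  have len: "length ys = n" using mset_eq_length[OF mset] by (simp del: upt_Suc)
  have pr: "prod_list ys = prod_list (cluster_list n t)" using mset by (metis prod_mset_prod_list)
  have nz: "prod_list ys \<noteq> 0"
    unfolding pr prod_cluster_list using good_cvar_nonzero[OF t(2)] by (simp only: prod_zero_iff finite_atLeastAtMost) blast
  obtain \<epsilon> where \<epsilon>: "\<epsilon> = 1 \<or> \<epsilon> = - 1" "D (cluster_list n t) = \<epsilon> * prod_list (cluster_list n t)"
    using seed_volume[OF t(1)] by blast
  have "cluster_list n t \<in> tuples UNIV n" by (rule cluster_list_tuple) simp
  from multiderivations_permuted[OF field_module_module UNIV_subring D D this mset]
  have "D ys = D (cluster_list n t) \<or> D ys = - D (cluster_list n t)" by (simp only: field_module_a_inv) blast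
  then have "D ys = \<epsilon> * prod_list ys \<or> D ys = (- \<epsilon>) * prod_list ys" unfolding \<epsilon>(2) pr by simp
  then have "\<exists>\<epsilon>. (\<epsilon> = 1 \<or> \<epsilon> = - 1) \<and> D ys = \<epsilon> * prod_list ys" using \<epsilon>(1) by (metis minus_minus)
  then show ?thesis using len nz by blast
qed

lemma volume_laurent:
  assumes Y: "Y \<in> clusters n s" and as: "as \<in> tuples (laurent_ring K Y) n"
  shows "D as \<in> laurent_ring K Y"
proof (rule slot_induct[of Y "laurent_ring K Y" n "\<lambda>as. D as \<in> laurent_ring K Y", OF _ _ _ as])
  note L = laurent_ring_subring[of K Y]
  show "Y \<subseteq> laurent_ring K Y" using laurent_var by blast
  obtain t where t: "good_seed K n t" "Y = cvar t ` {1..n}" using Y by (rule clustersE)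
  have card: "card Y = n" "finite Y"
    unfolding t(2) using card_image[OF lindep_inj[OF K finite_atLeastAtMost good_seedD(3)[OF t(1)]]] by simp_all
  show "D as \<in> laurent_ring K Y" if as: "as \<in> tuples Y n" for as
  proof (cases "distinct as")
    case True
    have "set as = Y"
      using card_subset_eq[OF card(2), of "set as"] as distinct_card[OF True] card(1) by (simp add: tuples_def)
    then obtain \<epsilon> where \<epsilon>: "\<epsilon> = 1 \<or> \<epsilon> = - 1" "D as = \<epsilon> * prod_list as"
      using cluster_volume[of as] Y True by blast
    have "set bs \<subseteq> Y \<Longrightarrow> prod_list bs \<in> laurent_ring K Y" for bs
      by (induction bs) (simp_all add: subring_one[OF L] subring_mult[OF L] laurent_var)
    then have "prod_list as \<in> laurent_ring K Y" using \<open>set as = Y\<close> by simp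
    then show ?thesis unfolding \<epsilon>(2) using \<epsilon>(1) subring_uminus[OF L] by auto
  next
    case False
    then obtain i j where ij: "i < n" "j < n" "i \<noteq> j" "as ! i = as ! j"
      using as by (auto simp: distinct_conv_nth tuples_def)
    have "as \<in> tuples UNIV n" using as by (simp add: tuples_def)
    from slot_repeat[OF this ij(1-3)] have "D as = 0" unfolding ij(4)[symmetric] list_update_id .
    then show ?thesis using subring_zero[OF L] by simp
  qed
  show "D (as[i := a]) \<in> laurent_ring K Y"
    if as: "as \<in> tuples (laurent_ring K Y) n" and i: "i < n"
      and g: "\<And>g. g \<in> Y \<Longrightarrow> D (as[i := g]) \<in> laurent_ring K Y" and a: "a \<in> laurent_ring K Y" for as i a
  proof -
    have "as \<in> tuples UNIV n" using as by (simp add: tuples_def)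
    from derivation_laurent[OF slot_derivation[OF this i] one_K g a] show ?thesis .
  qed
qed

lemma volume_conductor:
  assumes Y: "Y \<in> clusters n s" and C: "C \<subseteq> laurent_ring K Y"
    and vars: "\<And>t i. mutation_equivalent n s t \<Longrightarrow> i \<in> {1..n} \<Longrightarrow> cvar t i \<in> C"
    and c: "\<And>as. as \<in> tuples C n \<Longrightarrow> c * D as \<in> C"
  shows "c \<in> laurent_ring K Y"
proof -
  note L = laurent_ring_subring[of K Y]
  obtain t where t: "mutation_equivalent n s t" "good_seed K n t" "Y = cvar t ` {1..n}" using Y by (rule clustersE)
  let ?ys = "cluster_list n t"
  have "set ?ys \<subseteq> C" unfolding set_cluster_list using vars[OF t(1)] by blast
  from c[OF cluster_list_tuple[OF this]] have cD: "c * D ?ys \<in> laurent_ring K Y" using C by blast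
  obtain \<epsilon> where \<epsilon>: "\<epsilon> = 1 \<or> \<epsilon> = - 1" "D ?ys = \<epsilon> * prod_list ?ys" using seed_volume[OF t(1)] by blast
  have nz: "prod_list ?ys \<noteq> 0"
    unfolding prod_cluster_list using good_cvar_nonzero[OF t(2)] by (simp only: prod_zero_iff finite_atLeastAtMost) blast
  have "inverse (cvar t i) \<in> laurent_ring K Y" if "i \<in> {1..n}" for i
    unfolding t(3) by (rule laurent_inverse[OF imageI[OF that]])
  then have "(\<Prod>i\<in>{1..n}. inverse (cvar t i)) \<in> laurent_ring K Y" by (rule subring_prod[OF L])
  then have inv: "inverse (prod_list ?ys) \<in> laurent_ring K Y"
    unfolding prod_cluster_list prod_inversef[symmetric] comp_def .
  have e: "c * D ?ys * inverse (prod_list ?ys) = c * \<epsilon>" unfolding \<epsilon>(2) using nz by (simp add: mult.assoc del: upt_Suc)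
  from subring_mult[OF L cD inv] have ce: "c * \<epsilon> \<in> laurent_ring K Y" unfolding e .
  show ?thesis using \<epsilon>(1) ce subring_uminus[OF L ce] by (elim disjE) simp_all
qed

end

context jacobian_ring
begin

lemma log_volume_form_multiple:
  assumes "length ys = n" "jacobian \<theta> ys = \<epsilon> * prod_list ys" "prod_list ys \<noteq> 0"
  shows "log_volume_form K ys = \<epsilon> \<odot>\<^bsub>MF\<^esub> \<mu>"
proof -
  have ys: "ys \<in> tuples UNIV n" using assms(1) by (simp add: tuples_def)
  have e: "inverse (prod_list ys) * (\<epsilon> * prod_list ys) = \<epsilon>" using assms(3) by simp
  show ?thesis
    unfolding log_volume_form_def assms(1) dwedge_jacobian[OF ys] assms(2) smult_assoc_F[OF \<mu>_closed] e ..
qed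

end

theorem theoremA3:
  fixes K :: "'f::field set" and n :: nat and s :: "'f seed" and U :: "'f ring"
  assumes "subfield K ambient"
    and "is_seed K n s"
    and "U = upper_cluster_algebra K n s"
  shows "free_of_rank_one U (canonical_module K U n) \<and>
    inj_on (canonical_embedding K U n) (carrier (canonical_module K U n)) \<and>
    (\<forall>ys. set ys \<in> clusters n s \<and> distinct ys \<longrightarrow>
       canonical_embedding K U n ` carrier (canonical_module K U n) =
         {a \<odot>\<^bsub>top_forms K ambient n\<^esub> log_volume_form K ys | a. a \<in> carrier U} \<and>
       (\<exists>w \<in> carrier (canonical_module K U n).
          canonical_embedding K U n w = log_volume_form K ys \<and>
          carrier (canonical_module K U n) = {a \<odot>\<^bsub>canonical_module K U n\<^esub> w | a. a \<in> carrier U}))"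
proof -
  have K: "subring K ambient" by (rule subfieldE(1)[OF assms(1)])
  note s = seed_good[OF K assms(2)]
  have gen: "generate_field ambient (K \<union> cvar s ` {1..n}) = UNIV" using assms(2) unfolding is_seed_def by blast
  define C where "C = (\<Inter>Y\<in>clusters n s. laurent_ring K Y)"
  have U: "U = sub C" unfolding assms(3) upper_cluster_algebra_def C_def ..
  have C: "subring C ambient" unfolding C_def by (rule subring_Inter_ambient) (rule laurent_ring_subring)
  have CL: "C \<subseteq> laurent_ring K Y" if "Y \<in> clusters n s" for Y unfolding C_def using that by blast
  have KC: "K \<subseteq> C" unfolding C_def using laurent_const by blast
  have vars: "cvar t i \<in> C" if t: "mutation_equivalent n s t" and i: "i \<in> {1..n}" for t i
    unfolding C_def clusters_def using laurent_phenomenon[OF K s t _ i] by blast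
  obtain \<theta> where \<theta>: "\<And>j. derivation K UNIV (\<theta> j)"
    and \<theta>x: "\<And>i j. i < n \<Longrightarrow> j < n \<Longrightarrow> \<theta> j (cvar s (Suc i)) = (if i = j then cvar s (Suc j) else 0)"
    using log_derivations_exist[OF K good_seedD(3)[OF s] gen] by blast
  let ?xs = "cluster_list n s"
  have Jx: "jacobian \<theta> ?xs = prod_list ?xs" by (rule jacobian_log_derivations[OF \<theta>x])
  note D = K s jacobian_multiderivation[of K UNIV \<theta> n, OF \<theta>] Jx
  have xs0: "prod_list ?xs \<noteq> 0"
    unfolding prod_cluster_list using good_cvar_nonzero[OF s] by (simp only: prod_zero_iff finite_atLeastAtMost) blast
  have "set ?xs \<subseteq> C" unfolding set_cluster_list using vars[OF mutation_equivalent.refl] by blast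
  note xs = cluster_list_tuple[OF this]
  interpret jacobian_ring K C n ?xs \<theta>
  proof (rule jacobian_ring.intro)
    show "\<exists>p\<in>gen (K \<union> set ?xs). \<exists>q\<in>gen (K \<union> set ?xs). q \<noteq> 0 \<and> a * q = p" for a
      unfolding set_cluster_list by (rule generate_field_fraction[OF gen])
    show "jacobian \<theta> as \<in> C" if "as \<in> tuples C n" for as
      unfolding C_def
    proof (rule INT_I)
      fix Y assume Y: "Y \<in> clusters n s"
      have "as \<in> tuples (laurent_ring K Y) n" using that CL[OF Y] by (auto simp: tuples_def)
      then show "jacobian \<theta> as \<in> laurent_ring K Y" by (rule volume_laurent[OF D Y])
    qed
    show "c \<in> C" if "\<And>as. as \<in> tuples C n \<Longrightarrow> c * jacobian \<theta> as \<in> C" for c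
      unfolding C_def
    proof (rule INT_I)
      fix Y assume Y: "Y \<in> clusters n s"
      show "c \<in> laurent_ring K Y" by (rule volume_conductor[OF D Y CL[OF Y] vars that])
    qed
    show "jacobian \<theta> ?xs \<noteq> 0" unfolding Jx by (rule xs0)
  qed (rule C KC subring_one[OF K] xs \<theta>)+
  have carrier: "carrier U = C" unfolding U by simp
  have "free_of_rank_one U (canonical_module K U n)"
    and "inj_on (canonical_embedding K U n) (carrier (canonical_module K U n))"
    unfolding U using canonical_module_free(1,2)[OF subring_one[OF C]] by simp_all
  moreover have "canonical_embedding K U n ` carrier (canonical_module K U n) =
      {a \<odot>\<^bsub>top_forms K ambient n\<^esub> log_volume_form K ys | a. a \<in> carrier U} \<and>
    (\<exists>w \<in> carrier (canonical_module K U n).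
      canonical_embedding K U n w = log_volume_form K ys \<and>
      carrier (canonical_module K U n) = {a \<odot>\<^bsub>canonical_module K U n\<^esub> w | a. a \<in> carrier U})"
    if cl: "set ys \<in> clusters n s" "distinct ys" for ys
  proof -
    note vol = cluster_volume[OF D cl]
    obtain \<epsilon> where \<epsilon>0: "(\<epsilon> = 1 \<or> \<epsilon> = - 1) \<and> jacobian \<theta> ys = \<epsilon> * prod_list ys"
      using conjunct2[OF conjunct2[OF vol]] by (rule exE)
    note \<epsilon> = conjunct1[OF \<epsilon>0]
    note ys = conjunct1[OF vol] conjunct2[OF \<epsilon>0] conjunct1[OF conjunct2[OF vol]]
    have \<epsilon>C: "\<epsilon> \<in> C"
      using \<epsilon> by (elim disjE) (simp_all only: subring_one[OF C] subring_uminus[OF C subring_one[OF C]])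
    have sq: "\<epsilon> * \<epsilon> = 1" using \<epsilon> by (elim disjE) simp_all
    note free = canonical_module_free(3,4)[OF \<epsilon>C sq]
    show ?thesis
      unfolding log_volume_form_multiple[OF ys] carrier unfolding U by (rule conjI[OF free])
  qed
  ultimately show ?thesis by blast
qed

end
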